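(* Let $r\in\mathbb N_0=\{0,1,2,\dots\}$ and $E\ge0$. The set $\mathcal S_r^E$ of all states in $\mathcal S^E$ whose stellar rank is at most $r$ is compact in the trace norm.
   Context: Setting: $\mathcal H=L^2(\mathbb R)$ (one bosonic mode), with position and momentum operators $\hat x,\hat p$ satisfying $[\hat x,\hat p]=i$, annihilation operator $\hat a=(\hat x+i\hat p)/\sqrt2$, number operator $\hat n=\hat a^\dagger\hat a$, and Fock basis $\{|n\rangle\}_{n\ge0}$ of eigenvectors of $\hat n$. States are density operators on $\mathcal H$, viewed in the Banach space of trace-class operators with the trace norm; a pure state is identified with its rank-one projector $|\psi\rangle\langle\psi|$. Stellar rank: for a pure state $|\psi\rangle=\sum_n\psi_n|n\rangle$, $r^\star(\psi)\in\mathbb N_0\cup\{\infty\}$ is the number of zeros in $\mathbb C$, counted with multiplicity, of the entire function $F^\star_\psi(\alpha)=\sum_n\psi_n\alpha^n/\sqrt{n!}$. For a mixed state $\hat\rho$, $r^\star(\hat\rho)=\inf\sup_i r^\star(\psi_i)$, where the infimum is over all decompositions $\hat\rho=\sum_i p_i|\psi_i\rangle\langle\psi_i|$ of $\hat\rho$ as a statistical mixture of pure states (no energy constraint is placed on the $\psi_i$ here). Energy-bounded sets: for a set $S$ of states, $\mathrm{cch}(S)$ is its closed convex hull in trace norm. For $E\ge0$, $\mathcal S^E=\mathrm{cch}\{|\psi\rangle\langle\psi| : \|\psi\|=1,\ \langle\psi|\hat n|\psi\rangle\le E\}$. For $r\in\mathbb N_0$, $\mathcal S_r^E=\{\hat\rho\in\mathcal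 S^E : r^\star(\hat\rho)\le r\}$, i.e. the intersection of $\mathcal S^E$ with the set of states of stellar rank at most $r$.
   Formalization: In the stellar rank of a mixed state, decompositions Σ p_i|ψ_i⟩⟨ψ_i| are widened to integrals of |ψ⟩⟨ψ| over any probability measure on unit vectors; with countable sums only, the set is not closed for E>0 (e.g. r=0, the average of coherent states over a circle). *)

theory Defs
  imports "HOL-Probability.Probability" "HOL-Complex_Analysis.Complex_Analysis"
begin

definition square_integrable :: "(real \<Rightarrow> complex) \<Rightarrow> bool" where
  "square_integrable f \<longleftrightarrow>
     f \<in> borel_measurable lborel \<and> integrable lborel (\<lambda>x. (cmod (f x))\<^sup>2)"

lemma square_integrable_measurable [measurable_dest]:
  "square_integrable f \<Longrightarrow> f \<in> borel_measurable borel"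
  by (simp add: square_integrable_def)

lemma square_integrable_zero: "square_integrable (\<lambda>_. 0)"
  by (simp add: square_integrable_def)

lemma square_integrable_cmult:
  assumes "square_integrable f"
  shows "square_integrable (\<lambda>x. c * f x)"
  using assms by (auto simp: square_integrable_def norm_mult power_mult_distrib)

lemma square_integrable_add:
  assumes f: "square_integrable f" and g: "square_integrable g"
  shows "square_integrable (\<lambda>x. f x + g x)"
proof -
  have [measurable]: "f \<in> borel_measurable borel" "g \<in> borel_measurable borel"
    using f g by (auto simp: square_integrable_def)
  have "integrable lborel (\<lambda>x. 2 * (cmod (f x))\<^sup>2 + 2 * (cmod (g x))\<^sup>2)"
    using f g by (auto simp: square_integrable_def)
  then have "integrable lborel (\<lambda>x. (cmod (f x + g x))\<^sup>2)"
  proof (rule Bochner_Integration.integrable_bound)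
    show "AE x in lborel. norm ((cmod (f x + g x))\<^sup>2)
            \<le> norm (2 * (cmod (f x))\<^sup>2 + 2 * (cmod (g x))\<^sup>2)"
    proof (rule AE_I2)
      fix x
      have "(cmod (f x + g x))\<^sup>2 \<le> (cmod (f x) + cmod (g x))\<^sup>2"
        by (simp add: norm_triangle_ineq power_mono)
      also have "\<dots> \<le> 2 * (cmod (f x))\<^sup>2 + 2 * (cmod (g x))\<^sup>2"
        using sum_squares_bound[of "cmod (f x)" "cmod (g x)"] by (simp add: power2_sum)
      finally show "norm ((cmod (f x + g x))\<^sup>2)
            \<le> norm (2 * (cmod (f x))\<^sup>2 + 2 * (cmod (g x))\<^sup>2)" by simp
    qed
  qed simp
  then show ?thesis by (simp add: square_integrable_def)
qed

lemma integrable_cnj_mult: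
  assumes f: "square_integrable f" and g: "square_integrable g"
  shows "integrable lborel (\<lambda>x. cnj (f x) * g x)"
proof -
  have [measurable]: "f \<in> borel_measurable borel" "g \<in> borel_measurable borel"
    using f g by (auto simp: square_integrable_def)
  have [measurable]: "(\<lambda>x. cnj (f x)) \<in> borel_measurable borel"
    by (rule borel_measurable_continuous_on[OF continuous_on_cnj[OF continuous_on_id]]) simp
  have "integrable lborel (\<lambda>x. (cmod (f x))\<^sup>2 + (cmod (g x))\<^sup>2)"
    using f g by (auto simp: square_integrable_def)
  then show ?thesis
  proof (rule Bochner_Integration.integrable_bound)
    show "AE x in lborel. norm (cnj (f x) * g x) \<le> norm ((cmod (f x))\<^sup>2 + (cmod (g x))\<^sup>2)"
    proof (rule AE_I2)
      fix x
      have "0 \<le> cmod (f x) * cmod (g x)"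
        by (intro mult_nonneg_nonneg norm_ge_zero)
      then show "norm (cnj (f x) * g x) \<le> norm ((cmod (f x))\<^sup>2 + (cmod (g x))\<^sup>2)"
        using sum_squares_bound[of "cmod (f x)" "cmod (g x)"] by (simp add: norm_mult, linarith)
    qed
  qed simp
qed

quotient_type l2 = "real \<Rightarrow> complex" / partial:
  "\<lambda>f g. square_integrable f \<and> square_integrable g \<and> (AE x in lborel. f x = g x)"
proof (rule part_equivpI)
  show "\<exists>f. square_integrable f \<and> square_integrable f \<and> (AE x in lborel. f x = f x)"
    using square_integrable_zero by auto
  show "symp (\<lambda>f g. square_integrable f \<and> square_integrable g \<and> (AE x in lborel. f x = g x))"
    by (auto simp: symp_def elim: eventually_mono)
  show "transp (\<lambda>f g. square_integrable f \<and> square_integrable g \<and> (AE x in lborel. f x = g x))"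
    by (auto simp: transp_def elim: eventually_elim2)
qed

lift_definition cscale :: "complex \<Rightarrow> l2 \<Rightarrow> l2" (infixr \<open>*\<^sub>c\<close> 75) is "\<lambda>c f x. c * f x"
  by (auto simp: square_integrable_cmult elim: eventually_mono)

lift_definition cinner :: "l2 \<Rightarrow> l2 \<Rightarrow> complex" is
  "\<lambda>f g. integral\<^sup>L lborel (\<lambda>x. cnj (f x) * g x)"
proof -
  fix f f' g g' :: "real \<Rightarrow> complex"
  assume f: "square_integrable f \<and> square_integrable f' \<and> (AE x in lborel. f x = f' x)"
    and g: "square_integrable g \<and> square_integrable g' \<and> (AE x in lborel. g x = g' x)"
  show "integral\<^sup>L lborel (\<lambda>x. cnj (f x) * g x) = integral\<^sup>L lborel (\<lambda>x. cnj (f' x) * g' x)"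
  proof (rule integral_cong_AE)
    show "AE x in lborel. cnj (f x) * g x = cnj (f' x) * g' x"
      using f g by (auto elim: eventually_elim2)
  qed (use f g integrable_cnj_mult borel_measurable_integrable in blast)+
qed

instantiation l2 :: real_inner
begin

lift_definition zero_l2 :: l2 is "\<lambda>_. 0"
  by (simp add: square_integrable_zero)

lift_definition plus_l2 :: "l2 \<Rightarrow> l2 \<Rightarrow> l2" is "\<lambda>f g x. f x + g x"
  by (auto simp: square_integrable_add elim: eventually_elim2)

definition scaleR_l2 :: "real \<Rightarrow> l2 \<Rightarrow> l2" where
  "scaleR_l2 r u = complex_of_real r *\<^sub>c u"

definition uminus_l2 :: "l2 \<Rightarrow> l2" where "uminus_l2 u = (-1) *\<^sub>c u"

definition minus_l2 :: "l2 \<Rightarrow> l2 \<Rightarrow> l2" where "minus_l2 u v = u + (-1) *\<^sub>c v"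

definition inner_l2 :: "l2 \<Rightarrow> l2 \<Rightarrow> real" where "inner_l2 u v = Re (cinner u v)"

definition norm_l2 :: "l2 \<Rightarrow> real" where "norm_l2 u = sqrt (u \<bullet> u)"

definition sgn_l2 :: "l2 \<Rightarrow> l2" where "sgn_l2 u = inverse (norm u) *\<^sub>R u"

definition dist_l2 :: "l2 \<Rightarrow> l2 \<Rightarrow> real" where "dist_l2 u v = norm (u - v)"

definition uniformity_l2 :: "(l2 \<times> l2) filter" where
  "uniformity_l2 = (INF e\<in>{0<..}. principal {(u, v). dist u v < e})"

definition open_l2 :: "l2 set \<Rightarrow> bool" where
  "open_l2 U \<longleftrightarrow> (\<forall>u\<in>U. eventually (\<lambda>(u', v). u' = u \<longrightarrow> v \<in> U) uniformity)"

instance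
proof
  show "a + b + c = a + (b + c)" for a b c :: l2
    by transfer (auto simp: square_integrable_add add.assoc)
  show "a + b = b + a" for a b :: l2
    by transfer (auto simp: square_integrable_add add.commute)
  show "0 + a = a" for a :: l2
    by transfer auto
  show "- a + a = 0" for a :: l2
    unfolding uminus_l2_def
    by transfer (auto simp: square_integrable_zero)
  show "a - b = a + - b" for a b :: l2
    by (simp add: uminus_l2_def minus_l2_def)
  show "a *\<^sub>R (x + y) = a *\<^sub>R x + a *\<^sub>R y" for a and x y :: l2
    unfolding scaleR_l2_def
    by transfer (intro conjI square_integrable_cmult square_integrable_add AE_I2; simp add: distrib_left)
  show "(a + b) *\<^sub>R x = a *\<^sub>R x + b *\<^sub>R x" for a b and x :: l2
    unfolding scaleR_l2_def
    by transfer (intro conjI square_integrable_cmult square_integrable_add AE_I2; simp add: distrib_right)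
  show "a *\<^sub>R b *\<^sub>R x = (a * b) *\<^sub>R x" for a b and x :: l2
    unfolding scaleR_l2_def
    by transfer (intro conjI square_integrable_cmult square_integrable_add AE_I2; simp add: mult.assoc)
  show "1 *\<^sub>R x = x" for x :: l2
    unfolding scaleR_l2_def by transfer auto
  show "sgn x = inverse (norm x) *\<^sub>R x" for x :: l2
    by (rule sgn_l2_def)
  show "dist x y = norm (x - y)" for x y :: l2
    by (rule dist_l2_def)
  show "uniformity = (INF e\<in>{0<..}. principal {(x, y). dist (x::l2) y < e})"
    by (rule uniformity_l2_def)
  show "open U \<longleftrightarrow> (\<forall>x\<in>U. eventually (\<lambda>(x', y). x' = x \<longrightarrow> y \<in> U) uniformity)" for U :: "l2 set"
    by (rule open_l2_def)
  have cnj: "cinner x y = cnj (cinner y x)" for x y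
    by transfer (simp add: mult.commute flip: Bochner_Integration.integral_cnj)
  show "x \<bullet> y = y \<bullet> x" for x y :: l2
    unfolding inner_l2_def by (subst cnj) simp
  show "(x + y) \<bullet> z = x \<bullet> z + y \<bullet> z" for x y z :: l2
    unfolding inner_l2_def
    by transfer (simp add: distrib_right Bochner_Integration.integral_add integrable_cnj_mult)
  show "(r *\<^sub>R x) \<bullet> y = r * (x \<bullet> y)" for r and x y :: l2
    unfolding inner_l2_def scaleR_l2_def by transfer (simp add: mult.assoc)
  have self: "square_integrable f \<Longrightarrow>
      Re (integral\<^sup>L lborel (\<lambda>x. cnj (f x) * f x)) = integral\<^sup>L lborel (\<lambda>x. (cmod (f x))\<^sup>2)" for f
  proof -
    have "(\<lambda>x. cnj (f x) * f x) = (\<lambda>x. complex_of_real ((cmod (f x))\<^sup>2))"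
      by (rule ext) (metis complex_norm_square mult.commute)
    then show ?thesis by (simp del: of_real_power)
  qed
  show "0 \<le> x \<bullet> x" for x :: l2
    unfolding inner_l2_def by transfer (simp add: self)
  show "x \<bullet> x = 0 \<longleftrightarrow> x = 0" for x :: l2
    unfolding inner_l2_def
  proof transfer
    fix f assume "square_integrable f \<and> square_integrable f \<and> (AE x in lborel. f x = f x)"
    then have f: "square_integrable f" by simp
    then have "integral\<^sup>L lborel (\<lambda>x. (cmod (f x))\<^sup>2) = 0 \<longleftrightarrow> (AE x in lborel. (cmod (f x))\<^sup>2 = 0)"
      by (intro integral_nonneg_eq_0_iff_AE) (auto simp: square_integrable_def)
    then show "Re (integral\<^sup>L lborel (\<lambda>x. cnj (f x) * f x)) = 0 \<longleftrightarrow>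
        square_integrable f \<and> square_integrable (\<lambda>_. 0) \<and> (AE x in lborel. f x = 0)"
      using f by (simp add: self square_integrable_zero)
  qed
  show "norm x = sqrt (x \<bullet> x)" for x :: l2
    by (rule norm_l2_def)
qed

end

lemma cinner_cscale_right: "cinner u (c *\<^sub>c v) = c * cinner u v"
  by transfer (simp add: mult.left_commute)

lemma cinner_cscale_left: "cinner (c *\<^sub>c u) v = cnj c * cinner u v"
  by transfer (simp add: mult.assoc)

lemma cinner_add_right: "cinner u (v + w) = cinner u v + cinner u w"
  by transfer (simp add: distrib_left Bochner_Integration.integral_add integrable_cnj_mult)

lemma cscale_add_left: "(c + d) *\<^sub>c u = c *\<^sub>c u + d *\<^sub>c u"
  by transfer (intro conjI square_integrable_cmult square_integrable_add AE_I2; simp add: distrib_right)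

lemma cscale_cscale: "c *\<^sub>c d *\<^sub>c u = (c * d) *\<^sub>c u"
  by transfer (intro conjI square_integrable_cmult square_integrable_add AE_I2; simp add: mult.assoc)

lemma scaleR_eq_cscale: "r *\<^sub>R u = complex_of_real r *\<^sub>c u" for u :: l2
  by (rule scaleR_l2_def)

lemma inner_eq_Re_cinner: "u \<bullet> v = Re (cinner u v)"
  by (rule inner_l2_def)

lemma norm_cscale: "norm (c *\<^sub>c u) = cmod c * norm u"
proof -
  have "cinner (c *\<^sub>c u) (c *\<^sub>c u) = (c * cnj c) * cinner u u"
    by (simp add: cinner_cscale_left cinner_cscale_right)
  also have "c * cnj c = complex_of_real ((cmod c)\<^sup>2)"
    by (rule complex_norm_square[symmetric])
  finally have "(c *\<^sub>c u) \<bullet> (c *\<^sub>c u) = (cmod c)\<^sup>2 * (u \<bullet> u)"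
    by (simp add: inner_eq_Re_cinner)
  then show ?thesis by (simp add: norm_eq_sqrt_inner real_sqrt_mult)
qed

lemma cmod_cinner_le: "cmod (cinner u v) \<le> norm u * norm v"
proof -
  define c where "c = cnj (sgn (cinner u v))"
  have "cinner u (c *\<^sub>c v) = (cinner u v * cnj (cinner u v)) / complex_of_real (cmod (cinner u v))"
    by (simp add: c_def cinner_cscale_right sgn_eq)
  also have "\<dots> = complex_of_real (cmod (cinner u v))"
    by (simp add: complex_norm_square[symmetric] power2_eq_square)
  finally have "cinner u (c *\<^sub>c v) = complex_of_real (cmod (cinner u v))" .
  then have "cmod (cinner u v) = u \<bullet> (c *\<^sub>c v)"
    by (simp add: inner_eq_Re_cinner)
  also have "\<dots> \<le> norm u * norm (c *\<^sub>c v)"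
    by (rule norm_cauchy_schwarz)
  also have "\<dots> \<le> norm u * norm v"
    by (intro mult_left_mono) (auto simp: norm_cscale c_def norm_sgn)
  finally show ?thesis .
qed

definition position :: "(real \<Rightarrow> complex) \<Rightarrow> real \<Rightarrow> complex" where
  "position f x = complex_of_real x * f x"

definition momentum :: "(real \<Rightarrow> complex) \<Rightarrow> real \<Rightarrow> complex" where
  "momentum f x = - \<i> * vector_derivative f (at x)"

definition annihilation :: "(real \<Rightarrow> complex) \<Rightarrow> real \<Rightarrow> complex" where
  "annihilation f x = (position f x + \<i> * momentum f x) / complex_of_real (sqrt 2)"

definition creation :: "(real \<Rightarrow> complex) \<Rightarrow> real \<Rightarrow> complex" where
  "creation f x = (position f x - \<i> * momentum f x) / complex_of_real (sqrt 2)"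

definition vacuum_fun :: "real \<Rightarrow> complex" where
  "vacuum_fun x = complex_of_real (pi powr (-1/4) * exp (- x\<^sup>2 / 2))"

text \<open>The phases of the Fock states enter the stellar function; they are fixed here by the
  usual convention that \<open>|n\<rangle>\<close> is \<open>(a\<^sup>\<dagger>)\<^sup>n |0\<rangle> / \<surd>n!\<close>, so the \<open>|n\<rangle>\<close> are the Hermite functions.\<close>

definition fock_fun :: "nat \<Rightarrow> real \<Rightarrow> complex" where
  "fock_fun n x = (creation ^^ n) vacuum_fun x / complex_of_real (sqrt (fact n))"

definition poly_gauss :: "complex poly \<Rightarrow> real \<Rightarrow> complex" where
  "poly_gauss p x = poly p (complex_of_real x) * complex_of_real (exp (- x\<^sup>2 / 2))"

lemma vector_derivative_poly_gauss:
  "vector_derivative (poly_gauss p) (at x) = poly_gauss (pderiv p - [:0, 1:] * p) x"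
proof -
  have "((\<lambda>z. poly p z * exp (- z\<^sup>2 / 2)) has_field_derivative
      (poly (pderiv p) z * exp (- z\<^sup>2 / 2) - z * poly p z * exp (- z\<^sup>2 / 2))) (at z)" for z :: complex
    by (auto intro!: derivative_eq_intros simp: power2_eq_square field_simps)
  from has_vector_derivative_real_field[OF this, of x UNIV]
  have "(poly_gauss p has_vector_derivative poly_gauss (pderiv p - [:0, 1:] * p) x) (at x)"
    by (simp add: poly_gauss_def[abs_def] algebra_simps flip: exp_of_real)
  then show ?thesis by (rule vector_derivative_at)
qed

lemma creation_poly_gauss:
  "creation (poly_gauss p) =
     poly_gauss (smult (1 / complex_of_real (sqrt 2)) ([:0, 2:] * p - pderiv p))"
  by (rule ext) (simp add: creation_def position_def momentum_def vector_derivative_poly_gauss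
      poly_gauss_def algebra_simps diff_divide_distrib add_divide_distrib)

lemma annihilation_poly_gauss:
  "annihilation (poly_gauss p) = poly_gauss (smult (1 / complex_of_real (sqrt 2)) (pderiv p))"
  by (rule ext) (simp add: annihilation_def position_def momentum_def vector_derivative_poly_gauss
      poly_gauss_def algebra_simps diff_divide_distrib add_divide_distrib)

lemma square_integrable_monom_gauss:
  "square_integrable (\<lambda>x. complex_of_real x ^ k * complex_of_real (exp (- x\<^sup>2 / 2)))"
proof -
  have "integrable lborel (\<lambda>x. normal_density 0 (1 / sqrt 2) x * (x - 0) ^ (2 * k))"
    by (rule integrable_normal_moment) simp
  then have "integrable lborel (\<lambda>x. sqrt pi * (normal_density 0 (1 / sqrt 2) x * (x - 0) ^ (2 * k)))"
    by (rule integrable_mult_right)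
  also have "(\<lambda>x. sqrt pi * (normal_density 0 (1 / sqrt 2) x * (x - 0) ^ (2 * k))) =
      (\<lambda>x. (cmod (complex_of_real x ^ k * complex_of_real (exp (- x\<^sup>2 / 2))))\<^sup>2)"
  proof
    fix x :: real
    have "(cmod (complex_of_real x ^ k * complex_of_real (exp (- x\<^sup>2 / 2))))\<^sup>2 =
        (\<bar>x\<bar> ^ k)\<^sup>2 * (exp (- x\<^sup>2 / 2))\<^sup>2"
      by (simp add: norm_mult norm_power power_mult_distrib)
    also have "(\<bar>x\<bar> ^ k)\<^sup>2 = x ^ (2 * k)"
      by (simp add: power_mult flip: power_mult[of _ k 2] mult.commute[of 2 k])
    also have "(exp (- x\<^sup>2 / 2))\<^sup>2 = exp (- x\<^sup>2)"
      by (simp flip: exp_double)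
    finally have 1: "(cmod (complex_of_real x ^ k * complex_of_real (exp (- x\<^sup>2 / 2))))\<^sup>2 =
        x ^ (2 * k) * exp (- x\<^sup>2)" .
    have "normal_density 0 (1 / sqrt 2) x = exp (- x\<^sup>2) / sqrt pi"
      by (simp add: normal_density_def power_divide)
    then show "sqrt pi * (normal_density 0 (1 / sqrt 2) x * (x - 0) ^ (2 * k)) =
        (cmod (complex_of_real x ^ k * complex_of_real (exp (- x\<^sup>2 / 2))))\<^sup>2"
      unfolding 1 by simp
  qed
  finally show ?thesis by (simp add: square_integrable_def)
qed

lemma square_integrable_poly_gauss: "square_integrable (poly_gauss p)"
proof -
  have "square_integrable (\<lambda>x. \<Sum>i\<in>I. coeff p i *
      (complex_of_real x ^ i * complex_of_real (exp (- x\<^sup>2 / 2))))" if "finite I" for I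
    using that
  proof induction
    case empty
    show ?case by (simp add: square_integrable_zero)
  next
    case (insert i I)
    then show ?case
      using square_integrable_add[OF square_integrable_cmult[OF square_integrable_monom_gauss]]
      by simp
  qed
  from this[of "{..degree p}"] show ?thesis
    by (simp add: poly_gauss_def[abs_def] poly_altdef sum_distrib_right mult.assoc)
qed

lemma hermite_ode_smult:
  fixes p :: "complex poly"
  assumes ode: "[:0, 2:] * pderiv p - pderiv (pderiv p) = smult d p"
  shows "[:0, 2:] * pderiv (smult c p) - pderiv (pderiv (smult c p)) = smult d (smult c p)"
  using arg_cong[OF ode, of "smult c"]
  by (simp add: pderiv_smult smult_diff_right mult.commute)

lemma creation_power_vacuum:
  "\<exists>p. (creation ^^ n) vacuum_fun = poly_gauss p \<and>
     [:0, 2:] * pderiv p - pderiv (pderiv p) = smult (2 * of_nat n) p"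
proof (induction n)
  case 0
  show ?case
    by (rule exI[of _ "[:complex_of_real (pi powr (-1/4)):]"])
      (auto simp: vacuum_fun_def poly_gauss_def pderiv_pCons)
next
  case (Suc n)
  then obtain p where p: "(creation ^^ n) vacuum_fun = poly_gauss p"
    and ode: "[:0, 2:] * pderiv p - pderiv (pderiv p) = smult (2 * of_nat n) p" by blast
  define q where "q = [:0, 2:] * p - pderiv p"
  have q': "pderiv q = smult (2 * of_nat (Suc n)) p"
  proof -
    have "pderiv q = smult 2 p + ([:0, 2:] * pderiv p - pderiv (pderiv p))"
      by (simp add: q_def pderiv_diff pderiv_mult pderiv_pCons pderiv_smult)
    also have "\<dots> = smult (2 * of_nat (Suc n)) p"
      by (simp only: ode smult_add_left[symmetric]) (simp add: algebra_simps)
    finally show ?thesis .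
  qed
  have "[:0, 2:] * pderiv q - pderiv (pderiv q) = smult (2 * of_nat (Suc n)) q"
    unfolding q' pderiv_smult by (simp add: smult_diff_right q_def mult_ac del: of_nat_Suc)
  from hermite_ode_smult[OF this] show ?case
    by (intro exI[of _ "smult (1 / complex_of_real (sqrt 2)) q"] conjI)
      (simp_all only: funpow.simps o_apply p creation_poly_gauss q_def)
qed

lemma fock_fun_poly_gauss:
  "\<exists>p. fock_fun n = poly_gauss p \<and>
     [:0, 2:] * pderiv p - pderiv (pderiv p) = smult (2 * of_nat n) p"
proof -
  obtain p where p: "(creation ^^ n) vacuum_fun = poly_gauss p"
    and ode: "[:0, 2:] * pderiv p - pderiv (pderiv p) = smult (2 * of_nat n) p"
    using creation_power_vacuum by blast
  let ?c = "1 / complex_of_real (sqrt (fact n))"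
  have "fock_fun n = poly_gauss (smult ?c p)"
    by (simp add: fun_eq_iff fock_fun_def p poly_gauss_def)
  with hermite_ode_smult[OF ode, of ?c] show ?thesis by blast
qed

lemma number_fock_fun: "creation (annihilation (fock_fun n)) x = of_nat n * fock_fun n x"
proof -
  obtain p where p: "fock_fun n = poly_gauss p"
    and ode: "[:0, 2:] * pderiv p - pderiv (pderiv p) = smult (2 * of_nat n) p"
    using fock_fun_poly_gauss by blast
  define c where "c = 1 / complex_of_real (sqrt 2)"
  have c: "c * c = 1 / 2"
    by (simp add: c_def flip: of_real_mult)
  have "smult c ([:0, 2:] * smult c q - smult c r) = smult (c * c) ([:0, 2:] * q - r)" for q r
    by (simp add: smult_diff_right mult_ac)
  then have "creation (annihilation (fock_fun n)) =
      poly_gauss (smult (1/2) ([:0, 2:] * pderiv p - pderiv (pderiv p)))"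
    unfolding p annihilation_poly_gauss creation_poly_gauss pderiv_smult c_def[symmetric] c
    by simp
  then show ?thesis by (simp only: ode) (simp add: poly_gauss_def p)
qed

lift_definition fock :: "nat \<Rightarrow> l2" is fock_fun
  by (metis (mono_tags, lifting) AE_I2 fock_fun_poly_gauss square_integrable_poly_gauss)

text \<open>The quadratic form of the number operator in its spectral decomposition, with value
  \<open>\<infinity>\<close> outside the form domain.\<close>

definition energy :: "l2 \<Rightarrow> ennreal" where
  "energy \<psi> = (\<Sum>n. ennreal (of_nat n * (cmod (cinner (fock n) \<psi>))\<^sup>2))"

text \<open>Bounded operators are real-linear maps \<^typ>\<open>l2 \<Rightarrow>\<^sub>L l2\<close> that commute with complex
  scalars. On such maps the adjoint with respect to the real inner product
  \<^term>\<open>Re (cinner u v)\<close> is the complex adjoint.\<close>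

definition complex_linear_op :: "(l2 \<Rightarrow>\<^sub>L l2) \<Rightarrow> bool" where
  "complex_linear_op T \<longleftrightarrow> (\<forall>c u. T (c *\<^sub>c u) = c *\<^sub>c T u)"

definition positive_op :: "(l2 \<Rightarrow>\<^sub>L l2) \<Rightarrow> bool" where
  "positive_op T \<longleftrightarrow> complex_linear_op T \<and> (\<forall>u. cinner u (T u) \<in> \<real>\<^sub>\<ge>\<^sub>0)"

definition abs_op :: "(l2 \<Rightarrow>\<^sub>L l2) \<Rightarrow> (l2 \<Rightarrow>\<^sub>L l2)" where
  "abs_op T = (THE P. positive_op P \<and> blinfun_apply (P o\<^sub>L P) = adjoint T \<circ> T)"

definition trace_norm :: "(l2 \<Rightarrow>\<^sub>L l2) \<Rightarrow> ennreal" where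
  "trace_norm T = (\<Sum>n. ennreal (Re (cinner (fock n) (abs_op T (fock n)))))"

definition trace_class :: "(l2 \<Rightarrow>\<^sub>L l2) set" where
  "trace_class = {T. complex_linear_op T \<and> trace_norm T < \<infinity>}"

definition trace_op :: "(l2 \<Rightarrow>\<^sub>L l2) \<Rightarrow> complex" where
  "trace_op T = (\<Sum>n. cinner (fock n) (T (fock n)))"

definition states :: "(l2 \<Rightarrow>\<^sub>L l2) set" where
  "states = {\<rho> \<in> trace_class. positive_op \<rho> \<and> trace_op \<rho> = 1}"

definition trace_norm_topology :: "(l2 \<Rightarrow>\<^sub>L l2) topology" where
  "trace_norm_topology =
     Metric_space.mtopology trace_class (\<lambda>S T. enn2real (trace_norm (S - T)))"

definition cch :: "(l2 \<Rightarrow>\<^sub>L l2) set \<Rightarrow> (l2 \<Rightarrow>\<^sub>L l2) set" where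
  "cch S = trace_norm_topology closure_of (convex hull S)"

lift_definition pure_state :: "l2 \<Rightarrow> (l2 \<Rightarrow>\<^sub>L l2)" is "\<lambda>\<psi> v. cinner \<psi> v *\<^sub>c \<psi>"
proof (rule bounded_linear_intro)
  fix \<psi> u v :: l2 and r :: real
  show "cinner \<psi> (u + v) *\<^sub>c \<psi> = cinner \<psi> u *\<^sub>c \<psi> + cinner \<psi> v *\<^sub>c \<psi>"
    by (simp add: cinner_add_right cscale_add_left)
  show "cinner \<psi> (r *\<^sub>R u) *\<^sub>c \<psi> = r *\<^sub>R (cinner \<psi> u *\<^sub>c \<psi>)"
    by (simp add: scaleR_eq_cscale cinner_cscale_right cscale_cscale)
  have "cmod (cinner \<psi> u) * norm \<psi> \<le> (norm \<psi> * norm u) * norm \<psi>"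
    by (intro mult_right_mono cmod_cinner_le) simp
  then show "norm (cinner \<psi> u *\<^sub>c \<psi>) \<le> norm u * (norm \<psi> * norm \<psi>)"
    by (simp add: norm_cscale mult_ac)
qed

definition stellar_fun :: "l2 \<Rightarrow> complex \<Rightarrow> complex" where
  "stellar_fun \<psi> \<alpha> = (\<Sum>n. cinner (fock n) \<psi> * \<alpha> ^ n / complex_of_real (sqrt (fact n)))"

definition pure_stellar_rank :: "l2 \<Rightarrow> enat" where
  "pure_stellar_rank \<psi> =
     (let Z = {\<alpha>. stellar_fun \<psi> \<alpha> = 0}
      in if finite Z then enat (\<Sum>\<alpha>\<in>Z. nat (zorder (stellar_fun \<psi>) \<alpha>)) else \<infinity>)"

text \<open>A decomposition of \<open>\<rho>\<close> as a statistical mixture of pure states is a probability measure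
  on a set of unit vectors, the possible states \<open>\<psi>\<close> of the mixture, whose barycentre is \<open>\<rho>\<close>.
  The barycentre \<open>\<integral> |\<psi>\<rangle>\<langle>\<psi>| dM(\<psi>)\<close> is expressed through matrix elements. Discrete mixtures
  \<open>\<Sum>i. p\<^sub>i |\<psi>\<^sub>i\<rangle>\<langle>\<psi>\<^sub>i|\<close> are the measures on countable sets. Mixtures over a continuum are needed:
  the average of the coherent states \<open>|\<alpha>\<rangle>\<close> over a circle \<open>|\<alpha>| = R > 0\<close> is a trace norm limit of
  finite mixtures of states of rank 0 with the same energy \<open>R\<^sup>2\<close>, but it is not a countable
  mixture of states of rank 0.\<close>

definition decompositions :: "(l2 \<Rightarrow>\<^sub>L l2) \<Rightarrow> l2 measure set" where
  "decompositions \<rho> =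
     {M. prob_space M \<and> space M \<subseteq> sphere 0 1 \<and>
         sets M = sets (restrict_space borel (space M)) \<and>
         (\<forall>u v. cinner u (\<rho> v) = (LINT \<psi>|M. cinner u (pure_state \<psi> v)))}"

definition stellar_rank :: "(l2 \<Rightarrow>\<^sub>L l2) \<Rightarrow> enat" where
  "stellar_rank \<rho> = (INF M\<in>decompositions \<rho>. SUP \<psi>\<in>space M. pure_stellar_rank \<psi>)"

lemma stellar_rank_discrete_mixture:
  fixes \<rho> :: "l2 \<Rightarrow>\<^sub>L l2" and p :: "'i pmf" and \<psi> :: "'i \<Rightarrow> l2"
  assumes unit: "\<And>i. norm (\<psi> i) = 1"
    and mix: "\<And>u v. cinner u (\<rho> v) = measure_pmf.expectation p (\<lambda>i. cinner u (pure_state (\<psi> i) v))"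
  shows "stellar_rank \<rho> \<le> (SUP i. pure_stellar_rank (\<psi> i))"
proof -
  define B where "B = restrict_space borel (range \<psi>)"
  define M where "M = distr (measure_pmf p) B \<psi>"
  have \<psi>: "\<psi> \<in> measurable (measure_pmf p) B"
    by (auto simp: B_def space_restrict_space)
  have space: "space M = range \<psi>"
    by (simp add: M_def B_def space_restrict_space)
  have cont: "continuous_on UNIV (\<lambda>\<phi>. cinner u (pure_state \<phi> v))" for u v
  proof -
    have *: "cinner a b = complex_of_real (a \<bullet> b) + \<i> * complex_of_real (a \<bullet> ((-\<i>) *\<^sub>c b))" for a b
      by (simp add: inner_eq_Re_cinner cinner_cscale_right complex_eq_iff)
    have "continuous_on UNIV (\<lambda>\<phi>. (-\<i>) *\<^sub>c \<phi>)"
    proof (rule linear_continuous_on, rule bounded_linear_intro)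
      fix a b :: l2 and r :: real
      show "(-\<i>) *\<^sub>c (a + b) = (-\<i>) *\<^sub>c a + (-\<i>) *\<^sub>c b"
        by transfer (intro conjI square_integrable_cmult square_integrable_add AE_I2;
            simp add: distrib_left)
      show "(-\<i>) *\<^sub>c (r *\<^sub>R a) = r *\<^sub>R ((-\<i>) *\<^sub>c a)"
        by (simp add: scaleR_eq_cscale cscale_cscale mult.commute)
      show "norm ((-\<i>) *\<^sub>c a) \<le> norm a * 1" by (simp add: norm_cscale)
    qed
    then have "continuous_on UNIV (\<lambda>\<phi>. cinner \<phi> v)" "continuous_on UNIV (\<lambda>\<phi>. cinner u \<phi>)"
      unfolding * by (intro continuous_intros; assumption)+
    then show ?thesis
      by (simp add: pure_state.rep_eq cinner_cscale_right continuous_on_mult)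
  qed
  have "M \<in> decompositions \<rho>"
    unfolding decompositions_def
  proof (intro CollectI conjI allI)
    show "prob_space M"
      unfolding M_def by (rule measure_pmf.prob_space_distr[OF \<psi>])
    show "space M \<subseteq> sphere 0 1" using unit by (auto simp: space)
    show "sets M = sets (restrict_space borel (space M))"
      by (simp only: space) (simp add: M_def B_def)
    fix u v
    have "(\<lambda>\<phi>. cinner u (pure_state \<phi> v)) \<in> borel_measurable B"
      unfolding B_def by (intro measurable_restrict_space1 borel_measurable_continuous_onI cont)
    then show "cinner u (\<rho> v) = (LINT \<phi>|M. cinner u (pure_state \<phi> v))"
      unfolding mix M_def by (rule integral_distr[OF \<psi>, symmetric])
  qed
  then have "stellar_rank \<rho> \<le> (SUP \<phi>\<in>space M. pure_stellar_rank \<phi>)"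
    unfolding stellar_rank_def by (rule INF_lower)
  then show ?thesis by (simp add: space image_image)
qed

definition energy_bounded :: "real \<Rightarrow> (l2 \<Rightarrow>\<^sub>L l2) set" where
  "energy_bounded E = cch {pure_state \<psi> | \<psi>. norm \<psi> = 1 \<and> energy \<psi> \<le> ennreal E}"

definition energy_bounded_rank :: "nat \<Rightarrow> real \<Rightarrow> (l2 \<Rightarrow>\<^sub>L l2) set" where
  "energy_bounded_rank r E = energy_bounded E \<inter> {\<rho> \<in> states. stellar_rank \<rho> \<le> enat r}"

end

theory Submission
  imports Defs
begin

text \<open>Convergence of states of bounded energy in operator norm already implies convergence in trace
  norm, so it suffices to show that the set is sequentially compact in operator norm. Write states
  \<open>\<rho>\<^sub>k\<close> of the set as barycentres of probability measures \<open>M\<^sub>k\<close> on the unit vectors of stellar rank at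
  most \<open>r\<close>. This set of vectors is closed by Hurwitz' theorem. Since the mean of the energy under
  \<open>M\<^sub>k\<close> is at most \<open>E\<close> and sets of unit vectors of bounded energy are relatively compact, the \<open>M\<^sub>k\<close>
  are tight. In the place of Prokhorov's theorem, an injective Borel coding of vectors of finite
  energy by real numbers, with an inverse that is continuous on the closure of its range, reduces the
  choice of a convergent subsequence to Helly's selection theorem on the real line. Skorokhod's
  theorem then realises the subsequence by almost surely convergent random vectors, whose limit has a
  law \<open>M\<close> on the same closed set. The barycentre of \<open>M\<close> is the limit state.\<close>

section \<open>The Hilbert space of square integrable functions\<close>

text \<open>The energy bound acts at two levels through the same Markov estimate. For a state, the
  Fock levels from \<open>N\<close> on carry weight at most \<open>E / N\<close>, so the trace
  distance of two states is at most \<open>N\<close> times their operator norm distance plus a tail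
  of order sqrt(E/N), uniform in the states. For a decomposition, the diagonal elements of the
  barycentre are averages of squared Fock coefficients, so the mean energy of the pure states is
  that of the mixture. This gives tightness although no single component has bounded energy, and a
  null set of components may even have infinite energy. Membership in
  \<open>energy_bounded E\<close> enters in two ways only: it implies \<open>mean_energy_le\<close>,
  which passes to limits entry by entry, and it is closed in trace norm by the definition of
  \<open>cch\<close>. The obstacle is that the components range over a set of infinite dimension
  that is not compact. Neither a reduction to mixtures of boundedly many terms nor weak compactness
  of all probability measures on that set is available, so tightness has to supply the convergent
  subsequence.\<close>

lemma abs_rep_l2 [simp]: "abs_l2 (rep_l2 u) = u"
  by (rule Quotient3_abs_rep[OF Quotient3_l2])

lemma square_integrable_rep_l2: "square_integrable (rep_l2 u)"
  using Quotient3_rep_reflp[OF Quotient3_l2, of u] by simp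

lemma l2_abs_eq_iff:
  assumes "square_integrable f" "square_integrable g"
  shows "abs_l2 f = abs_l2 g \<longleftrightarrow> (AE x in lborel. f x = g x)"
  using Quotient3_rel_abs[OF Quotient3_l2] Quotient3_rel[OF Quotient3_l2, of f g] assms by auto

lemma cscale_abs: "square_integrable f \<Longrightarrow> c *\<^sub>c abs_l2 f = abs_l2 (\<lambda>x. c * f x)"
  by (rule cscale.abs_eq) simp

lemma plus_abs: "square_integrable f \<Longrightarrow> square_integrable g \<Longrightarrow> abs_l2 f + abs_l2 g = abs_l2 (\<lambda>x. f x + g x)"
  by (rule plus_l2.abs_eq) simp_all

lemma minus_abs:
  assumes "square_integrable f" "square_integrable g"
  shows "abs_l2 f - abs_l2 g = abs_l2 (\<lambda>x. f x - g x)"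
  using plus_abs[OF assms(1) square_integrable_cmult[OF assms(2), of "-1"]] assms
  by (simp add: minus_l2_def cscale_abs)

lemma square_integrable_diff:
  assumes "square_integrable f" "square_integrable g"
  shows "square_integrable (\<lambda>x. f x - g x)"
  using square_integrable_add[OF assms(1) square_integrable_cmult[OF assms(2), of "-1"]] by simp

lemma cinner_abs:
  "square_integrable f \<Longrightarrow> square_integrable g \<Longrightarrow>
    cinner (abs_l2 f) (abs_l2 g) = (\<integral>x. cnj (f x) * g x \<partial>lborel)"
  by (rule cinner.abs_eq) simp_all

lemma norm_abs_l2:
  assumes "square_integrable f"
  shows "(norm (abs_l2 f))\<^sup>2 = (\<integral>x. (cmod (f x))\<^sup>2 \<partial>lborel)"
proof -
  have "(\<lambda>x. cnj (f x) * f x) = (\<lambda>x. complex_of_real ((cmod (f x))\<^sup>2))"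
    by (rule ext) (metis complex_norm_square mult.commute)
  then have "cinner (abs_l2 f) (abs_l2 f) = complex_of_real (\<integral>x. (cmod (f x))\<^sup>2 \<partial>lborel)"
    using assms by (simp add: cinner_abs del: of_real_power)
  then show ?thesis by (simp add: power2_norm_eq_inner inner_eq_Re_cinner)
qed

lemma nn_integral_square_integrable:
  assumes "square_integrable f"
  shows "(\<integral>\<^sup>+x. ennreal ((cmod (f x))\<^sup>2) \<partial>lborel) = ennreal ((norm (abs_l2 f))\<^sup>2)"
  using assms by (simp add: norm_abs_l2 square_integrable_def nn_integral_eq_integral)

section \<open>Completeness of L^2\<close>

text \<open>The squared increments have integrals at most 4^(-k), so even their sum with weights 2^k
  is integrable and hence finite almost everywhere. Where it is finite with value \<open>C\<close>,
  the increments are bounded by the geometric sequence sqrt(C) 2^(-k/2).\<close>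

lemma ae_convergent_of_fast_cauchy:
  fixes f :: "nat \<Rightarrow> real \<Rightarrow> complex"
  assumes f: "\<And>k. square_integrable (f k)"
    and d: "\<And>k. norm (abs_l2 (f (Suc k)) - abs_l2 (f k)) \<le> (1/2) ^ k"
  shows "AE x in lborel. convergent (\<lambda>k. f k x)"
proof -
  have [measurable]: "f k \<in> borel_measurable borel" for k
    using f[of k] by (simp add: square_integrable_def)
  let ?g = "\<lambda>k x. (cmod (f (Suc k) x - f k x))\<^sup>2"
  have "(\<integral>\<^sup>+x. (\<Sum>k. ennreal (2 ^ k * ?g k x)) \<partial>lborel) = (\<Sum>k. \<integral>\<^sup>+x. ennreal (2 ^ k * ?g k x) \<partial>lborel)"
    by (rule nn_integral_suminf) simp
  also have "\<dots> \<le> (\<Sum>k. ennreal ((1/2) ^ k))"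
  proof (intro suminf_le summableI)
    fix k
    have "(\<integral>\<^sup>+x. ennreal (2 ^ k * ?g k x) \<partial>lborel) = ennreal (2 ^ k) * (\<integral>\<^sup>+x. ennreal (?g k x) \<partial>lborel)"
      by (subst nn_integral_cmult[symmetric]) (simp_all add: ennreal_mult')
    also have "\<dots> = ennreal (2 ^ k * (norm (abs_l2 (f (Suc k)) - abs_l2 (f k)))\<^sup>2)"
      by (simp add: nn_integral_square_integrable square_integrable_diff f minus_abs ennreal_mult')
    also have "\<dots> \<le> ennreal (2 ^ k * ((1/2) ^ k)\<^sup>2)"
      by (intro ennreal_leI mult_left_mono power_mono d) auto
    also have "2 ^ k * ((1/2) ^ k)\<^sup>2 = (1/2 :: real) ^ k"
      by (simp add: power2_eq_square field_simps flip: power_mult_distrib)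
    finally show "(\<integral>\<^sup>+x. ennreal (2 ^ k * ?g k x) \<partial>lborel) \<le> ennreal ((1/2) ^ k)" .
  qed
  also have "\<dots> = ennreal (\<Sum>k. (1/2) ^ k)"
    by (intro suminf_ennreal2) (auto simp: summable_geometric)
  finally have "(\<integral>\<^sup>+x. (\<Sum>k. ennreal (2 ^ k * ?g k x)) \<partial>lborel) < \<infinity>"
    by (simp add: le_less_trans ennreal_less_top)
  then have "AE x in lborel. (\<Sum>k. ennreal (2 ^ k * ?g k x)) \<noteq> \<infinity>"
    by (intro nn_integral_PInf_AE) auto
  then show ?thesis
  proof (rule eventually_mono)
    fix x assume fin: "(\<Sum>k. ennreal (2 ^ k * ?g k x)) \<noteq> \<infinity>"
    have sm: "summable (\<lambda>k. 2 ^ k * ?g k x)"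
      by (rule summable_suminf_not_top) (use fin in auto)
    define C where "C = (\<Sum>k. 2 ^ k * ?g k x)"
    have C0: "0 \<le> C" unfolding C_def by (intro suminf_nonneg sm) simp
    have "norm (f (Suc k) x - f k x) \<le> sqrt C * (sqrt (1/2)) ^ k" for k
    proof -
      have "(\<Sum>k\<in>{k}. 2 ^ k * ?g k x) \<le> C"
        unfolding C_def by (rule sum_le_suminf[OF sm]) auto
      then have "?g k x \<le> C * (1/2) ^ k" by (simp add: field_simps)
      then have "cmod (f (Suc k) x - f k x) \<le> sqrt (C * (1/2) ^ k)" by (rule real_le_rsqrt)
      then show ?thesis by (simp add: real_sqrt_mult real_sqrt_power)
    qed
    moreover have "summable (\<lambda>k. sqrt C * (sqrt (1/2)) ^ k)"
      by (intro summable_mult summable_geometric) (simp add: real_sqrt_divide)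
    ultimately have "summable (\<lambda>k. f (Suc k) x - f k x)"
      by (blast intro: summable_comparison_test'[where N = 0])
    then have "convergent (\<lambda>n. \<Sum>k<n. f (Suc k) x - f k x)"
      by (simp add: summable_iff_convergent)
    then have "convergent (\<lambda>n. (f n x - f 0 x) + f 0 x)"
      by (subst (asm) sum_lessThan_telescope) (intro convergent_add convergent_const)
    then show "convergent (\<lambda>k. f k x)" by simp
  qed
qed

text \<open>Riesz-Fischer: a rapidly converging subsequence has representatives that converge almost
  everywhere, and Fatou's lemma turns the closeness of its members to each other into closeness to
  the pointwise limit.\<close>

instance l2 :: banach
proof
  fix X :: "nat \<Rightarrow> l2" assume X: "Cauchy X"
  have "\<exists>N. \<forall>m\<ge>N. \<forall>n\<ge>N. dist (X m) (X n) < (1/2) ^ Suc k" for k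
    using X unfolding Cauchy_def by (elim allE[of _ "(1/2) ^ Suc k"]) simp
  then obtain N where N: "\<And>k m n. N k \<le> m \<Longrightarrow> N k \<le> n \<Longrightarrow> dist (X m) (X n) < (1/2) ^ Suc k"
    by metis
  \<comment> \<open>The sum dominates every \<open>N i\<close> with \<open>i \<le> k\<close>; the
    summand \<open>k\<close> makes the indices strictly increasing.\<close>
  define r where "r k = (\<Sum>i\<le>k. N i) + k" for k
  have r: "strict_mono r" unfolding strict_mono_Suc_iff r_def by auto
  have rN: "N k \<le> r j" if "k \<le> j" for j k
    unfolding r_def using that by (intro trans_le_add1 member_le_sum) auto
  have rd: "dist (X (r i)) (X (r j)) \<le> (1/2) ^ k" if "k \<le> i" "k \<le> j" for i j k
  proof -
    have "dist (X (r i)) (X (r j)) < (1/2) ^ Suc k" by (intro N rN that)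
    also have "\<dots> \<le> (1/2) ^ k" by (rule power_decreasing) auto
    finally show ?thesis by simp
  qed
  define f where "f k = rep_l2 (X (r k))" for k
  have f: "square_integrable (f k)" and Xf: "X (r k) = abs_l2 (f k)" for k
    by (simp_all add: f_def square_integrable_rep_l2)
  have [measurable]: "f k \<in> borel_measurable borel" for k
    using f[of k] by (simp add: square_integrable_def)
  define g where "g x = lim (\<lambda>k. f k x)" for x
  have [measurable]: "g \<in> borel_measurable borel"
    unfolding g_def by measurable
  have ae: "AE x in lborel. (\<lambda>k. f k x) \<longlonglongrightarrow> g x"
  proof -
    have "AE x in lborel. convergent (\<lambda>k. f k x)"
    proof (rule ae_convergent_of_fast_cauchy[OF f])
      show "norm (abs_l2 (f (Suc k)) - abs_l2 (f k)) \<le> (1/2) ^ k" for k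
        using rd[of k "Suc k" k] by (simp add: Xf dist_norm)
    qed
    then show ?thesis by (simp add: g_def convergent_LIMSEQ_iff)
  qed
  have bound: "(\<integral>\<^sup>+x. ennreal ((cmod (g x - f k x))\<^sup>2) \<partial>lborel) \<le> ennreal (((1/2) ^ k)\<^sup>2)" for k
  proof -
    have "(\<integral>\<^sup>+x. ennreal ((cmod (g x - f k x))\<^sup>2) \<partial>lborel) =
        (\<integral>\<^sup>+x. liminf (\<lambda>j. ennreal ((cmod (f j x - f k x))\<^sup>2)) \<partial>lborel)"
    proof (rule nn_integral_cong_AE, use ae in eventually_elim)
      fix x assume "(\<lambda>k. f k x) \<longlonglongrightarrow> g x"
      then have "(\<lambda>j. ennreal ((cmod (f j x - f k x))\<^sup>2)) \<longlonglongrightarrow> ennreal ((cmod (g x - f k x))\<^sup>2)"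
        by (intro tendsto_intros)
      then show "ennreal ((cmod (g x - f k x))\<^sup>2) = liminf (\<lambda>j. ennreal ((cmod (f j x - f k x))\<^sup>2))"
        by (rule lim_imp_Liminf[OF sequentially_bot, symmetric])
    qed
    also have "\<dots> \<le> liminf (\<lambda>j. \<integral>\<^sup>+x. ennreal ((cmod (f j x - f k x))\<^sup>2) \<partial>lborel)"
      by (rule nn_integral_liminf) simp
    also have "\<dots> \<le> ennreal (((1/2) ^ k)\<^sup>2)"
    proof (rule Liminf_le)
      show "\<forall>\<^sub>F j in sequentially. (\<integral>\<^sup>+x. ennreal ((cmod (f j x - f k x))\<^sup>2) \<partial>lborel) \<le> ennreal (((1/2) ^ k)\<^sup>2)"
        using eventually_ge_at_top[of k]
      proof eventually_elim
        case (elim j)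
        have "(\<integral>\<^sup>+x. ennreal ((cmod (f j x - f k x))\<^sup>2) \<partial>lborel) = ennreal ((dist (X (r j)) (X (r k)))\<^sup>2)"
          by (simp add: nn_integral_square_integrable square_integrable_diff f Xf minus_abs dist_norm)
        also have "\<dots> \<le> ennreal (((1/2) ^ k)\<^sup>2)"
          by (intro ennreal_leI power_mono rd) (use elim in auto)
        finally show ?case .
      qed
    qed simp
    finally show ?thesis .
  qed
  have sd: "square_integrable (\<lambda>x. g x - f k x)" for k
    unfolding square_integrable_def
    using bound[of k] by (auto intro!: integrableI_bounded simp: le_less_trans[OF _ ennreal_less_top])
  from square_integrable_add[OF sd[of 0] f[of 0]] have g: "square_integrable g" by simp
  have near: "norm (abs_l2 g - X (r k)) \<le> (1/2) ^ k" for k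
  proof -
    have "ennreal ((norm (abs_l2 g - X (r k)))\<^sup>2) \<le> ennreal (((1/2) ^ k)\<^sup>2)"
      using bound[of k] by (simp add: nn_integral_square_integrable[OF sd] Xf minus_abs g f)
    then have "(norm (abs_l2 g - X (r k)))\<^sup>2 \<le> ((1/2) ^ k)\<^sup>2"
      by (subst (asm) ennreal_le_iff) auto
    then show ?thesis by (rule power2_le_imp_le) simp
  qed
  have "(\<lambda>k. abs_l2 g - X (r k)) \<longlonglongrightarrow> 0"
    by (rule Lim_null_comparison[OF always_eventually[OF allI[OF near]]])
      (rule LIMSEQ_realpow_zero; simp)
  then have "(\<lambda>k. abs_l2 g - (abs_l2 g - X (r k))) \<longlonglongrightarrow> abs_l2 g - 0"
    by (intro tendsto_intros)
  then have "(X \<circ> r) \<longlonglongrightarrow> abs_l2 g" by (simp add: o_def)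
  with X r show "convergent X"
    unfolding convergent_def by (blast intro: Cauchy_converges_subseq)
qed

lemma cinner_commute: "cinner u v = cnj (cinner v u)"
  by transfer (simp add: mult.commute flip: Bochner_Integration.integral_cnj)

lemma cinner_add_left: "cinner (u + v) w = cinner u w + cinner v w"
  by (metis cinner_commute cinner_add_right complex_cnj_add)

interpretation cinner: bounded_bilinear cinner
proof
  show "cinner (u + v) w = cinner u w + cinner v w" for u v w by (rule cinner_add_left)
  show "cinner u (v + w) = cinner u v + cinner u w" for u v w by (rule cinner_add_right)
  show "cinner (r *\<^sub>R u) v = r *\<^sub>R cinner u v" for r u v
    by (simp add: scaleR_eq_cscale cinner_cscale_left scaleR_conv_of_real)
  show "cinner u (r *\<^sub>R v) = r *\<^sub>R cinner u v" for r u v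
    by (simp add: scaleR_eq_cscale cinner_cscale_right scaleR_conv_of_real)
  show "\<exists>K. \<forall>u v. norm (cinner u v) \<le> norm u * norm v * K"
    by (rule exI[of _ 1]) (simp add: cmod_cinner_le)
qed

interpretation cscale: bounded_bilinear cscale
proof
  show "(c + d) *\<^sub>c u = c *\<^sub>c u + d *\<^sub>c u" for c d u by (rule cscale_add_left)
  show "c *\<^sub>c (u + v) = c *\<^sub>c u + c *\<^sub>c v" for c u v
    by transfer (intro conjI square_integrable_cmult square_integrable_add AE_I2; simp add: distrib_left)
  show "(r *\<^sub>R c) *\<^sub>c u = r *\<^sub>R (c *\<^sub>c u)" for r c u
    by (simp add: scaleR_eq_cscale cscale_cscale scaleR_conv_of_real)
  show "c *\<^sub>c (r *\<^sub>R u) = r *\<^sub>R (c *\<^sub>c u)" for r c u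
    by (simp add: scaleR_eq_cscale cscale_cscale mult.commute)
  show "\<exists>K. \<forall>c u. norm (c *\<^sub>c u) \<le> norm c * norm u * K"
    by (rule exI[of _ 1]) (simp add: norm_cscale)
qed

lemma cinner_self: "cinner u u = complex_of_real ((norm u)\<^sup>2)"
proof -
  have "Im (cinner u u) = 0"
    using arg_cong[OF cinner_commute[of u u], of Im] by simp
  moreover have "Re (cinner u u) = (norm u)\<^sup>2"
    by (simp add: power2_norm_eq_inner inner_eq_Re_cinner)
  ultimately show ?thesis by (simp add: complex_eq_iff)
qed

lemma Im_cinner: "Im (cinner u v) = u \<bullet> ((- \<i>) *\<^sub>c v)"
  by (simp add: inner_eq_Re_cinner cinner_cscale_right)

lemma cinner_ext:
  assumes "\<And>w. cinner w u = cinner w v"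
  shows "u = v"
proof -
  have "cinner (u - v) (u - v) = 0"
    using assms by (simp add: cinner.diff_right)
  then show ?thesis by (simp add: cinner_self)
qed

section \<open>The Fock basis\<close>

text \<open>These are pi^(-1/4) 2^(-n/2) H_n for the physicists' Hermite polynomials H_n. The
  recursion is the action of \<open>creation\<close> on the polynomial factor of
  \<open>poly_gauss\<close>.\<close>

fun hermite :: "nat \<Rightarrow> complex poly" where
  "hermite 0 = [:complex_of_real (pi powr (-1/4)):]"
| "hermite (Suc n) = smult (1 / complex_of_real (sqrt 2)) ([:0, 2:] * hermite n - pderiv (hermite n))"

lemma creation_power_hermite: "(creation ^^ n) vacuum_fun = poly_gauss (hermite n)"
proof (induction n)
  case 0
  show ?case by (auto simp: vacuum_fun_def poly_gauss_def fun_eq_iff)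
next
  case (Suc n)
  then show ?case by (simp only: funpow.simps o_apply creation_poly_gauss hermite.simps)
qed

lemma sqrt2_mult: "complex_of_real (sqrt 2) * complex_of_real (sqrt 2) = 2"
  by (simp flip: of_real_mult)

lemma sqrt2_nonzero: "complex_of_real (sqrt 2) \<noteq> 0" by simp

lemma hermite_Suc_mult:
  "[:0, 2:] * hermite n - pderiv (hermite n) = smult (complex_of_real (sqrt 2)) (hermite (Suc n))"
  by simp

declare hermite.simps(2) [simp del]

text \<open>The lowering relation for Fock states: differentiation is \<open>annihilation\<close> up
  to a factor, and its commutator with 2x - d/dx is 2, which raises the eigenvalue by one in each
  induction step. For \<open>n = 0\<close> the factor \<open>of_nat n\<close> vanishes, so the
  truncated \<open>n - 1\<close> does no harm.\<close>

lemma pderiv_hermite: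
  "pderiv (hermite n) = smult (of_nat n * complex_of_real (sqrt 2)) (hermite (n - 1))"
proof (induction n)
  case 0
  show ?case by (simp add: pderiv_pCons)
next
  case (Suc n)
  let ?s = "complex_of_real (sqrt 2)"
  have "pderiv (hermite (Suc n)) = smult (1 / ?s)
      (smult 2 (hermite n) + ([:0, 2:] * pderiv (hermite n) - pderiv (pderiv (hermite n))))"
    by (simp add: hermite.simps(2) pderiv_smult pderiv_diff pderiv_mult pderiv_pCons add_diff_eq)
  also have "[:0, 2:] * pderiv (hermite n) - pderiv (pderiv (hermite n)) = smult (2 * of_nat n) (hermite n)"
  proof (cases n)
    case 0
    then show ?thesis by (simp add: pderiv_pCons)
  next
    case (Suc m)
    have "[:0, 2:] * pderiv (hermite n) - pderiv (pderiv (hermite n)) =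
        smult (of_nat n * ?s) ([:0, 2:] * hermite m - pderiv (hermite m))"
      unfolding Suc.IH pderiv_smult using Suc
      by (simp add: smult_diff_right mult_ac del: of_nat_Suc)
    also have "\<dots> = smult (2 * of_nat n) (hermite n)"
      unfolding hermite_Suc_mult using Suc
      by (simp add: mult.assoc sqrt2_mult del: of_nat_Suc) (simp only: mult.commute)
    finally show ?thesis .
  qed
  also have "smult (1 / ?s) (smult 2 (hermite n) + smult (2 * of_nat n) (hermite n)) =
      smult (of_nat (Suc n) * ?s) (hermite n)"
  proof -
    have "1 / ?s * 2 = ?s" using sqrt2_mult sqrt2_nonzero by (simp add: field_simps)
    then have "1 / ?s * (2 + 2 * of_nat n) = of_nat (Suc n) * ?s"
      by (metis (no_types, opaque_lifting) distrib_left mult.assoc mult.commute mult.right_neutral of_nat_Suc)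
    then show ?thesis by (simp only: smult_smult flip: smult_add_left)
  qed
  finally show ?case by simp
qed

lemma fock_eq: "fock n = abs_l2 (poly_gauss (smult (1 / complex_of_real (sqrt (fact n))) (hermite n)))"
proof -
  have "fock_fun n = poly_gauss (smult (1 / complex_of_real (sqrt (fact n))) (hermite n))"
    by (simp add: fun_eq_iff fock_fun_def creation_power_hermite poly_gauss_def)
  then show ?thesis by (simp add: fock_def)
qed

section \<open>Orthonormality of the Hermite functions\<close>

text \<open>The inner product of polynomials with weight exp(-x^2), for which the Hermite
  polynomials are orthogonal.\<close>

definition gauss_inner :: "complex poly \<Rightarrow> complex poly \<Rightarrow> complex" where
  "gauss_inner p q = cinner (abs_l2 (poly_gauss p)) (abs_l2 (poly_gauss q))"

lemma gauss_inner_integral: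
  "gauss_inner p q = (\<integral>x. cnj (poly_gauss p x) * poly_gauss q x \<partial>lborel)"
  by (simp add: gauss_inner_def cinner_abs square_integrable_poly_gauss)

lemma abs_poly_gauss_add: "abs_l2 (poly_gauss (p + q)) = abs_l2 (poly_gauss p) + abs_l2 (poly_gauss q)"
  by (simp add: plus_abs square_integrable_poly_gauss) (simp add: poly_gauss_def[abs_def] distrib_right)

lemma abs_poly_gauss_diff: "abs_l2 (poly_gauss (p - q)) = abs_l2 (poly_gauss p) - abs_l2 (poly_gauss q)"
  by (simp add: minus_abs square_integrable_poly_gauss) (simp add: poly_gauss_def[abs_def] left_diff_distrib)

lemma abs_poly_gauss_smult: "abs_l2 (poly_gauss (smult c p)) = c *\<^sub>c abs_l2 (poly_gauss p)"
  by (simp add: cscale_abs square_integrable_poly_gauss) (simp add: poly_gauss_def[abs_def] mult.assoc)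

lemma poly_gauss_has_vector_derivative:
  "(poly_gauss p has_vector_derivative poly_gauss (pderiv p - [:0, 1:] * p) x) (at x)"
proof -
  have "((\<lambda>z. poly p z * exp (- z\<^sup>2 / 2)) has_field_derivative
      (poly (pderiv p) z * exp (- z\<^sup>2 / 2) - z * poly p z * exp (- z\<^sup>2 / 2))) (at z)" for z :: complex
    by (auto intro!: derivative_eq_intros simp: power2_eq_square field_simps)
  from has_vector_derivative_real_field[OF this, of x UNIV]
  show ?thesis
    by (simp add: poly_gauss_def[abs_def] algebra_simps flip: exp_of_real)
qed

lemma continuous_poly_gauss: "isCont (poly_gauss p) x"
  using poly_gauss_has_vector_derivative has_vector_derivative_continuous by blast

lemma monom_gauss_at_top: "((\<lambda>x::real. x ^ k * exp (- x\<^sup>2 / 2)) \<longlongrightarrow> 0) at_top"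
proof (rule Lim_null_comparison[OF _ tendsto_power_div_exp_0])
  show "\<forall>\<^sub>F x in at_top. norm (x ^ k * exp (- x\<^sup>2 / 2)) \<le> x ^ k / exp x"
    using eventually_ge_at_top[of 2]
  proof eventually_elim
    case (elim x)
    then have "x * 2 \<le> x * x" by (intro mult_left_mono) auto
    then have "exp (- x\<^sup>2 / 2) \<le> exp (- x)" by (simp add: power2_eq_square)
    then show ?case using elim by (simp add: exp_minus field_simps)
  qed
qed

lemma poly_gauss_tendsto_at_top: "(poly_gauss p \<longlongrightarrow> 0) at_top"
proof -
  have "((\<lambda>x. \<Sum>i\<le>degree p. coeff p i * complex_of_real (x ^ i * exp (- x\<^sup>2 / 2))) \<longlongrightarrow>
      (\<Sum>i\<le>degree p. coeff p i * complex_of_real 0)) at_top"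
    by (intro tendsto_intros monom_gauss_at_top)
  then show ?thesis
    by (simp add: poly_gauss_def[abs_def] poly_altdef sum_distrib_right mult.assoc)
qed

lemma poly_gauss_tendsto_at_bot: "(poly_gauss p \<longlongrightarrow> 0) at_bot"
proof -
  have "poly_gauss p (- x) = poly_gauss (pcompose p [:0, -1:]) x" for x
    by (simp add: poly_gauss_def poly_pcompose)
  then show ?thesis
    using poly_gauss_tendsto_at_top[of "pcompose p [:0, -1:]"] by (simp add: filterlim_at_bot_mirror)
qed

text \<open>Integration by parts over the whole line: \<open>pderiv p - [:0, 1:] * p\<close> is the
  polynomial factor of the derivative of \<open>poly_gauss p\<close>, and the boundary terms vanish
  by the Gaussian decay.\<close>

lemma gauss_inner_parts:
  "gauss_inner (pderiv p - [:0, 1:] * p) q + gauss_inner p (pderiv q - [:0, 1:] * q) = 0"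
proof -
  let ?G = "\<lambda>x. cnj (poly_gauss p x) * poly_gauss q x"
  let ?g1 = "\<lambda>x. cnj (poly_gauss (pderiv p - [:0, 1:] * p) x) * poly_gauss q x"
  let ?g2 = "\<lambda>x. cnj (poly_gauss p x) * poly_gauss (pderiv q - [:0, 1:] * q) x"
  have int: "integrable lborel ?g1" "integrable lborel ?g2"
    by (intro integrable_cnj_mult square_integrable_poly_gauss)+
  have "(LBINT x=-\<infinity>..\<infinity>. ?g1 x + ?g2 x) = 0 - 0"
  proof (rule interval_integral_FTC_integrable[where F = ?G])
    show "(?G has_vector_derivative ?g1 x + ?g2 x) (at x)" for x :: real
      using has_vector_derivative_mult[OF has_vector_derivative_cnj[OF poly_gauss_has_vector_derivative[of p x]]
          poly_gauss_has_vector_derivative[of q x]]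
      by (simp add: add.commute)
    show "isCont (\<lambda>x. ?g1 x + ?g2 x) x" for x :: real
      by (intro continuous_intros continuous_poly_gauss isCont_cnj)
    show "set_integrable lborel (einterval (- \<infinity>) \<infinity>) (\<lambda>x. ?g1 x + ?g2 x)"
      using int by (simp add: set_integrable_def)
    have top: "(?G \<longlongrightarrow> cnj 0 * 0) at_top" and bot: "(?G \<longlongrightarrow> cnj 0 * 0) at_bot"
      by (intro tendsto_intros poly_gauss_tendsto_at_top poly_gauss_tendsto_at_bot)+
    show "((?G \<circ> real_of_ereal) \<longlongrightarrow> 0) (at_right (- \<infinity>))"
      using bot by (simp add: ereal_tendsto_simps)
    show "((?G \<circ> real_of_ereal) \<longlongrightarrow> 0) (at_left \<infinity>)"
      using top by (simp add: ereal_tendsto_simps)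
  qed simp
  then have "(\<integral>x. ?g1 x + ?g2 x \<partial>lborel) = 0"
    by (simp add: interval_lebesgue_integral_def set_lebesgue_integral_def)
  then show ?thesis
    using int by (simp add: gauss_inner_integral Bochner_Integration.integral_add)
qed

lemma gauss_inner_mult_var: "gauss_inner ([:0, 1:] * p) q = gauss_inner p ([:0, 1:] * q)"
  unfolding gauss_inner_integral by (simp add: poly_gauss_def mult_ac)

lemma gauss_inner_diff_left: "gauss_inner (p - q) r = gauss_inner p r - gauss_inner q r"
  by (simp add: gauss_inner_def abs_poly_gauss_diff cinner.diff_left)

lemma gauss_inner_diff_right: "gauss_inner p (q - r) = gauss_inner p q - gauss_inner p r"
  by (simp add: gauss_inner_def abs_poly_gauss_diff cinner.diff_right)

lemma gauss_inner_smult_left: "gauss_inner (smult c p) r = cnj c * gauss_inner p r"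
  by (simp add: gauss_inner_def abs_poly_gauss_smult cinner_cscale_left)

lemma gauss_inner_smult_right: "gauss_inner p (smult c r) = c * gauss_inner p r"
  by (simp add: gauss_inner_def abs_poly_gauss_smult cinner_cscale_right)

text \<open>Adjointness of \<open>creation\<close> and \<open>annihilation\<close>, read on
  polynomial factors and without the common factor 1/sqrt 2. Multiplication by x is symmetric and
  the derivative of the full function is skew, which leaves only \<open>pderiv q\<close> on the
  right.\<close>

lemma gauss_inner_creation:
  "gauss_inner ([:0, 2:] * p - pderiv p) q = gauss_inner p (pderiv q)"
proof -
  define u v where "u = [:0, 1:] * p" and "v = [:0, 1:] * q"
  have two: "[:0, 2:] * p = smult 2 u" by (simp add: u_def)
  show ?thesis
    using gauss_inner_parts[of p q] gauss_inner_mult_var[of p q]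
    unfolding two u_def[symmetric] v_def[symmetric]
    by (simp add: gauss_inner_diff_left gauss_inner_diff_right gauss_inner_smult_left algebra_simps)
qed

lemma gauss_inner_hermite_Suc:
  "gauss_inner (hermite (Suc m)) (hermite n) = of_nat n * gauss_inner (hermite m) (hermite (n - 1))"
  by (simp only: hermite.simps(2) gauss_inner_smult_left gauss_inner_creation pderiv_hermite[of n]
      gauss_inner_smult_right) simp

lemma gauss_inner_hermite_0: "gauss_inner (hermite 0) (hermite 0) = 1"
proof -
  have "cnj (poly_gauss (hermite 0) x) * poly_gauss (hermite 0) x =
      complex_of_real (normal_density 0 (1 / sqrt 2) x)" for x
  proof -
    have "pi powr (-1/4) * pi powr (-1/4) = pi powr (-(1/2))" by (simp flip: powr_add)
    also have "\<dots> = 1 / sqrt pi" by (simp only: powr_minus_divide powr_half_sqrt pi_ge_zero)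
    finally have 1: "pi powr (-1/4) * pi powr (-1/4) = 1 / sqrt pi" .
    have 2: "exp (- x\<^sup>2 / 2) * exp (- x\<^sup>2 / 2) = exp (- x\<^sup>2)" by (simp flip: exp_add)
    have "cnj (poly_gauss (hermite 0) x) * poly_gauss (hermite 0) x =
      complex_of_real ((pi powr (-1/4) * pi powr (-1/4)) * (exp (- x\<^sup>2 / 2) * exp (- x\<^sup>2 / 2)))"
      by (simp add: poly_gauss_def)
    then show ?thesis unfolding 1 2 by (simp add: normal_density_def power_divide)
  qed
  then show ?thesis by (simp add: gauss_inner_integral)
qed

text \<open>Moving one creation operator to the other side lowers both indices by one. The base case
  with \<open>n > 0\<close> needs the conjugate symmetry, since there only the right argument can be
  lowered.\<close>

lemma gauss_inner_hermite: "gauss_inner (hermite m) (hermite n) = (if m = n then fact n else 0)"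
proof (induction m arbitrary: n)
  case 0
  show ?case
  proof (cases n)
    case (Suc k)
    have "gauss_inner (hermite 0) (hermite n) = cnj (gauss_inner (hermite n) (hermite 0))"
      unfolding gauss_inner_def by (rule cinner_commute)
    then show ?thesis using Suc by (simp add: gauss_inner_hermite_Suc del: hermite.simps)
  qed (simp add: gauss_inner_hermite_0 del: hermite.simps)
next
  case (Suc m)
  show ?case
    by (cases n) (simp_all add: gauss_inner_hermite_Suc Suc del: hermite.simps)
qed

lemma cinner_fock: "cinner (fock m) (fock n) = (if m = n then 1 else 0)"
proof -
  have "complex_of_real (sqrt (fact n)) * complex_of_real (sqrt (fact n)) = fact n"
    by (simp flip: of_real_mult)
  then show ?thesis
    by (simp add: fock_eq gauss_inner_smult_left gauss_inner_smult_right gauss_inner_hermite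
        flip: gauss_inner_def)
qed

section \<open>Completeness of the Fock basis\<close>

lemma cis_partial_sum_bound:
  fixes t x :: real
  shows "cmod (\<Sum>k<n. (\<i> * complex_of_real (t * x)) ^ k / fact k) \<le> exp (\<bar>t\<bar> * \<bar>x\<bar>)"
proof -
  have "cmod (\<Sum>k<n. (\<i> * complex_of_real (t * x)) ^ k / fact k) \<le> (\<Sum>k<n. (\<bar>t\<bar> * \<bar>x\<bar>) ^ k / fact k)"
    by (rule sum_norm_le) (simp add: norm_divide norm_power norm_mult abs_mult)
  also have "\<dots> \<le> (\<Sum>k. (\<bar>t\<bar> * \<bar>x\<bar>) ^ k / fact k)"
    using summable_exp[of "\<bar>t\<bar> * \<bar>x\<bar>"]
    by (intro sum_le_suminf) (auto simp: divide_inverse mult.commute)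
  also have "\<dots> = exp (\<bar>t\<bar> * \<bar>x\<bar>)"
    by (simp add: exp_def scaleR_conv_of_real divide_inverse mult.commute)
  finally show ?thesis .
qed

text \<open>The partial sums of the exponential series give integrals that are combinations of
  moments, hence 0. They are dominated by \<open>exp (\<bar>t\<bar> * \<bar>x\<bar>) * h x\<close>,
  so dominated convergence applies for every real \<open>t\<close>, without a radius of
  convergence.\<close>

lemma fourier_zero_of_moments_zero:
  fixes h :: "real \<Rightarrow> real"
  assumes [measurable]: "h \<in> borel_measurable borel"
    and expint: "\<And>t. integrable lborel (\<lambda>x. exp (\<bar>t\<bar> * \<bar>x\<bar>) * h x)"
    and moments: "\<And>k. (\<integral>x. x ^ k * h x \<partial>lborel) = 0"
  shows "(\<integral>x. exp (\<i> * complex_of_real (t * x)) * complex_of_real (h x) \<partial>lborel) = 0"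
proof -
  let ?s = "\<lambda>n x. (\<Sum>k<n. (\<i> * complex_of_real (t * x)) ^ k / fact k) * complex_of_real (h x)"
  have int_k: "integrable lborel (\<lambda>x. x ^ k * h x)" for k
  proof (rule Bochner_Integration.integrable_bound)
    show "integrable lborel (\<lambda>x. fact k * (exp (\<bar>1\<bar> * \<bar>x\<bar>) * h x))"
      using expint[of 1] by simp
    have "\<bar>x\<bar> ^ k \<le> fact k * exp \<bar>x\<bar>" for x :: real
    proof -
      have "(\<Sum>j\<in>{k}. \<bar>x\<bar> ^ j / fact j) \<le> (\<Sum>j. \<bar>x\<bar> ^ j / fact j)"
        using summable_exp[of "\<bar>x\<bar>"] by (intro sum_le_suminf) (auto simp: divide_inverse mult.commute)
      also have "\<dots> = exp \<bar>x\<bar>"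
        by (simp add: exp_def scaleR_conv_of_real divide_inverse mult.commute)
      finally show ?thesis by (simp add: field_simps)
    qed
    then show "AE x in lborel. norm (x ^ k * h x) \<le> norm (fact k * (exp (\<bar>1\<bar> * \<bar>x\<bar>) * h x))"
      by (intro AE_I2) (simp add: norm_mult abs_mult norm_power power_abs mult_right_mono flip: mult.assoc)
  qed simp
  have "(\<integral>x. ?s n x \<partial>lborel) = 0" for n
  proof -
    have "(\<integral>x. ?s n x \<partial>lborel) =
        (\<integral>x. (\<Sum>k<n. (\<i> * complex_of_real t) ^ k / fact k * complex_of_real (x ^ k * h x)) \<partial>lborel)"
      by (intro Bochner_Integration.integral_cong refl)
        (unfold sum_distrib_right, intro sum.cong refl, simp add: power_mult_distrib)
    also have "\<dots> = (\<Sum>k<n. (\<i> * complex_of_real t) ^ k / fact k *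
        (\<integral>x. complex_of_real (x ^ k * h x) \<partial>lborel))"
      using int_k by (subst Bochner_Integration.integral_sum)
        (auto intro!: integrable_mult_right integrable_of_real simp del: of_real_mult of_real_power)
    also have "\<dots> = 0" using moments by (simp del: of_real_mult of_real_power)
    finally show ?thesis .
  qed
  moreover have "(\<lambda>n. \<integral>x. ?s n x \<partial>lborel) \<longlonglongrightarrow>
      (\<integral>x. exp (\<i> * complex_of_real (t * x)) * complex_of_real (h x) \<partial>lborel)"
  proof (rule integral_dominated_convergence)
    show "integrable lborel (\<lambda>x. norm (exp (\<bar>t\<bar> * \<bar>x\<bar>) * h x))"
      using expint by (rule integrable_norm)
    show "AE x in lborel. (\<lambda>n. ?s n x) \<longlonglongrightarrow> exp (\<i> * complex_of_real (t * x)) * complex_of_real (h x)"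
    proof (rule AE_I2)
      fix x :: real
      have "(\<lambda>n. (\<Sum>k<n. (\<i> * complex_of_real (t * x)) ^ k / fact k)) \<longlonglongrightarrow> exp (\<i> * complex_of_real (t * x))"
        using exp_converges[of "\<i> * complex_of_real (t * x)"]
        by (simp add: sums_def scaleR_conv_of_real divide_inverse mult.commute)
      then show "(\<lambda>n. ?s n x) \<longlonglongrightarrow> exp (\<i> * complex_of_real (t * x)) * complex_of_real (h x)"
        by (rule tendsto_mult_right)
    qed
    show "AE x in lborel. norm (?s n x) \<le> norm (exp (\<bar>t\<bar> * \<bar>x\<bar>) * h x)" for n
      unfolding norm_mult
      by (intro AE_I2 mult_mono) (use cis_partial_sum_bound in auto)
  qed measurable
  ultimately show ?thesis by (simp add: LIMSEQ_const_iff)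
qed

text \<open>The positive and the negative part of \<open>h\<close> have the same Fourier transform, so that they
  are densities of the same measure.\<close>

lemma zero_of_fourier_zero:
  fixes h :: "real \<Rightarrow> real"
  assumes h: "integrable lborel h"
    and fourier: "\<And>t. (\<integral>x. exp (\<i> * complex_of_real (t * x)) * complex_of_real (h x) \<partial>lborel) = 0"
  shows "AE x in lborel. h x = 0"
proof -
  have [measurable]: "h \<in> borel_measurable borel" using h by auto
  define p where "p x = max 0 (h x)" for x
  define m where "m x = max 0 (- h x)" for x
  have [measurable]: "p \<in> borel_measurable borel" "m \<in> borel_measurable borel"
    unfolding p_def m_def by measurable
  have p: "integrable lborel p" and m: "integrable lborel m"
    unfolding p_def m_def using h by auto
  have h_eq: "h x = p x - m x" for x by (simp add: p_def m_def)
  have p0: "0 \<le> p x" and m0: "0 \<le> m x" for x by (simp_all add: p_def m_def)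
  \<comment> \<open>The common total mass of \<open>p\<close> and \<open>m\<close>, by the Fourier
    transform at 0. Division by it gives probability densities, to which Levy's uniqueness theorem
    applies.\<close>
  define c where "c = (\<integral>x. p x \<partial>lborel)"
  have c0: "0 \<le> c" unfolding c_def by (simp add: p0)
  have four_int: "integrable lborel (\<lambda>x. exp (\<i> * complex_of_real (t * x)) * complex_of_real (q x))"
    if "integrable lborel q" for q t
  proof (rule Bochner_Integration.integrable_bound)
    show "integrable lborel q" by fact
    show "AE x in lborel. norm (exp (\<i> * complex_of_real (t * x)) * complex_of_real (q x)) \<le> norm (q x)"
      by (simp add: norm_mult)
    have [measurable]: "q \<in> borel_measurable borel" using that by auto
    show "(\<lambda>x. exp (\<i> * complex_of_real (t * x)) * complex_of_real (q x)) \<in> borel_measurable lborel"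
      by measurable
  qed
  have four_eq: "(\<integral>x. exp (\<i> * complex_of_real (t * x)) * complex_of_real (p x) \<partial>lborel) =
      (\<integral>x. exp (\<i> * complex_of_real (t * x)) * complex_of_real (m x) \<partial>lborel)" for t
    using fourier[of t] Bochner_Integration.integral_diff[OF four_int[OF p] four_int[OF m], of t t]
    by (simp add: h_eq algebra_simps)
  have cm: "(\<integral>x. m x \<partial>lborel) = c"
    using four_eq[of 0] by (simp add: c_def)
  show ?thesis
  proof (cases "c = 0")
    case True
    have "AE x in lborel. p x = 0" "AE x in lborel. m x = 0"
      using integral_nonneg_eq_0_iff_AE[OF p] integral_nonneg_eq_0_iff_AE[OF m] p0 m0 True cm
      by (simp_all add: c_def)
    then show ?thesis by eventually_elim (simp add: h_eq)
  next
    case False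
    then have c: "0 < c" using c0 by simp
    define D where "D q = density lborel (\<lambda>x :: real. ennreal (q x / c))" for q
    have D_prob: "real_distribution (D q)"
      if q: "integrable lborel q" "\<And>x. 0 \<le> q x" "(\<integral>x. q x \<partial>lborel) = c" for q
    proof -
      have [measurable]: "q \<in> borel_measurable borel" using q by auto
      have "emeasure (D q) (space (D q)) = (\<integral>\<^sup>+x. ennreal (q x / c) \<partial>lborel)"
        by (simp add: D_def emeasure_density)
      also have "\<dots> = ennreal (\<integral>x. q x / c \<partial>lborel)"
        using q c by (intro nn_integral_eq_integral) auto
      also have "\<dots> = 1" using q c by simp
      finally have "prob_space (D q)" by (rule prob_spaceI)
      then show ?thesis
        by (simp add: real_distribution_def real_distribution_axioms_def D_def)
    qed
    have D_char: "char (D q) t = (\<integral>x. exp (\<i> * complex_of_real (t * x)) * complex_of_real (q x) \<partial>lborel) / complex_of_real c"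
      if q: "integrable lborel q" "\<And>x. 0 \<le> q x" for q t
    proof -
      have [measurable]: "q \<in> borel_measurable borel" using q by auto
      have "char (D q) t = (\<integral>x. (q x / c) *\<^sub>R exp (\<i> * complex_of_real (t * x)) \<partial>lborel)"
        unfolding char_def D_def using q c
        by (subst integral_density) (auto intro!: AE_I2 simp: mult.commute cis_conv_exp)
      also have "\<dots> = (\<integral>x. exp (\<i> * complex_of_real (t * x)) * complex_of_real (q x) / complex_of_real c \<partial>lborel)"
        by (simp add: scaleR_conv_of_real mult.commute)
      finally show ?thesis by simp
    qed
    have "D p = D m"
      by (rule Levy_uniqueness) (auto simp: D_prob p m p0 m0 cm c_def[symmetric] D_char four_eq fun_eq_iff simp del: of_real_mult)
    then have "AE x in lborel. ennreal (p x / c) = ennreal (m x / c)"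
      unfolding D_def by (subst (asm) sigma_finite_measure.density_unique_iff[OF sigma_finite_lborel]) auto
    then show ?thesis
      by eventually_elim (use c p0 m0 in \<open>simp add: h_eq\<close>)
  qed
qed

text \<open>From (|t| - |x|/2)^2 >= 0. One half of the exponent of the Gaussian pays for the
  exponential growth; the other half stays as a square integrable factor.\<close>

lemma exp_square_shift: "exp (\<bar>t\<bar> * \<bar>x\<bar>) * exp (- x\<^sup>2 / 2) \<le> exp (t\<^sup>2) * exp (- (x / 2)\<^sup>2)" for t x :: real
proof -
  have "0 \<le> (\<bar>t\<bar> - \<bar>x\<bar> / 2)\<^sup>2" by simp
  also have "\<dots> = t\<^sup>2 + (x / 2)\<^sup>2 - \<bar>t\<bar> * \<bar>x\<bar>" by (simp add: power2_diff power_divide)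
  finally have "\<bar>t\<bar> * \<bar>x\<bar> + - x\<^sup>2 / 2 \<le> t\<^sup>2 + - (x / 2)\<^sup>2" by (simp add: power_divide)
  then show ?thesis by (simp flip: exp_add)
qed

lemma zero_of_gauss_moments_zero:
  fixes g :: "real \<Rightarrow> real"
  assumes [measurable]: "g \<in> borel_measurable borel"
    and g2: "integrable lborel (\<lambda>x. (g x)\<^sup>2)"
    and moments: "\<And>k. (\<integral>x. x ^ k * (exp (- x\<^sup>2 / 2) * g x) \<partial>lborel) = 0"
  shows "AE x in lborel. g x = 0"
proof -
  let ?h = "\<lambda>x. exp (- x\<^sup>2 / 2) * g x"
  have gauss: "integrable lborel (\<lambda>x. (exp (- (x / 2)\<^sup>2))\<^sup>2 :: real)"
  proof -
    have "integrable lborel (\<lambda>x. sqrt (2 * pi) * normal_density 0 1 x)"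
      by (intro integrable_mult_right integrable_normal_density) simp
    also have "(\<lambda>x. sqrt (2 * pi) * normal_density 0 1 x) = (\<lambda>x. (exp (- (x / 2)\<^sup>2))\<^sup>2)"
      by (rule ext) (simp add: normal_density_def power_divide flip: exp_double)
    finally show ?thesis .
  qed
  have expint: "integrable lborel (\<lambda>x. exp (\<bar>t\<bar> * \<bar>x\<bar>) * ?h x)" for t :: real
  proof (rule Bochner_Integration.integrable_bound)
    show "integrable lborel (\<lambda>x. exp (t\<^sup>2) * ((exp (- (x / 2)\<^sup>2))\<^sup>2 + (g x)\<^sup>2))"
      using gauss g2 by simp
    show "AE x in lborel. norm (exp (\<bar>t\<bar> * \<bar>x\<bar>) * ?h x) \<le> norm (exp (t\<^sup>2) * ((exp (- (x / 2)\<^sup>2))\<^sup>2 + (g x)\<^sup>2))"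
    proof (rule AE_I2)
      fix x :: real
      have "norm (exp (\<bar>t\<bar> * \<bar>x\<bar>) * ?h x) = exp (\<bar>t\<bar> * \<bar>x\<bar>) * exp (- x\<^sup>2 / 2) * \<bar>g x\<bar>"
        by (simp add: abs_mult)
      also have "\<dots> \<le> exp (t\<^sup>2) * exp (- (x / 2)\<^sup>2) * \<bar>g x\<bar>"
        by (intro mult_right_mono exp_square_shift) auto
      also have "\<dots> \<le> exp (t\<^sup>2) * ((exp (- (x / 2)\<^sup>2))\<^sup>2 + (g x)\<^sup>2)"
      proof -
        have "exp (- (x / 2)\<^sup>2) * \<bar>g x\<bar> \<le> 2 * exp (- (x / 2)\<^sup>2) * \<bar>g x\<bar>"
          by simp
        also have "\<dots> \<le> (exp (- (x / 2)\<^sup>2))\<^sup>2 + (g x)\<^sup>2"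
          using sum_squares_bound[of "exp (- (x / 2)\<^sup>2)" "\<bar>g x\<bar>"] by simp
        finally show ?thesis by (simp add: mult.assoc)
      qed
      finally show "norm (exp (\<bar>t\<bar> * \<bar>x\<bar>) * ?h x) \<le> norm (exp (t\<^sup>2) * ((exp (- (x / 2)\<^sup>2))\<^sup>2 + (g x)\<^sup>2))"
        by simp
    qed
  qed measurable
  have "AE x in lborel. ?h x = 0"
  proof (rule zero_of_fourier_zero)
    show "integrable lborel ?h" using expint[of 0] by simp
    show "(\<integral>x. exp (\<i> * complex_of_real (t * x)) * complex_of_real (?h x) \<partial>lborel) = 0" for t
      by (rule fourier_zero_of_moments_zero[OF _ expint moments]) measurable
  qed
  then show ?thesis by eventually_elim simp
qed

text \<open>Orthogonality to the Hermite functions is turned into vanishing of all moments of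
  \<open>f\<close> against exp(-x^2/2). Since the weights are real, the real and the imaginary part
  of \<open>f\<close> can be treated separately.\<close>

theorem fock_total:
  assumes "\<And>n. cinner (fock n) u = 0"
  shows "u = 0"
proof -
  define f where "f = rep_l2 u"
  have f: "square_integrable f" and u: "u = abs_l2 f"
    by (simp_all add: f_def square_integrable_rep_l2)
  then have [measurable]: "f \<in> borel_measurable borel" by (simp add: square_integrable_def)
  define orth where "orth p \<longleftrightarrow> cinner (abs_l2 (poly_gauss p)) u = 0" for p
  have orth_add: "orth (p + q)" if "orth p" "orth q" for p q
    using that by (simp add: orth_def abs_poly_gauss_add cinner.add_left)
  have orth_smult: "orth (smult c p)" if "orth p" for p c
    using that by (simp add: orth_def abs_poly_gauss_smult cinner_cscale_left)
  have orth_hermite: "orth (hermite n)" for n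
    using assms[of n] by (simp add: orth_def fock_eq abs_poly_gauss_smult cinner_cscale_left)
  \<comment> \<open>The three-term recurrence: the position operator maps the span of the Hermite
    functions into itself.\<close>
  have shift: "[:0, 1:] * hermite n = smult (1/2) (smult (complex_of_real (sqrt 2)) (hermite (Suc n)) +
      smult (of_nat n * complex_of_real (sqrt 2)) (hermite (n - 1)))" for n
  proof -
    have "[:0, 2:] * hermite n = smult (complex_of_real (sqrt 2)) (hermite (Suc n)) + pderiv (hermite n)"
      using hermite_Suc_mult[of n] by (simp add: algebra_simps)
    then have "smult (1/2) ([:0, 2:] * hermite n) = smult (1/2) (smult (complex_of_real (sqrt 2)) (hermite (Suc n)) +
      smult (of_nat n * complex_of_real (sqrt 2)) (hermite (n - 1)))"
      by (simp only: pderiv_hermite)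
    then show ?thesis by simp
  qed
  \<comment> \<open>Carrying all \<open>hermite n\<close> through the induction avoids expressing
    monomials by Hermite polynomials; at the end \<open>n = 0\<close> isolates the monomial because
    \<open>hermite 0\<close> is a nonzero constant.\<close>
  have orth_monom: "orth (monom 1 k * hermite n)" for k n
  proof (induction k arbitrary: n)
    case 0
    then show ?case using orth_hermite by simp
  next
    case (Suc k)
    have "monom 1 (Suc k) * hermite n = monom 1 k * ([:0, 1:] * hermite n)"
      by (simp add: monom_Suc)
    also have "\<dots> = smult (1/2) (smult (complex_of_real (sqrt 2)) (monom 1 k * hermite (Suc n)) +
      smult (of_nat n * complex_of_real (sqrt 2)) (monom 1 k * hermite (n - 1)))"
      unfolding shift by (simp add: algebra_simps)
    finally show ?case by (simp only:) (intro orth_smult orth_add Suc)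
  qed
  have moment: "(\<integral>x. complex_of_real (x ^ k * exp (- x\<^sup>2 / 2)) * f x \<partial>lborel) = 0"
    and int: "integrable lborel (\<lambda>x. complex_of_real (x ^ k * exp (- x\<^sup>2 / 2)) * f x)" for k
  proof -
    have "monom 1 k * hermite 0 = smult (complex_of_real (pi powr (-1/4))) (monom 1 k)" by simp
    with orth_monom[of k 0] have "orth (monom 1 k)"
      by (simp add: orth_def abs_poly_gauss_smult cinner_cscale_left)
    moreover have eq: "cnj (poly_gauss (monom 1 k) x) * f x = complex_of_real (x ^ k * exp (- x\<^sup>2 / 2)) * f x" for x
      by (simp add: poly_gauss_def poly_monom)
    ultimately show "(\<integral>x. complex_of_real (x ^ k * exp (- x\<^sup>2 / 2)) * f x \<partial>lborel) = 0"
      using f by (simp add: orth_def u cinner_abs square_integrable_poly_gauss del: of_real_mult)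
    show "integrable lborel (\<lambda>x. complex_of_real (x ^ k * exp (- x\<^sup>2 / 2)) * f x)"
      using integrable_cnj_mult[OF square_integrable_poly_gauss f, of "monom 1 k"] unfolding eq .
  qed
  have sq: "integrable lborel (\<lambda>x. (cmod (f x))\<^sup>2)" using f by (simp add: square_integrable_def)
  have "AE x in lborel. Re (f x) = 0"
  proof (rule zero_of_gauss_moments_zero)
    show "integrable lborel (\<lambda>x. (Re (f x))\<^sup>2)"
      by (rule Bochner_Integration.integrable_bound[OF sq]) (auto simp: cmod_power2)
    show "(\<integral>x. x ^ k * (exp (- x\<^sup>2 / 2) * Re (f x)) \<partial>lborel) = 0" for k
      using integral_Re[OF int[of k]] moment[of k] by (simp add: mult.assoc del: of_real_mult of_real_power)
  qed measurable
  moreover have "AE x in lborel. Im (f x) = 0"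
  proof (rule zero_of_gauss_moments_zero)
    show "integrable lborel (\<lambda>x. (Im (f x))\<^sup>2)"
      by (rule Bochner_Integration.integrable_bound[OF sq]) (auto simp: cmod_power2)
    show "(\<integral>x. x ^ k * (exp (- x\<^sup>2 / 2) * Im (f x)) \<partial>lborel) = 0" for k
      using integral_Im[OF int[of k]] moment[of k] by (simp add: mult.assoc del: of_real_mult of_real_power)
  qed measurable
  ultimately have "AE x in lborel. f x = 0"
    by eventually_elim (simp add: complex_eq_iff)
  then have "abs_l2 f = abs_l2 (\<lambda>_. 0)"
    using f by (subst l2_abs_eq_iff) (auto simp: square_integrable_zero)
  then show ?thesis by (simp add: u zero_l2_def)
qed


section \<open>Bessel, Riesz-Fischer and Parseval\<close>

lemma norm_fock [simp]: "norm (fock n) = 1"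
proof -
  have "complex_of_real ((norm (fock n))\<^sup>2) = complex_of_real 1"
    unfolding cinner_self[symmetric] by (simp add: cinner_fock)
  then have "(norm (fock n))\<^sup>2 = 1" by (simp only: of_real_eq_iff)
  then show ?thesis by (simp add: power2_eq_1_iff) (metis norm_ge_zero neg_0_le_iff_le not_one_le_zero)
qed

lemma cinner_fock_sum:
  assumes "finite F"
  shows "cinner (fock m) (\<Sum>n\<in>F. a n *\<^sub>c fock n) = (if m \<in> F then a m else 0)"
  using assms by (simp add: cinner.sum_right cinner_cscale_right cinner_fock if_distrib[of "\<lambda>x. _ * x"] cong: if_cong)

lemma norm_fock_sum:
  assumes "finite F"
  shows "(norm (\<Sum>n\<in>F. a n *\<^sub>c fock n))\<^sup>2 = (\<Sum>n\<in>F. (cmod (a n))\<^sup>2)"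
proof -
  have "cinner (\<Sum>n\<in>F. a n *\<^sub>c fock n) (\<Sum>n\<in>F. a n *\<^sub>c fock n) = (\<Sum>n\<in>F. cnj (a n) * a n)"
    using assms by (subst cinner.sum_left) (simp add: cinner_cscale_left cinner_fock_sum)
  also have "\<dots> = (\<Sum>n\<in>F. complex_of_real ((cmod (a n))\<^sup>2))"
    by (intro sum.cong refl) (metis complex_norm_square mult.commute)
  finally have "complex_of_real ((norm (\<Sum>n\<in>F. a n *\<^sub>c fock n))\<^sup>2) = complex_of_real (\<Sum>n\<in>F. (cmod (a n))\<^sup>2)"
    by (simp add: cinner_self del: of_real_power)
  then show ?thesis by (simp only: of_real_eq_iff)
qed

lemma bessel:
  assumes "finite F"
  shows "(\<Sum>n\<in>F. (cmod (cinner (fock n) u))\<^sup>2) \<le> (norm u)\<^sup>2"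
proof -
  let ?p = "\<Sum>n\<in>F. cinner (fock n) u *\<^sub>c fock n"
  have "cinner ?p u = (\<Sum>n\<in>F. cnj (cinner (fock n) u) * cinner (fock n) u)"
    by (simp add: cinner.sum_left cinner_cscale_left)
  also have "\<dots> = (\<Sum>n\<in>F. complex_of_real ((cmod (cinner (fock n) u))\<^sup>2))"
    by (intro sum.cong refl) (metis complex_norm_square mult.commute)
  finally have pu: "?p \<bullet> u = (norm ?p)\<^sup>2"
    using assms by (simp add: inner_eq_Re_cinner norm_fock_sum)
  have "0 \<le> (norm (u - ?p))\<^sup>2" by simp
  also have "\<dots> = (norm u)\<^sup>2 - (norm ?p)\<^sup>2"
    using pu by (simp add: power2_norm_eq_inner inner_diff_left inner_diff_right inner_commute)
  finally show ?thesis using assms by (simp add: norm_fock_sum)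
qed

lemma riesz_fischer:
  assumes "summable (\<lambda>n. (cmod (a n))\<^sup>2)"
  shows "summable (\<lambda>n. a n *\<^sub>c fock n)"
  unfolding summable_Cauchy
proof (intro allI impI)
  fix e :: real assume "0 < e"
  then obtain N where N: "\<And>m n. m \<ge> N \<Longrightarrow> norm (\<Sum>k=m..<n. (cmod (a k))\<^sup>2) < e\<^sup>2"
    using assms unfolding summable_Cauchy by (meson zero_less_power)
  show "\<exists>N. \<forall>m\<ge>N. \<forall>n. norm (\<Sum>k=m..<n. a k *\<^sub>c fock k) < e"
  proof (intro exI allI impI)
    fix m n assume "N \<le> m"
    from N[OF this, of n] have "(norm (\<Sum>k=m..<n. a k *\<^sub>c fock k))\<^sup>2 < e\<^sup>2"
      by (simp add: norm_fock_sum)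
    then show "norm (\<Sum>k=m..<n. a k *\<^sub>c fock k) < e"
      using \<open>0 < e\<close> by (simp add: power_less_imp_less_base)
  qed
qed

lemma cinner_fock_suminf:
  assumes "summable (\<lambda>n. a n *\<^sub>c fock n)"
  shows "cinner (fock m) (\<Sum>n. a n *\<^sub>c fock n) = a m"
proof -
  have "(\<lambda>n. cinner (fock m) (a n *\<^sub>c fock n)) sums cinner (fock m) (\<Sum>n. a n *\<^sub>c fock n)"
    by (rule bounded_linear.sums[OF cinner.bounded_linear_right summable_sums[OF assms]])
  moreover have "(\<lambda>n. cinner (fock m) (a n *\<^sub>c fock n)) = (\<lambda>n. if n = m then a n else 0)"
    by (auto simp: cinner_cscale_right cinner_fock)
  ultimately show ?thesis using sums_single[of m a] by (simp add: sums_unique2)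
qed

lemma fock_ext:
  assumes "\<And>n. cinner (fock n) u = cinner (fock n) v"
  shows "u = v"
  using fock_total[of "u - v"] assms by (simp add: cinner.diff_right)

lemma summable_fock_coefficients: "summable (\<lambda>n. (cmod (cinner (fock n) u))\<^sup>2)"
  by (rule bounded_imp_summable[where B = "(norm u)\<^sup>2"]) (auto intro: bessel)

text \<open>The series converges by Bessel and Riesz-Fischer, and its sum has the Fock coefficients
  of \<open>u\<close>; totality of the basis identifies the two.\<close>

theorem fock_expansion: "(\<lambda>n. cinner (fock n) u *\<^sub>c fock n) sums u"
proof -
  have s: "summable (\<lambda>n. cinner (fock n) u *\<^sub>c fock n)"
    by (intro riesz_fischer summable_fock_coefficients)
  have "(\<Sum>n. cinner (fock n) u *\<^sub>c fock n) = u"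
    by (rule fock_ext) (simp add: cinner_fock_suminf s)
  with s show ?thesis by (simp add: sums_iff)
qed

lemma parseval_cinner: "(\<lambda>n. cnj (cinner (fock n) u) * cinner (fock n) v) sums cinner u v"
  using bounded_linear.sums[OF cinner.bounded_linear_left fock_expansion[of u], of v]
  by (simp add: cinner_cscale_left)

lemma parseval: "(\<lambda>n. (cmod (cinner (fock n) u))\<^sup>2) sums (norm u)\<^sup>2"
proof -
  have "cnj (cinner (fock n) u) * cinner (fock n) u = complex_of_real ((cmod (cinner (fock n) u))\<^sup>2)" for n
    by (metis complex_norm_square mult.commute)
  then have "(\<lambda>n. complex_of_real ((cmod (cinner (fock n) u))\<^sup>2)) sums complex_of_real ((norm u)\<^sup>2)"
    using parseval_cinner[of u u] by (simp only: cinner_self)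
  then show ?thesis by (simp only: sums_of_real_iff)
qed

lemma parseval_ennreal: "(\<Sum>n. ennreal ((cmod (cinner (fock n) u))\<^sup>2)) = ennreal ((norm u)\<^sup>2)"
  using parseval[of u] by (intro suminf_ennreal_eq) auto

section \<open>Square roots and resolvents of positive operators\<close>

text \<open>Over the reals a nonnegative quadratic form does not force symmetry, so symmetry is a
  separate requirement.\<close>

definition psd :: "('a::real_inner \<Rightarrow>\<^sub>L 'a) \<Rightarrow> bool" where
  "psd A \<longleftrightarrow> (\<forall>u v. A u \<bullet> v = u \<bullet> A v) \<and> (\<forall>u. 0 \<le> u \<bullet> A u)"

lemma psd_symmetric: "psd A \<Longrightarrow> A u \<bullet> v = u \<bullet> A v"
  and psd_nonneg: "psd A \<Longrightarrow> 0 \<le> u \<bullet> A u"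
  by (simp_all add: psd_def)

lemma psd_cauchy_schwarz:
  assumes A: "psd A"
  shows "(u \<bullet> A v)\<^sup>2 \<le> (u \<bullet> A u) * (v \<bullet> A v)"
proof -
  define a b c where "a = u \<bullet> A u" and "b = u \<bullet> A v" and "c = v \<bullet> A v"
  have b: "v \<bullet> A u = b"
    using psd_symmetric[OF A, of v u] by (simp add: b_def inner_commute)
  have quad: "0 \<le> a + 2 * t * b + t\<^sup>2 * c" for t
    using psd_nonneg[OF A, of "u + t *\<^sub>R v"] b
    by (simp add: blinfun.add_right blinfun.scaleR_right inner_add_left inner_add_right
        a_def b_def c_def power2_eq_square algebra_simps)
  have "b\<^sup>2 \<le> a * c"
  proof (cases "c = 0")
    case True
    have "b = 0"
    proof (rule ccontr)
      assume "b \<noteq> 0"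
      \<comment> \<open>With \<open>c = 0\<close> this \<open>t\<close> gives the quadratic
        polynomial the value -1.\<close>
      then show False using quad[of "- (a + 1) / (2 * b)"] True by (simp add: field_simps)
    qed
    with True show ?thesis by simp
  next
    case False
    then have c: "0 < c" using psd_nonneg[OF A, of v] by (simp add: c_def)
    have "0 \<le> a + 2 * (- b / c) * b + (- b / c)\<^sup>2 * c" by (rule quad)
    also have "\<dots> = a - b\<^sup>2 / c" using c by (simp add: power2_eq_square field_simps)
    finally show ?thesis using c by (simp add: field_simps)
  qed
  then show ?thesis by (simp add: a_def b_def c_def)
qed

text \<open>This is the operator inequality A^2 \<le> ||A|| A, from Cauchy-Schwarz for the form of
  \<open>A\<close> at the vectors \<open>u\<close> and \<open>A u\<close>.\<close>

lemma psd_norm_apply: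
  assumes A: "psd A"
  shows "(norm (A u))\<^sup>2 \<le> norm A * (u \<bullet> A u)"
proof (cases "A u = 0")
  case True
  then show ?thesis using psd_nonneg[OF A] by simp
next
  case False
  then have pos: "0 < (norm (A u))\<^sup>2" by simp
  have "((norm (A u))\<^sup>2)\<^sup>2 = (u \<bullet> A (A u))\<^sup>2"
    by (simp add: power2_norm_eq_inner psd_symmetric[OF A])
  also have "\<dots> \<le> (u \<bullet> A u) * (A u \<bullet> A (A u))"
    by (rule psd_cauchy_schwarz[OF A])
  also have "\<dots> \<le> (u \<bullet> A u) * (norm A * (norm (A u))\<^sup>2)"
  proof (intro mult_left_mono psd_nonneg[OF A])
    have "A u \<bullet> A (A u) \<le> norm (A u) * norm (A (A u))" by (rule norm_cauchy_schwarz)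
    also have "\<dots> \<le> norm (A u) * (norm A * norm (A u))"
      by (intro mult_left_mono norm_blinfun) simp
    finally show "A u \<bullet> A (A u) \<le> norm A * (norm (A u))\<^sup>2"
      by (simp add: power2_eq_square mult_ac)
  qed
  finally have "(norm (A u))\<^sup>2 * (norm (A u))\<^sup>2 \<le> (norm A * (u \<bullet> A u)) * (norm (A u))\<^sup>2"
    by (simp add: power2_eq_square mult_ac)
  then show ?thesis using pos by (simp only: mult_le_cancel_right_pos)
qed

lemma psd_kernel: "psd A \<Longrightarrow> u \<bullet> A u = 0 \<Longrightarrow> A u = 0"
  using psd_norm_apply[of A u] by simp

lemma psd_complement_norm:
  assumes A: "psd A" and le: "norm A \<le> 1"
  shows "norm (id_blinfun - A) \<le> 1"
proof (rule norm_blinfun_bound)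
  fix u
  have "(norm (u - A u))\<^sup>2 = (norm u)\<^sup>2 - 2 * (u \<bullet> A u) + (norm (A u))\<^sup>2"
    by (simp add: power2_norm_eq_inner inner_diff_left inner_diff_right inner_commute)
  also have "\<dots> \<le> (norm u)\<^sup>2"
  proof -
    have "(norm (A u))\<^sup>2 \<le> norm A * (u \<bullet> A u)" by (rule psd_norm_apply[OF A])
    also have "\<dots> \<le> 1 * (u \<bullet> A u)" by (intro mult_right_mono le psd_nonneg[OF A])
    finally show ?thesis using psd_nonneg[OF A, of u] by simp
  qed
  finally have "norm (u - A u) \<le> norm u" by (rule power2_le_imp_le) simp
  then show "norm ((id_blinfun - A) u) \<le> 1 * norm u" by (simp add: blinfun.diff_left)
qed simp

text \<open>A fixed point \<open>Y = (B + Y\<^sup>2) / 2\<close> for \<open>B = 1 - A\<close> satisfies \<open>(1 - Y)\<^sup>2 = A\<close>.\<close>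

primrec sqrt_iter :: "('a::real_inner \<Rightarrow>\<^sub>L 'a) \<Rightarrow> nat \<Rightarrow> ('a \<Rightarrow>\<^sub>L 'a)" where
  "sqrt_iter B 0 = 0"
| "sqrt_iter B (Suc k) = (1/2) *\<^sub>R (B + (sqrt_iter B k o\<^sub>L sqrt_iter B k))"

text \<open>The same iteration for the number 1; it dominates the operator iteration.\<close>

primrec sqrt_bound :: "nat \<Rightarrow> real" where
  "sqrt_bound 0 = 0"
| "sqrt_bound (Suc k) = (1 + (sqrt_bound k)\<^sup>2) / 2"

lemma sqrt_bound_range: "0 \<le> sqrt_bound k" "sqrt_bound k \<le> 1"
proof -
  have "0 \<le> sqrt_bound k \<and> sqrt_bound k \<le> 1"
    by (induction k) (auto simp: power_le_one)
  then show "0 \<le> sqrt_bound k" "sqrt_bound k \<le> 1" by auto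
qed

lemma sqrt_bound_mono: "sqrt_bound k \<le> sqrt_bound (Suc k)"
  using sum_squares_bound[of 1 "sqrt_bound k"] by simp

lemma norm_sqrt_iter_le:
  assumes "norm B \<le> 1"
  shows "norm (sqrt_iter B k) \<le> sqrt_bound k"
proof (induction k)
  case (Suc k)
  have "norm (B + (sqrt_iter B k o\<^sub>L sqrt_iter B k)) \<le> norm B + norm (sqrt_iter B k) * norm (sqrt_iter B k)"
    by (intro norm_triangle_le add_left_mono norm_blinfun_compose)
  also have "\<dots> \<le> 1 + sqrt_bound k * sqrt_bound k"
    by (intro add_mono mult_mono assms Suc sqrt_bound_range norm_ge_zero)
  finally show ?case by (simp add: power2_eq_square)
qed simp

text \<open>A difference of squares splits as Y' D + D Y with D = Y' - Y even without commutation.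
  The scalar iteration satisfies the same recursion with equality, so its increments dominate those
  of the operators.\<close>

lemma norm_sqrt_iter_step:
  assumes "norm B \<le> 1"
  shows "norm (sqrt_iter B (Suc k) - sqrt_iter B k) \<le> sqrt_bound (Suc k) - sqrt_bound k"
proof (induction k)
  case 0
  show ?case using assms by simp
next
  case (Suc k)
  let ?Y = "sqrt_iter B" and ?y = sqrt_bound
  let ?D = "?Y (Suc k) - ?Y k"
  have "?Y (Suc (Suc k)) - ?Y (Suc k) =
      (1/2) *\<^sub>R (B + (?Y (Suc k) o\<^sub>L ?Y (Suc k))) - (1/2) *\<^sub>R (B + (?Y k o\<^sub>L ?Y k))"
    by (rule arg_cong2[where f = "(-)"]; rule sqrt_iter.simps(2))
  also have "\<dots> = (1/2) *\<^sub>R ((?Y (Suc k) o\<^sub>L ?Y (Suc k)) - (?Y k o\<^sub>L ?Y k))"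
    by (simp add: scaleR_right_diff_distrib scaleR_right_distrib del: sqrt_iter.simps)
  also have "(?Y (Suc k) o\<^sub>L ?Y (Suc k)) - (?Y k o\<^sub>L ?Y k) = (?Y (Suc k) o\<^sub>L ?D) + (?D o\<^sub>L ?Y k)"
    by (rule blinfun_eqI) (simp add: blinfun.diff_left blinfun.diff_right blinfun.add_left del: sqrt_iter.simps)
  also have "norm ((1/2) *\<^sub>R \<dots>) \<le> (1/2) * (norm (?Y (Suc k)) * norm ?D + norm ?D * norm (?Y k))"
    unfolding norm_scaleR
    by (intro mult_mono norm_triangle_le add_mono norm_blinfun_compose) auto
  also have "\<dots> \<le> (1/2) * (?y (Suc k) * (?y (Suc k) - ?y k) + (?y (Suc k) - ?y k) * ?y k)"
    using sqrt_bound_mono[of k]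
    by (intro mult_left_mono add_mono mult_mono Suc norm_sqrt_iter_le assms sqrt_bound_range)
      (auto simp del: sqrt_iter.simps sqrt_bound.simps)
  also have "\<dots> = (1 + (?y (Suc k))\<^sup>2) / 2 - (1 + (?y k)\<^sup>2) / 2"
    by (simp add: power2_eq_square field_simps del: sqrt_bound.simps)
  also have "\<dots> = ?y (Suc (Suc k)) - ?y (Suc k)" by simp
  finally show ?case .
qed

text \<open>Distances of iterates are bounded by differences of a bounded monotone real sequence. No
  contraction rate enters, so norm convergence holds also for \<open>norm B = 1\<close>.\<close>

lemma sqrt_iter_convergent:
  fixes B :: "'a::{real_inner,banach} \<Rightarrow>\<^sub>L 'a"
  assumes B: "norm B \<le> 1"
  shows "convergent (sqrt_iter B)"
proof -
  have dist_le: "norm (sqrt_iter B (n + j) - sqrt_iter B n) \<le> sqrt_bound (n + j) - sqrt_bound n" for n j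
  proof (induction j)
    case (Suc j)
    have "norm (sqrt_iter B (n + Suc j) - sqrt_iter B n) \<le>
        norm (sqrt_iter B (Suc (n + j)) - sqrt_iter B (n + j)) + norm (sqrt_iter B (n + j) - sqrt_iter B n)"
      using dist_triangle[of "sqrt_iter B (Suc (n + j))" "sqrt_iter B n" "sqrt_iter B (n + j)"]
      by (simp only: dist_norm add_Suc_right)
    also have "\<dots> \<le> (sqrt_bound (Suc (n + j)) - sqrt_bound (n + j)) + (sqrt_bound (n + j) - sqrt_bound n)"
      by (intro add_mono norm_sqrt_iter_step B Suc)
    finally show ?case by (simp only: add_Suc_right diff_add_cancel add_diff_eq)
  qed simp
  have "incseq sqrt_bound" by (rule incseq_SucI) (rule sqrt_bound_mono)
  then have "Cauchy sqrt_bound"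
    using incseq_convergent[of sqrt_bound 1] sqrt_bound_range(2) LIMSEQ_imp_Cauchy by metis
  then have "Cauchy (sqrt_iter B)"
    unfolding Cauchy_altdef2
  proof (intro allI impI)
    fix e :: real assume "0 < e" and c: "\<forall>e>0. \<exists>N. \<forall>n\<ge>N. dist (sqrt_bound n) (sqrt_bound N) < e"
    then obtain N where N: "\<And>n. n \<ge> N \<Longrightarrow> dist (sqrt_bound n) (sqrt_bound N) < e" by blast
    show "\<exists>N. \<forall>n\<ge>N. dist (sqrt_iter B n) (sqrt_iter B N) < e"
    proof (intro exI allI impI)
      fix n assume "N \<le> n"
      with N[OF this] dist_le[of N "n - N"] show "dist (sqrt_iter B n) (sqrt_iter B N) < e"
        by (simp add: dist_norm)
    qed
  qed
  then show ?thesis by (simp add: Cauchy_convergent_iff)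
qed

text \<open>The limit \<open>L\<close> is symmetric of norm at most 1, which makes
  \<open>S = 1 - L\<close> positive. All iterates are polynomials in \<open>A\<close>, so
  \<open>S\<close> commutes with whatever commutes with \<open>A\<close>; this clause later gives
  the uniqueness of the root and, with complex scalars as \<open>T\<close>, its complex
  linearity.\<close>

lemma psd_sqrt_contraction:
  fixes A :: "'a::{real_inner,banach} \<Rightarrow>\<^sub>L 'a"
  assumes A: "psd A" and le: "norm A \<le> 1"
  shows "\<exists>S. psd S \<and> S o\<^sub>L S = A \<and> (\<forall>T. T o\<^sub>L A = A o\<^sub>L T \<longrightarrow> T o\<^sub>L S = S o\<^sub>L T)"
proof -
  define B where "B = id_blinfun - A"
  have B: "norm B \<le> 1" unfolding B_def by (rule psd_complement_norm[OF A le])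
  have B_sym: "B u \<bullet> v = u \<bullet> B v" for u v
    by (simp add: B_def blinfun.diff_left inner_diff_left inner_diff_right psd_symmetric[OF A])
  obtain L where L: "sqrt_iter B \<longlonglongrightarrow> L"
    using sqrt_iter_convergent[OF B] by (auto simp: convergent_def)
  have L_norm: "norm L \<le> 1"
  proof (rule LIMSEQ_le_const2[OF tendsto_norm[OF L]])
    show "\<exists>N. \<forall>n\<ge>N. norm (sqrt_iter B n) \<le> 1"
      using norm_sqrt_iter_le[OF B] sqrt_bound_range(2) order_trans by blast
  qed
  have "(\<lambda>k. sqrt_iter B (Suc k)) \<longlonglongrightarrow> (1/2) *\<^sub>R (B + (L o\<^sub>L L))"
    unfolding sqrt_iter.simps
    by (intro tendsto_intros bounded_bilinear.tendsto[OF bounded_bilinear_blinfun_compose] L)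
  from LIMSEQ_unique[OF LIMSEQ_Suc[OF L] this] have fix_L: "L = (1/2) *\<^sub>R (B + (L o\<^sub>L L))" .
  have Y_sym: "sqrt_iter B k u \<bullet> v = u \<bullet> sqrt_iter B k v" for k u v
    by (induction k arbitrary: u v)
      (simp_all add: blinfun.scaleR_left blinfun.add_left inner_add_left inner_add_right B_sym)
  have L_sym: "L u \<bullet> v = u \<bullet> L v" for u v
  proof (rule LIMSEQ_unique)
    show "(\<lambda>k. sqrt_iter B k u \<bullet> v) \<longlonglongrightarrow> L u \<bullet> v" by (intro tendsto_intros L)
    show "(\<lambda>k. sqrt_iter B k u \<bullet> v) \<longlonglongrightarrow> u \<bullet> L v"
      unfolding Y_sym by (intro tendsto_intros L)
  qed
  have Y_comm: "T o\<^sub>L sqrt_iter B k = sqrt_iter B k o\<^sub>L T" if T: "T o\<^sub>L A = A o\<^sub>L T" for T k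
  proof (induction k)
    case (Suc k)
    have c: "T (A x) = A (T x)" for x using arg_cong[OF T, of "\<lambda>F. F x"] by simp
    have y: "T (sqrt_iter B k x) = sqrt_iter B k (T x)" for x using arg_cong[OF Suc, of "\<lambda>F. F x"] by simp
    have cB: "T (B x) = B (T x)" for x
      by (simp add: B_def blinfun.diff_left blinfun.diff_right c)
    show ?case
      by (rule blinfun_eqI)
        (simp add: blinfun.scaleR_left blinfun.add_left blinfun.scaleR_right blinfun.add_right cB y)
  qed simp
  define S where "S = id_blinfun - L"
  have "psd S"
    unfolding psd_def
  proof (intro conjI allI)
    show "S u \<bullet> v = u \<bullet> S v" for u v
      by (simp add: S_def blinfun.diff_left inner_diff_left inner_diff_right L_sym)
    fix u
    have "u \<bullet> L u \<le> norm u * norm (L u)" by (rule norm_cauchy_schwarz)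
    also have "\<dots> \<le> norm u * (norm L * norm u)" by (intro mult_left_mono norm_blinfun) simp
    also have "\<dots> \<le> norm u * (1 * norm u)"
      by (intro mult_left_mono mult_right_mono L_norm) auto
    finally show "0 \<le> u \<bullet> S u"
      by (simp add: S_def blinfun.diff_left inner_diff_right power2_norm_eq_inner flip: power2_eq_square)
  qed
  moreover have "S o\<^sub>L S = A"
  proof (rule blinfun_eqI)
    fix x
    have "L x + L x = B x + L (L x)"
      using arg_cong[OF fix_L, of "\<lambda>F. 2 *\<^sub>R F x"] by (simp add: blinfun.scaleR_left blinfun.add_left scaleR_2)
    then show "(S o\<^sub>L S) x = A x"
      by (simp add: S_def B_def blinfun.diff_left blinfun.diff_right algebra_simps)
  qed
  moreover have "T o\<^sub>L S = S o\<^sub>L T" if "T o\<^sub>L A = A o\<^sub>L T" for T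
  proof -
    have "(\<lambda>k. T o\<^sub>L sqrt_iter B k) \<longlonglongrightarrow> (T o\<^sub>L L)" "(\<lambda>k. sqrt_iter B k o\<^sub>L T) \<longlonglongrightarrow> (L o\<^sub>L T)"
      by (intro bounded_bilinear.tendsto[OF bounded_bilinear_blinfun_compose] tendsto_const L)+
    with Y_comm[OF that] have "T o\<^sub>L L = L o\<^sub>L T" by (auto intro: LIMSEQ_unique)
    from arg_cong[OF this, of blinfun_apply] show ?thesis
      by (intro blinfun_eqI) (simp add: fun_eq_iff S_def blinfun.diff_left blinfun.diff_right)
  qed
  ultimately show ?thesis by blast
qed

theorem psd_sqrt_exists:
  fixes A :: "'a::{real_inner,banach} \<Rightarrow>\<^sub>L 'a"
  assumes A: "psd A"
  shows "\<exists>S. psd S \<and> S o\<^sub>L S = A \<and> (\<forall>T. T o\<^sub>L A = A o\<^sub>L T \<longrightarrow> T o\<^sub>L S = S o\<^sub>L T)"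
proof (cases "A = 0")
  case True
  then show ?thesis by (intro exI[of _ 0]) (auto simp: psd_def)
next
  case False
  define a where "a = norm A"
  have a: "0 < a" using False by (simp add: a_def)
  define A' where "A' = (1 / a) *\<^sub>R A"
  have A': "psd A'" "norm A' \<le> 1"
    using A a by (auto simp: A'_def psd_def blinfun.scaleR_left) (simp add: a_def)
  obtain S where S: "psd S" "S o\<^sub>L S = A'" and comm: "\<And>T. T o\<^sub>L A' = A' o\<^sub>L T \<Longrightarrow> T o\<^sub>L S = S o\<^sub>L T"
    using psd_sqrt_contraction[OF A'] by blast
  show ?thesis
  proof (intro exI[of _ "sqrt a *\<^sub>R S"] conjI allI impI)
    show "psd (sqrt a *\<^sub>R S)" using S(1) a by (simp add: psd_def blinfun.scaleR_left)
    have S2: "S (S x) = (1 / a) *\<^sub>R A x" for x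
      using arg_cong[OF S(2), of "\<lambda>F. F x"] by (simp add: A'_def blinfun.scaleR_left)
    show "(sqrt a *\<^sub>R S) o\<^sub>L (sqrt a *\<^sub>R S) = A"
      using a by (intro blinfun_eqI) (simp add: blinfun.scaleR_left blinfun.scaleR_right S2)
    fix T assume T: "T o\<^sub>L A = A o\<^sub>L T"
    have c: "T (A x) = A (T x)" for x using arg_cong[OF T, of "\<lambda>F. F x"] by simp
    have "T o\<^sub>L S = S o\<^sub>L T"
      by (rule comm, rule blinfun_eqI) (simp add: A'_def blinfun.scaleR_left blinfun.scaleR_right c)
    then have c': "T (S x) = S (T x)" for x
      by (metis blinfun_apply_blinfun_compose)
    show "T o\<^sub>L (sqrt a *\<^sub>R S) = (sqrt a *\<^sub>R S) o\<^sub>L T"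
      by (rule blinfun_eqI) (simp add: blinfun.scaleR_left blinfun.scaleR_right c')
  qed
qed

text \<open>Commuting roots satisfy (S + Q)(S - Q) = 0. For \<open>d = S x - Q x\<close> the two
  nonnegative numbers <d, S d> and <d, Q d> therefore sum to 0, so \<open>S\<close> and
  \<open>Q\<close> annihilate \<open>d\<close>, and by symmetry \<open>d\<close> is orthogonal to
  \<open>S x\<close> and \<open>Q x\<close>, hence to itself.\<close>

lemma psd_sqrt_unique_commuting:
  assumes S: "psd S" and Q: "psd Q" and eq: "S o\<^sub>L S = Q o\<^sub>L Q" and comm: "Q o\<^sub>L S = S o\<^sub>L Q"
  shows "S = Q"
proof (rule blinfun_eqI)
  fix x
  have eq': "S (S y) = Q (Q y)" and comm': "Q (S y) = S (Q y)" for y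
    using arg_cong[OF eq, of "\<lambda>F. F y"] arg_cong[OF comm, of "\<lambda>F. F y"] by simp_all
  define d where "d = S x - Q x"
  have "d \<bullet> S d + d \<bullet> Q d = d \<bullet> (S d + Q d)" by (simp add: inner_add_right)
  also have "S d + Q d = 0" by (simp add: d_def blinfun.diff_right eq' comm')
  finally have "d \<bullet> S d = 0" "d \<bullet> Q d = 0"
    using psd_nonneg[OF S, of d] psd_nonneg[OF Q, of d] by auto
  then have "S d = 0" "Q d = 0" using psd_kernel S Q by auto
  then have "d \<bullet> d = 0"
    unfolding d_def inner_diff_right
    using psd_symmetric[OF S, of d x] psd_symmetric[OF Q, of d x] by (simp add: d_def)
  then show "S x = Q x" by (simp add: d_def)
qed

text \<open>\<open>S\<close> and \<open>Q\<close> are not known to commute with each other. The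
  constructed root \<open>R\<close> commutes with everything that commutes with the common square,
  hence with both, and is compared with each of them.\<close>

theorem psd_sqrt_unique:
  fixes S Q :: "'a::{real_inner,banach} \<Rightarrow>\<^sub>L 'a"
  assumes S: "psd S" and Q: "psd Q" and eq: "S o\<^sub>L S = Q o\<^sub>L Q"
  shows "S = Q"
proof -
  have "psd (S o\<^sub>L S)"
    using S by (simp add: psd_def) (metis inner_ge_zero)
  then obtain R where R: "psd R" "R o\<^sub>L R = S o\<^sub>L S"
    and comm: "\<And>T. T o\<^sub>L (S o\<^sub>L S) = (S o\<^sub>L S) o\<^sub>L T \<Longrightarrow> T o\<^sub>L R = R o\<^sub>L T"
    using psd_sqrt_exists by blast
  have "S o\<^sub>L R = R o\<^sub>L S" by (rule comm) (rule blinfun_eqI, simp)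
  then have "R = S" by (rule psd_sqrt_unique_commuting[OF R(1) S R(2)])
  moreover have "Q o\<^sub>L R = R o\<^sub>L Q" by (rule comm) (unfold eq, rule blinfun_eqI, simp)
  then have "R = Q" by (rule psd_sqrt_unique_commuting[OF R(1) Q R(2)[unfolded eq]])
  ultimately show ?thesis by simp
qed

section \<open>Resolvents of positive operators\<close>

lemma psd_shift_bound:
  assumes P: "psd P" and e: "0 < e" and x: "P y + e *\<^sub>R y = x"
  shows "norm (P y) \<le> norm x" "e * norm y \<le> norm x"
proof -
  have "(norm x)\<^sup>2 = (norm (P y))\<^sup>2 + 2 * e * (y \<bullet> P y) + (e * norm y)\<^sup>2"
    by (simp add: power2_norm_eq_inner power_mult_distrib inner_add_left inner_add_right inner_commute
        power2_eq_square[of e] algebra_simps flip: x)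
  then have "(norm (P y))\<^sup>2 \<le> (norm x)\<^sup>2" "(e * norm y)\<^sup>2 \<le> (norm x)\<^sup>2"
    using psd_nonneg[OF P, of y] e by auto
  then show "norm (P y) \<le> norm x" "e * norm y \<le> norm x"
    using e by (auto intro: power2_le_imp_le)
qed

text \<open>The inverse of \<open>P + e\<close> is the fixed point of \<open>K \<mapsto> K - l ((P + e) K - 1)\<close>, which is a
  contraction for small \<open>l\<close>.\<close>

theorem psd_resolvent:
  fixes P :: "'a::{real_inner,banach} \<Rightarrow>\<^sub>L 'a"
  assumes P: "psd P" and e: "0 < e"
  shows "\<exists>K :: 'a \<Rightarrow>\<^sub>L 'a. (\<forall>x. P (K x) + e *\<^sub>R K x = x) \<and> (\<forall>x. K (P x + e *\<^sub>R x) = x)"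
proof -
  define C where "C = P + e *\<^sub>R id_blinfun"
  have C: "C x = P x + e *\<^sub>R x" for x by (simp add: C_def blinfun.add_left blinfun.scaleR_left)
  \<comment> \<open>The choice \<open>l = e / c^2\<close> below minimises 1 - 2 l e + l^2 c^2, which
    bounds the squared norm of \<open>D\<close>. The summand \<open>e\<close> gives
    \<open>0 < c\<close> and \<open>e \<le> c\<close>, so that the minimum 1 - (e/c)^2 is
    nonnegative.\<close>
  define c where "c = norm C + e"
  define l where "l = e / c\<^sup>2"
  have c: "0 < c" "e \<le> c" "norm C \<le> c" using e by (auto simp: c_def add_nonneg_pos)
  have l: "0 < l" using e c by (simp add: l_def)
  define D where "D = id_blinfun - l *\<^sub>R C"
  define q where "q = sqrt (1 - (e / c)\<^sup>2)"
  have ec: "(e / c)\<^sup>2 \<le> 1" "0 < (e / c)\<^sup>2" using e c by (auto simp: power_le_one)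
  then have q: "0 \<le> q" "q < 1" by (auto simp: q_def)
  have D: "norm D \<le> q"
  proof (rule norm_blinfun_bound[OF q(1)])
    fix u
    have "(norm (D u))\<^sup>2 = (norm u)\<^sup>2 - 2 * l * (u \<bullet> C u) + l\<^sup>2 * (norm (C u))\<^sup>2"
      by (simp add: D_def blinfun.diff_left blinfun.scaleR_left power2_norm_eq_inner inner_diff_left
          inner_diff_right inner_commute power2_eq_square[of l] algebra_simps)
    also have "\<dots> \<le> (norm u)\<^sup>2 - 2 * l * (e * (norm u)\<^sup>2) + l\<^sup>2 * (c * norm u)\<^sup>2"
    proof (intro add_mono diff_mono mult_left_mono power_mono order_refl)
      show "e * (norm u)\<^sup>2 \<le> u \<bullet> C u"
        using psd_nonneg[OF P, of u] by (simp add: C inner_add_right power2_norm_eq_inner)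
      have "norm (C u) \<le> norm C * norm u" by (rule norm_blinfun)
      also have "\<dots> \<le> c * norm u" by (intro mult_right_mono c) simp
      finally show "norm (C u) \<le> c * norm u" .
    qed (use l in auto)
    also have "\<dots> = (1 - 2 * l * e + l\<^sup>2 * c\<^sup>2) * (norm u)\<^sup>2"
      by (simp add: power2_eq_square algebra_simps)
    also have "\<dots> = (1 - (e / c)\<^sup>2) * (norm u)\<^sup>2"
    proof -
      have "l * e = (e / c)\<^sup>2" by (simp add: l_def power2_eq_square)
      moreover have "l * c = e / c" using c by (simp add: l_def power2_eq_square)
      then have "l\<^sup>2 * c\<^sup>2 = (e / c)\<^sup>2" by (simp flip: power_mult_distrib)
      ultimately show ?thesis by (simp add: mult.assoc)
    qed
    also have "\<dots> = (q * norm u)\<^sup>2"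
    proof -
      have "q\<^sup>2 = 1 - (e / c)\<^sup>2" unfolding q_def using ec by (intro real_sqrt_pow2) simp
      then show ?thesis by (simp only: power_mult_distrib)
    qed
    finally show "norm (D u) \<le> q * norm u"
      by (rule power2_le_imp_le) (use q in simp)
  qed
  define \<Phi> where "\<Phi> K = (D o\<^sub>L K) + l *\<^sub>R id_blinfun" for K :: "'a \<Rightarrow>\<^sub>L 'a"
  have "dist (\<Phi> K) (\<Phi> K') \<le> q * dist K K'" for K K'
  proof -
    have "\<Phi> K - \<Phi> K' = D o\<^sub>L (K - K')"
      by (rule blinfun_eqI) (simp add: \<Phi>_def blinfun.add_left blinfun.diff_left blinfun.diff_right)
    then have "dist (\<Phi> K) (\<Phi> K') \<le> norm D * dist K K'"
      by (simp add: dist_norm norm_blinfun_compose)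
    also have "\<dots> \<le> q * dist K K'" by (intro mult_right_mono D) simp
    finally show ?thesis .
  qed
  then obtain K where K: "\<Phi> K = K" using banach_fix_type[OF q] by blast
  have CK: "P (K x) + e *\<^sub>R K x = x" for x
  proof -
    have "l *\<^sub>R C (K x) = l *\<^sub>R x"
      using arg_cong[OF K, of "\<lambda>F. F x"]
      by (simp add: \<Phi>_def D_def blinfun.add_left blinfun.diff_left blinfun.scaleR_left)
        metis
    then show ?thesis using l by (simp add: C)
  qed
  \<comment> \<open>The fixed point gives a right inverse; it is also a left inverse because
    \<open>P + e\<close> is injective by \<open>psd_shift_bound\<close>.\<close>
  moreover have "K (P x + e *\<^sub>R x) = x" for x
  proof -
    let ?y = "K (P x + e *\<^sub>R x) - x"
    have "P ?y + e *\<^sub>R ?y = 0"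
      using CK[of "P x + e *\<^sub>R x"] by (simp add: blinfun.diff_right algebra_simps)
    from psd_shift_bound(2)[OF P e this] e show ?thesis by (simp add: mult_le_0_iff)
  qed
  ultimately show ?thesis by blast
qed

section \<open>The trace norm\<close>

abbreviation population :: "(l2 \<Rightarrow>\<^sub>L l2) \<Rightarrow> nat \<Rightarrow> real" where
  "population T n \<equiv> Re (cinner (fock n) (T (fock n)))"

lemma complex_linear_opD: "complex_linear_op T \<Longrightarrow> T (c *\<^sub>c u) = c *\<^sub>c T u"
  by (simp add: complex_linear_op_def)

lemma complex_linear_op_compose:
  "complex_linear_op S \<Longrightarrow> complex_linear_op T \<Longrightarrow> complex_linear_op (S o\<^sub>L T)"
  by (simp add: complex_linear_op_def)

lemma complex_linear_op_add:
  "complex_linear_op S \<Longrightarrow> complex_linear_op T \<Longrightarrow> complex_linear_op (S + T)"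
  by (simp add: complex_linear_op_def blinfun.add_left cscale.add_right)

lemma complex_linear_op_diff:
  "complex_linear_op S \<Longrightarrow> complex_linear_op T \<Longrightarrow> complex_linear_op (S - T)"
  by (simp add: complex_linear_op_def blinfun.diff_left cscale.diff_right)

lemma complex_linear_op_zero: "complex_linear_op 0"
  by (simp add: complex_linear_op_def cscale.zero_right)

lemma cinner_eq_inner: "cinner u v = Complex (u \<bullet> v) (u \<bullet> ((- \<i>) *\<^sub>c v))"
  by (simp add: complex_eq_iff inner_eq_Re_cinner Im_cinner)

lemma psd_cinner_symmetric:
  assumes "complex_linear_op T" "psd T"
  shows "cinner (T u) v = cinner u (T v)"
  unfolding cinner_eq_inner
  using psd_symmetric[OF assms(2)] complex_linear_opD[OF assms(1)] by simp

text \<open>Over the complex numbers a form that is real on all vectors is Hermitian; polarisation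
  with \<open>u + \<i> *\<^sub>c v\<close> shows it. This transfers the real results on
  \<open>psd\<close> operators to \<open>positive_op\<close>.\<close>

lemma positive_op_iff: "positive_op T \<longleftrightarrow> complex_linear_op T \<and> psd T"
proof (intro iffI conjI)
  assume T: "positive_op T"
  then show lin: "complex_linear_op T" by (simp add: positive_op_def)
  have nn: "cinner u (T u) \<in> \<real>\<^sub>\<ge>\<^sub>0" for u using T by (simp add: positive_op_def)
  have im: "Im (cinner u (T u)) = 0" for u
    using nn[of u] by (auto simp: complex_nonneg_Reals_iff)
  show "psd T"
    unfolding psd_def
  proof (intro conjI allI)
    show "0 \<le> u \<bullet> T u" for u
      using nn[of u] by (auto simp: complex_nonneg_Reals_iff inner_eq_Re_cinner)
    fix u v
    have "Im (cinner (u + \<i> *\<^sub>c v) (T (u + \<i> *\<^sub>c v))) = 0" by (rule im)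
    also have "cinner (u + \<i> *\<^sub>c v) (T (u + \<i> *\<^sub>c v)) =
        cinner u (T u) + cinner v (T v) + (\<i> * cinner u (T v) - \<i> * cinner v (T u))"
      by (simp add: blinfun.add_right cinner.add_left cinner.add_right complex_linear_opD[OF lin]
          cinner_cscale_left cinner_cscale_right right_diff_distrib distrib_left flip: mult.assoc)
    finally have "Re (cinner u (T v)) = Re (cinner v (T u))" by (simp add: im)
    then show "T u \<bullet> v = u \<bullet> T v"
      by (subst inner_commute) (simp add: inner_eq_Re_cinner)
  qed
next
  assume T: "complex_linear_op T \<and> psd T"
  have "Im (cinner u (T u)) = 0" for u
  proof -
    have "cinner u (T u) = cnj (cinner u (T u))"
      using psd_cinner_symmetric[of T u u] cinner_commute[of u "T u"] T by simp
    from arg_cong[OF this, of Im] show ?thesis by simp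
  qed
  then show "positive_op T"
    using T by (simp add: positive_op_def complex_nonneg_Reals_iff psd_nonneg flip: inner_eq_Re_cinner)
qed

text \<open>Multiplication by a complex scalar is itself a bounded real-linear operator, and complex
  linearity means commuting with all of these.\<close>

lemma complex_linear_op_of_commutant:
  assumes A: "complex_linear_op A" and comm: "\<And>T. T o\<^sub>L A = A o\<^sub>L T \<Longrightarrow> T o\<^sub>L S = S o\<^sub>L T"
  shows "complex_linear_op S"
  unfolding complex_linear_op_def
proof (intro allI)
  fix c u
  define J where "J = Blinfun (cscale c)"
  have J: "J x = c *\<^sub>c x" for x
    unfolding J_def by (simp add: bounded_linear_Blinfun_apply cscale.bounded_linear_right)
  have "J o\<^sub>L A = A o\<^sub>L J"
    by (rule blinfun_eqI) (simp add: J complex_linear_opD[OF A])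
  from comm[OF this] show "S (c *\<^sub>c u) = c *\<^sub>c S u"
    by (metis J blinfun_apply_blinfun_compose)
qed

lemma positive_op_sqrt:
  assumes "positive_op Q"
  shows "\<exists>R. positive_op R \<and> R o\<^sub>L R = Q"
proof -
  have Q: "complex_linear_op Q" "psd Q" using assms by (simp_all add: positive_op_iff)
  obtain R where R: "psd R" "R o\<^sub>L R = Q" and comm: "\<And>T. T o\<^sub>L Q = Q o\<^sub>L T \<Longrightarrow> T o\<^sub>L R = R o\<^sub>L T"
    using psd_sqrt_exists[OF Q(2)] by metis
  have "complex_linear_op R" by (rule complex_linear_op_of_commutant[OF Q(1) comm])
  with R show ?thesis by (auto simp: positive_op_iff)
qed

section \<open>Riesz representation and adjoints\<close>

text \<open>The representing vector is built from its Fock coefficients, the conjugates of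
  \<open>\<phi> (fock n)\<close>. Evaluating \<open>\<phi>\<close> at a finite partial sum bounds
  the sum of squares \<open>s\<close> by sqrt(s) C, hence by C^2.\<close>

lemma riesz_representation:
  fixes \<phi> :: "l2 \<Rightarrow> complex"
  assumes lin: "bounded_linear \<phi>" and scale: "\<And>c x. \<phi> (c *\<^sub>c x) = c * \<phi> x"
  shows "\<exists>z. \<forall>x. \<phi> x = cinner z x"
proof -
  interpret \<phi>: bounded_linear \<phi> by fact
  obtain C where C: "\<And>x. norm (\<phi> x) \<le> norm x * C" using \<phi>.bounded by blast
  define a where "a n = cnj (\<phi> (fock n))" for n
  have le: "(\<Sum>n\<in>F. (cmod (a n))\<^sup>2) \<le> C\<^sup>2" if F: "finite F" for F
  proof -
    define s where "s = (\<Sum>n\<in>F. (cmod (a n))\<^sup>2)"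
    have s0: "0 \<le> s" unfolding s_def by (intro sum_nonneg) simp
    let ?x = "\<Sum>n\<in>F. a n *\<^sub>c fock n"
    have "\<phi> ?x = (\<Sum>n\<in>F. a n * cnj (a n))" by (simp add: \<phi>.sum scale a_def)
    also have "\<dots> = complex_of_real s"
      unfolding s_def of_real_sum by (intro sum.cong refl) (rule complex_norm_square[symmetric])
    finally have "s = norm (\<phi> ?x)" using s0 by simp
    also have "\<dots> \<le> norm ?x * C" by (rule C)
    also have "norm ?x = sqrt s"
      using norm_fock_sum[OF F, of a] by (simp add: s_def real_sqrt_unique)
    finally have sC: "sqrt s * sqrt s \<le> sqrt s * C" using s0 by simp
    show ?thesis
    proof (cases "s = 0")
      case False
      then have "0 < sqrt s" using s0 by simp
      with sC have "sqrt s \<le> C" by (simp only: mult_le_cancel_left_pos)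
      then have "(sqrt s)\<^sup>2 \<le> C\<^sup>2" using s0 by (intro power_mono) auto
      then show ?thesis using s0 by (simp add: s_def)
    qed (simp flip: s_def)
  qed
  then have "summable (\<lambda>n. (cmod (a n))\<^sup>2)" by (intro bounded_imp_summable[where B = "C\<^sup>2"]) auto
  note sm = riesz_fischer[OF this]
  define z where "z = (\<Sum>n. a n *\<^sub>c fock n)"
  have z: "cinner z (fock n) = \<phi> (fock n)" for n
    using cinner_fock_suminf[OF sm, of n] cinner_commute[of z "fock n"] by (simp add: z_def a_def)
  have "\<phi> x = cinner z x" for x
  proof (rule sums_unique2)
    show "(\<lambda>n. cinner (fock n) x * \<phi> (fock n)) sums \<phi> x"
      using \<phi>.sums[OF fock_expansion[of x]] by (simp add: scale)
    show "(\<lambda>n. cinner (fock n) x * \<phi> (fock n)) sums cinner z x"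
      using bounded_linear.sums[OF cinner.bounded_linear_right fock_expansion[of x], of z]
      by (simp add: cinner_cscale_right z)
  qed
  then show ?thesis by blast
qed

lemma complex_adjoint_exists:
  assumes T: "complex_linear_op T"
  shows "\<exists>S. complex_linear_op S \<and> (\<forall>u v. cinner (S u) v = cinner u (T v))"
proof -
  have "\<exists>z. \<forall>x. cinner u (T x) = cinner z x" for u
  proof (rule riesz_representation)
    show "bounded_linear (\<lambda>x. cinner u (T x))"
      by (rule bounded_linear_compose[OF cinner.bounded_linear_right blinfun.bounded_linear_right])
    show "cinner u (T (c *\<^sub>c x)) = c * cinner u (T x)" for c x
      by (simp add: complex_linear_opD[OF T] cinner_cscale_right)
  qed
  then obtain f where f: "\<And>u x. cinner u (T x) = cinner (f u) x" by metis
  have f': "cinner x (f u) = cinner (T x) u" for x u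
    using f[of u x] cinner_commute by metis
  have "bounded_linear f"
  proof (rule bounded_linear_intro)
    show "f (x + y) = f x + f y" for x y
      by (rule cinner_ext) (simp add: f' cinner.add_right)
    show "f (r *\<^sub>R x) = r *\<^sub>R f x" for r x
      by (rule cinner_ext) (simp add: f' cinner.scaleR_right)
    show "norm (f x) \<le> norm x * norm T" for x
    proof (cases "f x = 0")
      case False
      have "(norm (f x))\<^sup>2 = norm (cinner (f x) (f x))" by (simp add: cinner_self norm_power)
      also have "\<dots> = norm (cinner x (T (f x)))" by (simp add: f)
      also have "\<dots> \<le> norm x * norm (T (f x))" by (rule cmod_cinner_le)
      also have "\<dots> \<le> norm x * (norm T * norm (f x))" by (intro mult_left_mono norm_blinfun) simp
      finally show ?thesis using False by (simp add: power2_eq_square mult_ac)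
    qed simp
  qed
  then have B: "blinfun_apply (Blinfun f) = f" by (rule bounded_linear_Blinfun_apply)
  show ?thesis
  proof (intro exI[of _ "Blinfun f"] conjI allI)
    show "complex_linear_op (Blinfun f)"
      unfolding complex_linear_op_def B
      by (intro allI cinner_ext) (simp add: f' cinner_cscale_right)
  qed (simp add: B f)
qed

text \<open>A bounded operator for the complex inner product, whereas \<open>adjoint\<close> is a
  plain function chosen for the real one. They agree on complex linear operators.\<close>

definition cadjoint :: "(l2 \<Rightarrow>\<^sub>L l2) \<Rightarrow> (l2 \<Rightarrow>\<^sub>L l2)" where
  "cadjoint T = (SOME S. complex_linear_op S \<and> (\<forall>u v. cinner (S u) v = cinner u (T v)))"

lemma
  assumes "complex_linear_op T"
  shows complex_linear_op_cadjoint: "complex_linear_op (cadjoint T)"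
    and cadjoint_left: "cinner (cadjoint T u) v = cinner u (T v)"
    and cadjoint_right: "cinner u (cadjoint T v) = cinner (T u) v"
proof -
  have *: "complex_linear_op (cadjoint T) \<and> (\<forall>u v. cinner (cadjoint T u) v = cinner u (T v))"
    unfolding cadjoint_def by (rule someI_ex) (rule complex_adjoint_exists[OF assms])
  then show "complex_linear_op (cadjoint T)" "cinner (cadjoint T u) v = cinner u (T v)" by auto
  show "cinner u (cadjoint T v) = cinner (T u) v"
    using * cinner_commute by metis
qed

lemma adjoint_eq_cadjoint:
  assumes "complex_linear_op T"
  shows "adjoint (blinfun_apply T) = blinfun_apply (cadjoint T)"
  by (rule adjoint_unique) (simp add: inner_eq_Re_cinner cadjoint_right[OF assms])

lemma cadjoint_contraction:
  assumes X: "complex_linear_op X" and le: "\<And>u. norm (X u) \<le> norm u"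
  shows "norm (cadjoint X u) \<le> norm u"
proof (cases "cadjoint X u = 0")
  case False
  have "(norm (cadjoint X u))\<^sup>2 = norm (cinner (cadjoint X u) (cadjoint X u))"
    by (simp add: cinner_self norm_power)
  also have "\<dots> = norm (cinner u (X (cadjoint X u)))" by (simp add: cadjoint_left[OF X])
  also have "\<dots> \<le> norm u * norm (X (cadjoint X u))" by (rule cmod_cinner_le)
  also have "\<dots> \<le> norm u * norm (cadjoint X u)" by (intro mult_left_mono le) simp
  finally show ?thesis using False by (simp add: power2_eq_square)
qed simp

section \<open>The absolute value of an operator\<close>

lemma abs_op_unique:
  assumes T: "complex_linear_op T" and P: "positive_op P" and sq: "\<And>x. P (P x) = cadjoint T (T x)"
  shows "abs_op T = P"
  unfolding abs_op_def
proof (rule the_equality)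
  show "positive_op P \<and> blinfun_apply (P o\<^sub>L P) = adjoint T \<circ> T"
    using P sq by (auto simp: adjoint_eq_cadjoint[OF T])
  fix Q assume Q: "positive_op Q \<and> blinfun_apply (Q o\<^sub>L Q) = adjoint T \<circ> T"
  then have "blinfun_apply (Q o\<^sub>L Q) = blinfun_apply (P o\<^sub>L P)"
    using sq by (auto simp: adjoint_eq_cadjoint[OF T])
  then have "Q o\<^sub>L Q = P o\<^sub>L P" by (simp only: blinfun_apply_inject)
  moreover have "psd Q" "psd P" using P Q by (simp_all add: positive_op_iff)
  ultimately show "Q = P" by (metis psd_sqrt_unique)
qed

lemma
  assumes T: "complex_linear_op T"
  shows positive_abs_op: "positive_op (abs_op T)"
    and abs_op_square: "abs_op T (abs_op T x) = cadjoint T (T x)"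
proof -
  let ?A = "cadjoint T o\<^sub>L T"
  have lin: "complex_linear_op ?A"
    by (intro complex_linear_op_compose complex_linear_op_cadjoint T)
  have "psd ?A"
    by (simp add: psd_def inner_eq_Re_cinner cadjoint_left[OF T] cadjoint_right[OF T])
      (simp flip: inner_eq_Re_cinner)
  then obtain P where P: "positive_op P" "P o\<^sub>L P = ?A"
    using positive_op_sqrt[of ?A] lin by (auto simp: positive_op_iff)
  have sq: "P (P x) = cadjoint T (T x)" for x
    using arg_cong[OF P(2), of "\<lambda>F. F x"] by simp
  have "abs_op T = P" by (rule abs_op_unique[OF T P(1) sq])
  then show "positive_op (abs_op T)" "abs_op T (abs_op T x) = cadjoint T (T x)"
    using P(1) sq by simp_all
qed

lemma positive_opD:
  assumes "positive_op Q"
  shows positive_op_linear: "complex_linear_op Q" and positive_op_psd: "psd Q"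
    and positive_op_symmetric: "cinner (Q u) v = cinner u (Q v)"
  using assms by (simp_all add: positive_op_iff psd_cinner_symmetric)

lemma norm_abs_op:
  assumes T: "complex_linear_op T"
  shows "norm (abs_op T x) = norm (T x)"
proof -
  have "cinner (abs_op T x) (abs_op T x) = cinner (T x) (T x)"
    by (simp add: positive_op_symmetric[OF positive_abs_op[OF T]] abs_op_square[OF T] cadjoint_right[OF T])
  then have "(norm (abs_op T x))\<^sup>2 = (norm (T x))\<^sup>2"
    by (simp only: cinner_self of_real_eq_iff)
  then show ?thesis by (simp add: power2_eq_iff_nonneg)
qed

lemma abs_op_positive:
  assumes "positive_op Q"
  shows "abs_op Q = Q"
proof (rule abs_op_unique[OF positive_op_linear[OF assms] assms])
  show "Q (Q x) = cadjoint Q (Q x)" for x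
    by (rule cinner_ext) (simp add: cadjoint_right positive_op_symmetric positive_op_linear assms)
qed

text \<open>Stated for all bounded real-linear operators, because \<open>Metric_space\<close>
  demands symmetry of the distance also outside \<open>trace_class\<close>. The real functional f(x)
  = <y, T x> is the real part of the complex linear functional f(x) - i f(i x), to which the complex
  Riesz theorem applies.\<close>

lemma adjoint_characterization:
  fixes T :: "l2 \<Rightarrow>\<^sub>L l2"
  shows "T x \<bullet> y = x \<bullet> adjoint T y"
proof -
  have "\<exists>z. \<forall>x. T x \<bullet> y = x \<bullet> z" for y
  proof -
    define \<phi> where "\<phi> x = Complex (y \<bullet> T x) (- (y \<bullet> T (\<i> *\<^sub>c x)))" for x
    have "bounded_linear \<phi>"
    proof (rule bounded_linear_intro)
      show "\<phi> (u + v) = \<phi> u + \<phi> v" for u v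
        by (simp add: \<phi>_def complex_eq_iff blinfun.add_right cscale.add_right inner_add_right)
      show "\<phi> (r *\<^sub>R u) = r *\<^sub>R \<phi> u" for r u
        by (simp add: \<phi>_def complex_eq_iff blinfun.scaleR_right cscale.scaleR_right)
      fix u
      have *: "\<bar>y \<bullet> T v\<bar> \<le> norm y * (norm T * norm v)" for v
        using Cauchy_Schwarz_ineq2[of y "T v"] mult_left_mono[OF norm_blinfun[of T v], of "norm y"] by simp
      have "norm (\<phi> u) \<le> \<bar>y \<bullet> T u\<bar> + \<bar>y \<bullet> T (\<i> *\<^sub>c u)\<bar>"
        using cmod_le[of "\<phi> u"] by (simp add: \<phi>_def)
      also have "\<dots> \<le> norm y * (norm T * norm u) + norm y * (norm T * norm u)"
        using *[of u] *[of "\<i> *\<^sub>c u"] by (intro add_mono) (simp_all add: norm_cscale)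
      also have "\<dots> = norm u * (2 * norm y * norm T)" by simp
      finally show "norm (\<phi> u) \<le> norm u * (2 * norm y * norm T)" .
    qed
    moreover have "\<phi> (c *\<^sub>c u) = c * \<phi> u" for c u
    proof -
      have c: "c *\<^sub>c v = Re c *\<^sub>R v + Im c *\<^sub>R (\<i> *\<^sub>c v)" for v
        by (simp add: scaleR_eq_cscale cscale_cscale mult.commute flip: cscale_add_left complex_eq)
      have i: "\<i> *\<^sub>c (c *\<^sub>c v) = (- Im c) *\<^sub>R v + Re c *\<^sub>R (\<i> *\<^sub>c v)" for v
        by (simp add: scaleR_eq_cscale cscale_cscale complex_eq_iff flip: cscale_add_left)
          (rule arg_cong[where f = "\<lambda>c. c *\<^sub>c v"], simp add: complex_eq_iff)
      show ?thesis
        unfolding \<phi>_def i unfolding c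
        by (simp add: complex_eq_iff blinfun.add_right blinfun.scaleR_right inner_add_right algebra_simps
            blinfun.minus_right blinfun.diff_right inner_diff_right)
    qed
    ultimately obtain z where z: "\<And>x. \<phi> x = cinner z x"
      using riesz_representation by metis
    have "T x \<bullet> y = x \<bullet> z" for x
    proof -
      have "Re (\<phi> x) = z \<bullet> x" by (simp add: z inner_eq_Re_cinner)
      then show ?thesis by (simp add: \<phi>_def inner_commute)
    qed
    then show ?thesis by blast
  qed
  then have "\<exists>f'. \<forall>x y. T x \<bullet> y = x \<bullet> f' y" by metis
  then show ?thesis
    unfolding adjoint_def by (rule someI2_ex) blast
qed

lemma abs_op_minus: "abs_op (- T) = abs_op T"
proof -
  have eq: "x \<bullet> adjoint T (- y) = x \<bullet> - adjoint T y" for x y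
    by (simp flip: adjoint_characterization)
  have odd: "adjoint T (- y) = - adjoint T y" for y
    by (rule vector_eq_ldot[THEN iffD1, OF allI]) (rule eq)
  have "adjoint (blinfun_apply (- T)) = (\<lambda>y. - adjoint T y)"
    by (rule adjoint_unique) (simp add: blinfun.minus_left adjoint_characterization)
  then have "adjoint (blinfun_apply (- T)) \<circ> blinfun_apply (- T) = adjoint T \<circ> T"
    by (auto simp: blinfun.minus_left odd)
  then show ?thesis by (simp add: abs_op_def)
qed

lemma trace_norm_minus_commute: "trace_norm (S - T) = trace_norm (T - S)"
  using abs_op_minus[of "T - S"] by (simp add: trace_norm_def)

lemma Re_cinner_positive: "positive_op Q \<Longrightarrow> 0 \<le> Re (cinner u (Q u))"
  using psd_nonneg[OF positive_op_psd] by (simp add: inner_eq_Re_cinner)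

lemma norm_sqrt_apply:
  assumes "positive_op R" "R o\<^sub>L R = Q"
  shows "Re (cinner u (Q u)) = (norm (R u))\<^sup>2"
proof -
  have "cinner u (Q u) = cinner (R u) (R u)"
    using assms(1) by (simp add: positive_op_symmetric flip: assms(2))
  then show ?thesis by (simp add: cinner_self)
qed

text \<open>Approximate polar decomposition, with \<open>W = T (|T| + e)\<^sup>-\<^sup>1\<close>.\<close>

lemma polar_approximation:
  assumes T: "complex_linear_op T" and e: "0 < e"
  obtains W where "complex_linear_op W" "\<And>x. norm (W x) \<le> norm x"
    "\<And>x. norm (T x - W (abs_op T x)) \<le> e * norm x"
    "\<And>x. Re (cinner x (abs_op T x)) \<le> Re (cinner (W x) (T x)) + e * (norm x)\<^sup>2"
proof -
  let ?P = "abs_op T"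
  have P: "positive_op ?P" by (rule positive_abs_op[OF T])
  obtain K :: "l2 \<Rightarrow>\<^sub>L l2" where K1: "\<And>x. ?P (K x) + e *\<^sub>R K x = x" and K2: "\<And>x. K (?P x + e *\<^sub>R x) = x"
    using psd_resolvent[OF positive_op_psd[OF P] e] by blast
  have K: "complex_linear_op K"
    unfolding complex_linear_op_def
  proof (intro allI)
    fix c u
    have "?P (c *\<^sub>c K u) + e *\<^sub>R (c *\<^sub>c K u) = c *\<^sub>c u"
      by (simp add: complex_linear_opD[OF positive_op_linear[OF P]] K1 flip: cscale.scaleR_right cscale.add_right)
    then show "K (c *\<^sub>c u) = c *\<^sub>c K u" using K2[of "c *\<^sub>c K u"] by simp
  qed
  have PK: "norm (?P (K x)) \<le> norm x" for x
    by (rule psd_shift_bound(1)[OF positive_op_psd[OF P] e K1])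
  show ?thesis
  proof (rule that[of "T o\<^sub>L K"])
    show "complex_linear_op (T o\<^sub>L K)" by (intro complex_linear_op_compose T K)
    show bound: "norm ((T o\<^sub>L K) x) \<le> norm x" for x
      using PK[of x] by (simp add: norm_abs_op[OF T])
    show "norm (T x - (T o\<^sub>L K) (?P x)) \<le> e * norm x" for x
    proof -
      have "K (?P x) + e *\<^sub>R K x = x" using K2[of x] by (simp add: blinfun.add_right blinfun.scaleR_right)
      then have "x - K (?P x) = e *\<^sub>R K x" by (simp add: algebra_simps)
      then have "T x - (T o\<^sub>L K) (?P x) = e *\<^sub>R (T o\<^sub>L K) x"
        by (simp flip: blinfun.diff_right) (simp add: blinfun.scaleR_right)
      then show ?thesis using bound[of x] e by simp
    qed
    show "Re (cinner x (?P x)) \<le> Re (cinner ((T o\<^sub>L K) x) (T x)) + e * (norm x)\<^sup>2" for x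
    proof -
      have "cinner ((T o\<^sub>L K) x) (T x) = cinner (K x) (?P (?P x))"
        by (simp add: abs_op_square[OF T] cadjoint_right[OF T])
      also have "\<dots> = cinner (?P (K x)) (?P x)" by (simp add: positive_op_symmetric[OF P])
      also have "?P (K x) = x - e *\<^sub>R K x" using K1[of x] by (simp add: algebra_simps)
      finally have "Re (cinner x (?P x)) = Re (cinner ((T o\<^sub>L K) x) (T x)) + e * Re (cinner (K x) (?P x))"
        by (simp add: cinner.diff_left cinner.scaleR_left)
      also have "Re (cinner (K x) (?P x)) \<le> (norm x)\<^sup>2"
      proof -
        have "Re (cinner (K x) (?P x)) \<le> norm (cinner (?P (K x)) x)"
          by (simp add: positive_op_symmetric[OF P] complex_Re_le_cmod)
        also have "\<dots> \<le> norm (?P (K x)) * norm x" by (rule cmod_cinner_le)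
        also have "\<dots> \<le> norm x * norm x" by (intro mult_right_mono PK) simp
        finally show ?thesis by (simp add: power2_eq_square)
      qed
      finally show ?thesis using e by simp
    qed
  qed
qed

section \<open>Duality between the trace norm and contractions\<close>

text \<open>Cauchy-Schwarz for Hilbert-Schmidt operators, with \<open>Q\<close> split as R R. The
  second factor keeps the restriction to \<open>F\<close>, so that the bound is small when
  \<open>F\<close> lies far out in the Fock basis and \<open>Q\<close> has bounded energy.\<close>

lemma sum_cinner_positive_le:
  assumes Q: "positive_op Q" and tr: "(\<Sum>n. ennreal (population Q n)) \<le> ennreal t"
    and t: "0 \<le> t" and X: "complex_linear_op X" and contr: "\<And>u. norm (X u) \<le> norm u" and F: "finite F"
  shows "(\<Sum>n\<in>F. cmod (cinner (X (fock n)) (Q (fock n)))) \<le>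
    sqrt t * sqrt (\<Sum>n\<in>F. population Q n)"
proof -
  obtain R where R: "positive_op R" and RR: "R o\<^sub>L R = Q" using positive_op_sqrt[OF Q] by blast
  have Q_eq: "Q u = R (R u)" for u by (simp flip: RR)
  have "(\<Sum>n\<in>F. cmod (cinner (X (fock n)) (Q (fock n)))) \<le>
      (\<Sum>n\<in>F. \<bar>norm (R (X (fock n)))\<bar> * \<bar>norm (R (fock n))\<bar>)"
  proof (intro sum_mono)
    fix n
    have "cinner (X (fock n)) (Q (fock n)) = cinner (R (X (fock n))) (R (fock n))"
      by (simp add: Q_eq positive_op_symmetric[OF R])
    then show "cmod (cinner (X (fock n)) (Q (fock n))) \<le> \<bar>norm (R (X (fock n)))\<bar> * \<bar>norm (R (fock n))\<bar>"
      by (simp add: cmod_cinner_le)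
  qed
  also have "\<dots> \<le> L2_set (\<lambda>n. norm (R (X (fock n)))) F * L2_set (\<lambda>n. norm (R (fock n))) F"
    by (rule L2_set_mult_ineq)
  also have "L2_set (\<lambda>n. norm (R (fock n))) F = sqrt (\<Sum>n\<in>F. population Q n)"
    by (simp add: L2_set_def norm_sqrt_apply[OF R RR])
  also have "L2_set (\<lambda>n. norm (R (X (fock n)))) F \<le> sqrt t"
    unfolding L2_set_def
  proof (rule real_sqrt_le_mono)
    have "ennreal (\<Sum>n\<in>F. (norm (R (X (fock n))))\<^sup>2) = (\<Sum>n\<in>F. ennreal ((norm (R (X (fock n))))\<^sup>2))"
      by simp
    \<comment> \<open>Parseval for \<open>R (X (fock n))\<close>, with \<open>R\<close> and
      \<open>X\<close> moved to the other side. After the sums are exchanged, Bessel's inequality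
      for each \<open>m\<close> removes the contraction and leaves
      \<open>norm (R (fock m))\<close>.\<close>
    also have "\<dots> = (\<Sum>n\<in>F. \<Sum>m. ennreal ((cmod (cinner (fock n) (cadjoint X (R (fock m)))))\<^sup>2))"
    proof (intro sum.cong refl)
      fix n
      have "cmod (cinner (fock m) (R (X (fock n)))) = cmod (cinner (fock n) (cadjoint X (R (fock m))))" for m
        by (metis R X cadjoint_left cinner_commute complex_mod_cnj positive_op_symmetric)
      then show "ennreal ((norm (R (X (fock n))))\<^sup>2) =
          (\<Sum>m. ennreal ((cmod (cinner (fock n) (cadjoint X (R (fock m)))))\<^sup>2))"
        by (simp flip: parseval_ennreal)
    qed
    also have "\<dots> = (\<Sum>m. \<Sum>n\<in>F. ennreal ((cmod (cinner (fock n) (cadjoint X (R (fock m)))))\<^sup>2))"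
      by (rule suminf_sum[symmetric]) (rule summableI)
    also have "\<dots> \<le> (\<Sum>m. ennreal (population Q m))"
    proof (intro suminf_le summableI)
      fix m
      have "(\<Sum>n\<in>F. ennreal ((cmod (cinner (fock n) (cadjoint X (R (fock m)))))\<^sup>2)) \<le>
          ennreal ((norm (cadjoint X (R (fock m))))\<^sup>2)"
        using bessel[OF F] by (simp add: sum_ennreal ennreal_leI)
      also have "\<dots> \<le> ennreal ((norm (R (fock m)))\<^sup>2)"
        by (intro ennreal_leI power_mono cadjoint_contraction X contr) simp
      finally show "(\<Sum>n\<in>F. ennreal ((cmod (cinner (fock n) (cadjoint X (R (fock m)))))\<^sup>2)) \<le>
          ennreal (population Q m)"
        by (simp add: norm_sqrt_apply[OF R RR])
    qed
    also have "\<dots> \<le> ennreal t" by (rule tr)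
    finally show "(\<Sum>n\<in>F. (norm (R (X (fock n))))\<^sup>2) \<le> t"
      using t by (subst (asm) ennreal_le_iff) auto
  qed
  finally show ?thesis
    by (simp add: mult_right_mono sum_nonneg Re_cinner_positive[OF Q])
qed

lemma real_le_of_approx:
  fixes x t c :: real
  assumes "\<And>e. 0 < e \<Longrightarrow> x \<le> t + c * e" "0 \<le> c"
  shows "x \<le> t"
proof (rule field_le_epsilon)
  fix e :: real assume "0 < e"
  then have "x \<le> t + c * (e / (c + 1))" using assms(2) by (intro assms(1)) auto
  also have "c * (e / (c + 1)) \<le> e"
    using assms(2) \<open>0 < e\<close> by (simp add: field_simps)
  finally show "x \<le> t + e" by simp
qed

text \<open>Up to an error \<open>e\<close> per basis vector, \<open>A\<close> is a contraction
  \<open>V\<close> times its absolute value, and the adjoint of \<open>V\<close> joins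
  \<open>W\<close>. Since \<open>F\<close> is fixed and finite the total error vanishes with
  \<open>e\<close>, so an approximate polar decomposition suffices.\<close>

lemma sum_cinner_le_trace_norm:
  assumes A: "complex_linear_op A" and tr: "trace_norm A \<le> ennreal t" and t: "0 \<le> t"
    and W: "complex_linear_op W" and contr: "\<And>u. norm (W u) \<le> norm u" and F: "finite F"
  shows "(\<Sum>n\<in>F. cmod (cinner (W (fock n)) (A (fock n)))) \<le> t"
proof (rule real_le_of_approx)
  fix e :: real assume "0 < e"
  then obtain V where V: "complex_linear_op V" "\<And>x. norm (V x) \<le> norm x"
    and approx: "\<And>x. norm (A x - V (abs_op A x)) \<le> e * norm x"
    using polar_approximation[OF A] by metis
  let ?P = "abs_op A"
  let ?X = "cadjoint V o\<^sub>L W"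
  have P: "positive_op ?P" by (rule positive_abs_op[OF A])
  have X: "complex_linear_op ?X" "\<And>u. norm (?X u) \<le> norm u"
    using V W order_trans[OF cadjoint_contraction[OF V] contr]
    by (auto intro: complex_linear_op_compose complex_linear_op_cadjoint)
  have trP: "(\<Sum>n. ennreal (population ?P n)) \<le> ennreal t"
    using tr by (simp add: trace_norm_def)
  have "(\<Sum>n\<in>F. cmod (cinner (W (fock n)) (A (fock n)))) \<le>
      (\<Sum>n\<in>F. cmod (cinner (?X (fock n)) (?P (fock n))) + e)"
  proof (intro sum_mono)
    fix n
    have "cinner (W (fock n)) (A (fock n)) =
        cinner (?X (fock n)) (?P (fock n)) + cinner (W (fock n)) (A (fock n) - V (?P (fock n)))"
      by (simp add: cadjoint_left[OF V(1)] cinner.diff_right)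
    then have "cmod (cinner (W (fock n)) (A (fock n))) \<le>
        cmod (cinner (?X (fock n)) (?P (fock n))) + cmod (cinner (W (fock n)) (A (fock n) - V (?P (fock n))))"
      by (metis norm_triangle_ineq)
    also have "cmod (cinner (W (fock n)) (A (fock n) - V (?P (fock n)))) \<le>
        norm (W (fock n)) * norm (A (fock n) - V (?P (fock n)))"
      by (rule cmod_cinner_le)
    also have "\<dots> \<le> 1 * e"
      using contr[of "fock n"] approx[of "fock n"] \<open>0 < e\<close> by (intro mult_mono) auto
    finally show "cmod (cinner (W (fock n)) (A (fock n))) \<le> cmod (cinner (?X (fock n)) (?P (fock n))) + e"
      by simp
  qed
  also have "\<dots> = (\<Sum>n\<in>F. cmod (cinner (?X (fock n)) (?P (fock n)))) + real (card F) * e"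
    by (simp add: sum.distrib)
  also have "(\<Sum>n\<in>F. cmod (cinner (?X (fock n)) (?P (fock n)))) \<le>
      sqrt t * sqrt (\<Sum>n\<in>F. population ?P n)"
    by (rule sum_cinner_positive_le[OF P trP t X F])
  also have "\<dots> \<le> sqrt t * sqrt t"
  proof (intro mult_left_mono real_sqrt_le_mono)
    have "ennreal (\<Sum>n\<in>F. population ?P n) =
        (\<Sum>n\<in>F. ennreal (population ?P n))"
      by (simp add: sum_ennreal Re_cinner_positive[OF P])
    also have "\<dots> \<le> (\<Sum>n. ennreal (population ?P n))"
      by (rule sum_le_suminf[OF summableI F]) simp
    also note trP
    finally show "(\<Sum>n\<in>F. population ?P n) \<le> t"
      using t by (subst (asm) ennreal_le_iff) auto
  qed (use t in simp)
  also have "sqrt t * sqrt t = t" using t by simp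
  finally show "(\<Sum>n\<in>F. cmod (cinner (W (fock n)) (A (fock n)))) \<le> t + real (card F) * e" by simp
qed simp

text \<open>The converse half of the duality: the contractions of the approximate polar
  decomposition nearly attain the trace norm. With \<open>sum_cinner_le_trace_norm\<close> this
  describes the trace norm as a supremum of expressions linear in the operator, whence the triangle
  inequality.\<close>

lemma trace_norm_le:
  assumes T: "complex_linear_op T"
    and bound: "\<And>W N. complex_linear_op W \<Longrightarrow> (\<And>u. norm (W u) \<le> norm u) \<Longrightarrow>
      (\<Sum>n<N. Re (cinner (W (fock n)) (T (fock n)))) \<le> t"
  shows "trace_norm T \<le> ennreal t"
  unfolding trace_norm_def
proof (rule suminf_le_const[OF summableI])
  fix N :: nat
  let ?P = "abs_op T"
  have P: "positive_op ?P" by (rule positive_abs_op[OF T])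
  have "(\<Sum>n<N. population ?P n) \<le> t"
  proof (rule real_le_of_approx)
    fix e :: real assume "0 < e"
    then obtain W where W: "complex_linear_op W" "\<And>x. norm (W x) \<le> norm x"
      and approx: "\<And>x. Re (cinner x (?P x)) \<le> Re (cinner (W x) (T x)) + e * (norm x)\<^sup>2"
      using polar_approximation[OF T] by metis
    have "(\<Sum>n<N. population ?P n) \<le> (\<Sum>n<N. Re (cinner (W (fock n)) (T (fock n))) + e)"
      using approx[of "fock _"] by (intro sum_mono) simp
    also have "\<dots> \<le> t + real N * e" using bound[OF W, of N] by (simp add: sum.distrib)
    finally show "(\<Sum>n<N. population ?P n) \<le> t + real N * e" .
  qed simp
  then show "(\<Sum>n<N. ennreal (population ?P n)) \<le> ennreal t"
    by (simp add: sum_ennreal Re_cinner_positive[OF P] ennreal_leI)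
qed

lemma trace_norm_triangle:
  assumes A: "complex_linear_op A" and B: "complex_linear_op B"
  shows "trace_norm (A + B) \<le> trace_norm A + trace_norm B"
proof (cases "trace_norm A = \<infinity> \<or> trace_norm B = \<infinity>")
  case False
  define a b where "a = enn2real (trace_norm A)" and "b = enn2real (trace_norm B)"
  have ab: "trace_norm A = ennreal a" "0 \<le> a" "trace_norm B = ennreal b" "0 \<le> b"
    using False by (simp_all add: a_def b_def less_top)
  have "trace_norm (A + B) \<le> ennreal (a + b)"
  proof (rule trace_norm_le)
    show "complex_linear_op (A + B)" by (rule complex_linear_op_add[OF A B])
    fix W N assume W: "complex_linear_op W" "\<And>u. norm (W u) \<le> norm u"
    have "(\<Sum>n<N. Re (cinner (W (fock n)) ((A + B) (fock n)))) \<le>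
        (\<Sum>n<N. cmod (cinner (W (fock n)) (A (fock n))) + cmod (cinner (W (fock n)) (B (fock n))))"
      by (intro sum_mono) (simp add: blinfun.add_left cinner.add_right add_mono complex_Re_le_cmod)
    also have "\<dots> \<le> a + b"
      unfolding sum.distrib
      by (intro add_mono sum_cinner_le_trace_norm A B W) (use ab in auto)
    finally show "(\<Sum>n<N. Re (cinner (W (fock n)) ((A + B) (fock n)))) \<le> a + b" .
  qed
  then show ?thesis using ab by simp
qed auto

text \<open>With R the root of P = |T|, Cauchy-Schwarz for each Fock coefficient of P x gives |P
  x|^2 \<le> t |R x|^2, and |R x|^2 = <x, P x> is at most |x| |P x|.\<close>

lemma norm_le_trace_norm:
  assumes T: "complex_linear_op T" and tr: "trace_norm T \<le> ennreal t" and t: "0 \<le> t"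
  shows "norm T \<le> t"
proof (rule norm_blinfun_bound[OF t])
  fix x
  let ?P = "abs_op T"
  have P: "positive_op ?P" by (rule positive_abs_op[OF T])
  obtain R where R: "positive_op R" and RR: "R o\<^sub>L R = ?P" using positive_op_sqrt[OF P] by blast
  have P_eq: "?P u = R (R u)" for u by (simp flip: RR)
  have "ennreal ((norm (?P x))\<^sup>2) = (\<Sum>m. ennreal ((cmod (cinner (fock m) (?P x)))\<^sup>2))"
    by (rule parseval_ennreal[symmetric])
  also have "\<dots> \<le> (\<Sum>m. ennreal (population ?P m) * ennreal ((norm (R x))\<^sup>2))"
  proof (intro suminf_le summableI)
    fix m
    have "cinner (fock m) (?P x) = cinner (R (fock m)) (R x)"
      by (simp add: P_eq positive_op_symmetric[OF R])
    then have "cmod (cinner (fock m) (?P x)) \<le> norm (R (fock m)) * norm (R x)"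
      by (simp add: cmod_cinner_le)
    then have "(cmod (cinner (fock m) (?P x)))\<^sup>2 \<le> population ?P m * (norm (R x))\<^sup>2"
      unfolding norm_sqrt_apply[OF R RR] power_mult_distrib[symmetric] by (intro power_mono) auto
    then show "ennreal ((cmod (cinner (fock m) (?P x)))\<^sup>2) \<le>
        ennreal (population ?P m) * ennreal ((norm (R x))\<^sup>2)"
      by (simp add: Re_cinner_positive[OF P] ennreal_leI flip: ennreal_mult)
  qed
  also have "\<dots> = trace_norm T * ennreal ((norm (R x))\<^sup>2)"
    by (simp add: ennreal_suminf_multc trace_norm_def)
  also have "\<dots> \<le> ennreal t * ennreal ((norm (R x))\<^sup>2)" by (intro mult_right_mono tr) simp
  also have "\<dots> = ennreal (t * (norm (R x))\<^sup>2)" using t by (simp add: ennreal_mult)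
  finally have "(norm (?P x))\<^sup>2 \<le> t * (norm (R x))\<^sup>2"
    using t by (subst (asm) ennreal_le_iff) auto
  also have "(norm (R x))\<^sup>2 \<le> norm x * norm (?P x)"
    using cmod_cinner_le[of x "?P x"] complex_Re_le_cmod[of "cinner x (?P x)"]
    by (simp flip: norm_sqrt_apply[OF R RR])
  finally have "norm (?P x) * norm (?P x) \<le> t * norm x * norm (?P x)"
    using t by (simp add: power2_eq_square mult.assoc mult_left_mono)
  then have "norm (?P x) \<le> t * norm x"
    using t by (cases "norm (?P x) = 0") (auto simp: mult_le_cancel_right)
  then show "norm (T x) \<le> t * norm x" by (simp add: norm_abs_op[OF T])
qed


section \<open>Trace class operators as a metric space\<close>

lemma trace_norm_diff_finite:
  assumes "S \<in> trace_class" "T \<in> trace_class"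
  shows "trace_norm (S - T) < \<infinity>"
proof -
  have "complex_linear_op (0 - T)"
    using assms by (intro complex_linear_op_diff complex_linear_op_zero) (simp add: trace_class_def)
  then have "trace_norm (S - T) \<le> trace_norm S + trace_norm (0 - T)"
    using trace_norm_triangle[of S "0 - T"] assms by (simp add: trace_class_def)
  also have "trace_norm (0 - T) = trace_norm T"
    using trace_norm_minus_commute[of 0 T] by simp
  finally show ?thesis using assms by (simp add: trace_class_def) (metis ennreal_add_less_top le_less_trans)
qed

lemma Metric_space_trace_class: "Metric_space trace_class (\<lambda>S T. enn2real (trace_norm (S - T)))"
proof
  show "0 \<le> enn2real (trace_norm (S - T))" for S T by simp
  have lin: "complex_linear_op (S - T)" if "S \<in> trace_class" "T \<in> trace_class" for S T
    using that by (simp add: trace_class_def complex_linear_op_diff)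
  show "enn2real (trace_norm (S - T)) = enn2real (trace_norm (T - S))" for S T
    by (simp only: trace_norm_minus_commute)
  note fin = trace_norm_diff_finite
  show "enn2real (trace_norm (S - T)) = 0 \<longleftrightarrow> S = T" if ST: "S \<in> trace_class" "T \<in> trace_class" for S T
  proof
    assume "enn2real (trace_norm (S - T)) = 0"
    then have "trace_norm (S - T) \<le> ennreal 0"
      using fin[OF ST] by (auto simp: enn2real_eq_0_iff)
    from norm_le_trace_norm[OF lin[OF ST] this] show "S = T" by simp
  next
    assume "S = T"
    have "positive_op 0" by (simp add: positive_op_def complex_linear_op_zero cinner.zero_right)
    then show "enn2real (trace_norm (S - T)) = 0"
      using \<open>S = T\<close> by (simp add: trace_norm_def abs_op_positive cinner.zero_right)
  qed
  show "enn2real (trace_norm (S - U)) \<le> enn2real (trace_norm (S - T)) + enn2real (trace_norm (T - U))"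
    if "S \<in> trace_class" "T \<in> trace_class" "U \<in> trace_class" for S T U
  proof -
    have "trace_norm (S - U) \<le> trace_norm (S - T) + trace_norm (T - U)"
      using trace_norm_triangle[OF lin lin, of S T T U] that by simp
    then have "enn2real (trace_norm (S - U)) \<le> enn2real (trace_norm (S - T) + trace_norm (T - U))"
      using fin that by (intro enn2real_mono) (auto simp: less_top)
    also have "\<dots> = enn2real (trace_norm (S - T)) + enn2real (trace_norm (T - U))"
      using fin that by (intro enn2real_plus) auto
    finally show ?thesis .
  qed
qed


section \<open>Trace distance of states of bounded energy\<close>

lemma sum_tail_le:
  fixes p :: "nat \<Rightarrow> real"
  assumes "\<And>n. 0 \<le> p n" "\<And>N. (\<Sum>n<N. real n * p n) \<le> E" "0 < N"
  shows "(\<Sum>n\<in>{N..<M}. p n) \<le> E / real N"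
proof -
  have "real N * (\<Sum>n\<in>{N..<M}. p n) \<le> (\<Sum>n\<in>{N..<M}. real n * p n)"
    unfolding sum_distrib_left by (intro sum_mono mult_right_mono) (use assms(1) in auto)
  also have "\<dots> \<le> (\<Sum>n<M. real n * p n)"
    by (intro sum_mono2) (use assms(1) in auto)
  also have "\<dots> \<le> E" by (rule assms(2))
  finally show ?thesis using assms(3) by (simp add: field_simps)
qed

text \<open>The first \<open>N\<close> diagonal entries of a contraction times \<open>\<rho> - \<sigma>\<close> are controlled by the operator
  norm, the others by the energy.\<close>

lemma trace_norm_diff_le:
  assumes \<rho>: "positive_op \<rho>" "(\<Sum>n. ennreal (population \<rho> n)) \<le> 1"
      "\<And>N. (\<Sum>n<N. real n * population \<rho> n) \<le> E"
    and \<sigma>: "positive_op \<sigma>" "(\<Sum>n. ennreal (population \<sigma> n)) \<le> 1"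
      "\<And>N. (\<Sum>n<N. real n * population \<sigma> n) \<le> E"
    and N: "0 < N"
  shows "trace_norm (\<rho> - \<sigma>) \<le> ennreal (real N * norm (\<rho> - \<sigma>) + 2 * sqrt (E / real N))"
proof (rule trace_norm_le)
  show "complex_linear_op (\<rho> - \<sigma>)" by (intro complex_linear_op_diff positive_op_linear \<rho> \<sigma>)
  fix W M assume W: "complex_linear_op W" "\<And>u. norm (W u) \<le> norm u"
  let ?f = "\<lambda>n. Re (cinner (W (fock n)) ((\<rho> - \<sigma>) (fock n)))"
  \<comment> \<open>Cauchy-Schwarz gives the root of the total weight, at most 1, times the root of
    the weight from \<open>N\<close> on. The contraction \<open>W\<close> costs nothing.\<close>
  have tail: "(\<Sum>n\<in>{N..<M}. cmod (cinner (W (fock n)) (\<tau> (fock n)))) \<le> sqrt (E / real N)"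
    if \<tau>: "positive_op \<tau>" "(\<Sum>n. ennreal (population \<tau> n)) \<le> 1"
      "\<And>N. (\<Sum>n<N. real n * population \<tau> n) \<le> E" for \<tau>
  proof -
    have "(\<Sum>n\<in>{N..<M}. cmod (cinner (W (fock n)) (\<tau> (fock n)))) \<le>
        sqrt 1 * sqrt (\<Sum>n\<in>{N..<M}. population \<tau> n)"
      by (rule sum_cinner_positive_le[OF \<tau>(1) _ _ W]) (use \<tau>(2) in auto)
    also have "\<dots> \<le> sqrt (E / real N)"
      using sum_tail_le[OF Re_cinner_positive[OF \<tau>(1)] \<tau>(3) N] by simp
    finally show ?thesis .
  qed
  have "(\<Sum>n<M. ?f n) \<le> (\<Sum>n<M. \<bar>?f n\<bar>)" by (intro sum_mono) simp
  also have "\<dots> \<le> (\<Sum>n\<in>{..<N} \<union> {N..<M}. \<bar>?f n\<bar>)" by (intro sum_mono2) auto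
  also have "\<dots> = (\<Sum>n<N. \<bar>?f n\<bar>) + (\<Sum>n\<in>{N..<M}. \<bar>?f n\<bar>)" by (intro sum.union_disjoint) auto
  also have "(\<Sum>n<N. \<bar>?f n\<bar>) \<le> (\<Sum>n<N. norm (\<rho> - \<sigma>))"
  proof (intro sum_mono)
    fix n
    have "\<bar>?f n\<bar> \<le> cmod (cinner (W (fock n)) ((\<rho> - \<sigma>) (fock n)))" by (rule abs_Re_le_cmod)
    also have "\<dots> \<le> norm (W (fock n)) * norm ((\<rho> - \<sigma>) (fock n))" by (rule cmod_cinner_le)
    also have "\<dots> \<le> 1 * norm (\<rho> - \<sigma>)"
      using W(2)[of "fock n"] norm_blinfun[of "\<rho> - \<sigma>" "fock n"] by (intro mult_mono) auto
    finally show "\<bar>?f n\<bar> \<le> norm (\<rho> - \<sigma>)" by simp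
  qed
  also have "(\<Sum>n\<in>{N..<M}. \<bar>?f n\<bar>) \<le>
      (\<Sum>n\<in>{N..<M}. cmod (cinner (W (fock n)) (\<rho> (fock n))) + cmod (cinner (W (fock n)) (\<sigma> (fock n))))"
  proof (intro sum_mono)
    fix n
    have "\<bar>?f n\<bar> \<le> cmod (cinner (W (fock n)) ((\<rho> - \<sigma>) (fock n)))" by (rule abs_Re_le_cmod)
    also have "\<dots> \<le> cmod (cinner (W (fock n)) (\<rho> (fock n))) + cmod (cinner (W (fock n)) (\<sigma> (fock n)))"
      by (simp add: blinfun.diff_left cinner.diff_right norm_triangle_ineq4)
    finally show "\<bar>?f n\<bar> \<le> cmod (cinner (W (fock n)) (\<rho> (fock n))) + cmod (cinner (W (fock n)) (\<sigma> (fock n)))" .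
  qed
  also have "\<dots> \<le> sqrt (E / real N) + sqrt (E / real N)"
    unfolding sum.distrib by (intro add_mono tail \<rho> \<sigma>)
  finally show "(\<Sum>n<M. ?f n) \<le> real N * norm (\<rho> - \<sigma>) + 2 * sqrt (E / real N)" by simp
qed

section \<open>Closedness of bounded stellar rank\<close>

lemma zorder_entire_pos:
  assumes hol: "f holomorphic_on UNIV" and "f b \<noteq> 0" "f z = 0"
  shows "0 < zorder f z"
proof -
  obtain s where s: "0 < s" "\<And>w. w \<in> ball z s - {z} \<Longrightarrow> f w \<noteq> 0"
    using isolated_zeros[OF hol open_UNIV connected_UNIV UNIV_I \<open>f z = 0\<close> UNIV_I \<open>f b \<noteq> 0\<close>] by metis
  have "eventually (\<lambda>w. f w \<noteq> 0) (at z)"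
    unfolding eventually_at using s by (intro exI[of _ s]) (auto simp: dist_commute)
  then have "frequently (\<lambda>w. f w \<noteq> 0) (at z)"
    by (rule eventually_frequently[rotated]) simp
  then show ?thesis using zorder_pos_iff[OF hol open_UNIV UNIV_I] assms(3) by simp
qed

text \<open>Rouche's theorem on a slightly larger open disc, in which both functions have finitely
  many zeros. The strict inequality keeps the zeros of both off the circle; those inside have
  winding number 1 and those between the radii \<open>R\<close> and \<open>R + 1\<close> have
  winding number 0.\<close>

lemma zeros_in_circle_eq:
  assumes f: "f holomorphic_on UNIV" and g: "g holomorphic_on UNIV"
    and R: "0 < R" and less: "\<And>z. cmod z = R \<Longrightarrow> cmod (g z - f z) < cmod (f z)"
  shows "(\<Sum>p | cmod p < R \<and> g p = 0. zorder g p) = (\<Sum>p | cmod p < R \<and> f p = 0. zorder f p)"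
proof -
  let ?\<gamma> = "circlepath 0 R"
  have fin: "finite {p \<in> cball 0 (R + 1). h p = 0}"
    if h: "h holomorphic_on UNIV" and nz: "h (of_real R) \<noteq> 0" for h
  proof (cases "h constant_on UNIV")
    case True
    then have "h p \<noteq> 0" for p using nz by (auto simp: constant_on_def)
    then show ?thesis by simp
  next
    case False
    then show ?thesis
      by (intro holomorphic_compact_finite_zeros[OF h open_UNIV connected_UNIV]) auto
  qed
  have R_norm: "cmod (of_real R) = R" using R by simp
  have nzf: "f z \<noteq> 0" and nzg: "g z \<noteq> 0" if "cmod z = R" for z using less[OF that] by auto
  let ?Z = "\<lambda>h. {p \<in> ball 0 (R + 1). h p = 0}"
  have finZ: "finite (?Z f)" "finite (?Z g)"
    by (rule finite_subset[OF _ fin[OF f nzf[OF R_norm]]], force)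
      (rule finite_subset[OF _ fin[OF g nzg[OF R_norm]]], force)
  have wind: "(\<Sum>p\<in>?Z h. winding_number ?\<gamma> p * of_int (zorder h p)) =
      of_int (\<Sum>p | cmod p < R \<and> h p = 0. zorder h p)"
    if "finite (?Z h)" "\<And>z. cmod z = R \<Longrightarrow> h z \<noteq> 0" for h
  proof -
    have "(\<Sum>p\<in>?Z h. winding_number ?\<gamma> p * of_int (zorder h p)) =
        (\<Sum>p | cmod p < R \<and> h p = 0. of_int (zorder h p))"
    proof (rule sum.mono_neutral_cong_right)
      show "\<forall>p\<in>?Z h - {p. cmod p < R \<and> h p = 0}. winding_number ?\<gamma> p * of_int (zorder h p) = 0"
      proof
        fix p assume p: "p \<in> ?Z h - {p. cmod p < R \<and> h p = 0}"
        then have "R \<le> cmod p" "cmod p \<noteq> R" using that(2)[of p] by auto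
        then have "p \<notin> cball 0 R" by auto
        then have "winding_number ?\<gamma> p = 0"
          using R by (intro winding_number_zero_outside[where s = "cball 0 R"]) (auto simp: path_image_circlepath)
        then show "winding_number ?\<gamma> p * of_int (zorder h p) = 0" by simp
      qed
      show "winding_number ?\<gamma> p * of_int (zorder h p) = of_int (zorder h p)"
        if "p \<in> {p. cmod p < R \<and> h p = 0}" for p
        using that winding_number_circlepath[of p 0 R] by simp
    qed (use that in auto)
    then show ?thesis by simp
  qed
  have eq: "(\<lambda>p. f p + (g p - f p)) = g" by simp
  have "(\<Sum>p\<in>?Z (\<lambda>p. f p + (g p - f p)). winding_number ?\<gamma> p * of_int (zorder (\<lambda>p. f p + (g p - f p)) p)) =
      (\<Sum>p\<in>?Z f. winding_number ?\<gamma> p * of_int (zorder f p))"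
  proof (rule Rouche_theorem)
    show "path_image ?\<gamma> \<subseteq> ball 0 (R + 1)" using R by auto
    show "\<forall>z\<in>path_image ?\<gamma>. cmod (f z) > cmod (g z - f z)" using R less by (auto simp: path_image_circlepath)
    show "\<forall>z. z \<notin> ball 0 (R + 1) \<longrightarrow> winding_number ?\<gamma> z = 0"
      using R by (intro allI impI winding_number_zero_outside[where s = "cball 0 R"]) auto
    show "finite (?Z (\<lambda>p. f p + (g p - f p)))" using finZ(2) by simp
    show "f holomorphic_on ball 0 (R + 1)" "(\<lambda>p. g p - f p) holomorphic_on ball 0 (R + 1)"
      using f g by (auto intro!: holomorphic_on_diff intro: holomorphic_on_subset)
  qed (use finZ in auto)
  then have "complex_of_int (\<Sum>p | cmod p < R \<and> g p = 0. zorder g p) =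
      complex_of_int (\<Sum>p | cmod p < R \<and> f p = 0. zorder f p)"
    unfolding eq using wind[OF finZ(1) nzf] wind[OF finZ(2) nzg] by simp
  then show ?thesis by (simp only: of_int_eq_iff)
qed

text \<open>Hurwitz: zeros may escape to infinity in the limit but cannot appear. The estimate is
  made first for finite sets \<open>A\<close> of zeros, because finiteness of the zero set is itself
  claimed: infinitely many zeros would contain \<open>r + 1\<close> of positive order.\<close>

theorem zero_count_limit:
  fixes f :: "complex \<Rightarrow> complex" and g :: "nat \<Rightarrow> complex \<Rightarrow> complex"
  assumes f: "f holomorphic_on UNIV" and g: "\<And>k. g k holomorphic_on UNIV"
    and lim: "\<And>R. uniform_limit (cball 0 R) g f sequentially"
    and nz: "f b \<noteq> 0"
    and fin: "\<And>k. finite {z. g k z = 0}"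
    and count: "\<And>k. (\<Sum>z | g k z = 0. nat (zorder (g k) z)) \<le> r"
  shows "finite {z. f z = 0} \<and> (\<Sum>z | f z = 0. nat (zorder f z)) \<le> r"
proof -
  have pos: "0 < zorder f z" if "f z = 0" for z by (rule zorder_entire_pos[OF f nz that])
  have bound: "(\<Sum>z\<in>A. nat (zorder f z)) \<le> r" if A: "finite A" "A \<subseteq> {z. f z = 0}" for A
  proof (cases "f constant_on UNIV")
    case True
    then have "f z \<noteq> 0" for z using nz by (auto simp: constant_on_def)
    then have "A = {}" using A by auto
    then show ?thesis by simp
  next
    case False
    obtain m where m: "\<And>z. z \<in> A \<Longrightarrow> cmod z < m" "0 < m"
    proof -
      have "bounded A" using A(1) by (rule finite_imp_bounded)
      then obtain B where "0 < B" "\<forall>z\<in>A. cmod z \<le> B" by (auto simp: bounded_pos)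
      then show ?thesis by (intro that[of "B + 1"]) force+
    qed
    have finm: "finite (cmod ` {z \<in> cball 0 (m + 1). f z = 0})"
      by (intro finite_imageI holomorphic_compact_finite_zeros[OF f open_UNIV connected_UNIV _ _ False]) auto
    \<comment> \<open>A radius beyond \<open>A\<close> is needed whose circle carries no zero of
      \<open>f\<close>; only finitely many moduli have to be avoided. The minimum of |f| on that
      circle then sets the accuracy required of \<open>g k\<close>.\<close>
    have "infinite {m<..<m + 1}" by (simp add: infinite_Ioo)
    from Diff_infinite_finite[OF finm this]
    have "{m<..<m + 1} - cmod ` {z \<in> cball 0 (m + 1). f z = 0} \<noteq> {}" by (rule infinite_imp_nonempty)
    then obtain R where R: "R \<in> {m<..<m + 1} - cmod ` {z \<in> cball 0 (m + 1). f z = 0}" by blast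
    then have R0: "0 < R" "m < R" using m(2) by auto
    have nzR: "f z \<noteq> 0" if "cmod z = R" for z using R that by force
    have "continuous_on (sphere 0 R) (\<lambda>z. cmod (f z))"
      by (intro continuous_intros holomorphic_on_imp_continuous_on[OF holomorphic_on_subset[OF f]]) auto
    moreover have "sphere (0::complex) R \<noteq> {}" using R0 by auto
    ultimately obtain z0 where z0: "z0 \<in> sphere 0 R" "\<And>z. z \<in> sphere 0 R \<Longrightarrow> cmod (f z0) \<le> cmod (f z)"
      using continuous_attains_inf[OF compact_sphere, of 0 R "\<lambda>z. cmod (f z)"] by blast
    have "0 < cmod (f z0)" using z0(1) nzR by auto
    then have "\<forall>\<^sub>F k in sequentially. \<forall>z\<in>cball 0 R. dist (g k z) (f z) < cmod (f z0)"
      using lim[of R] by (auto simp: uniform_limit_iff)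
    from eventually_happens'[OF sequentially_bot this]
    obtain k where "\<forall>z\<in>cball 0 R. dist (g k z) (f z) < cmod (f z0)" ..
    then have k: "dist (g k z) (f z) < cmod (f z0)" if "cmod z \<le> R" for z
      using that by simp
    have less: "cmod (g k z - f z) < cmod (f z)" if "cmod z = R" for z
    proof -
      have "cmod (g k z - f z) < cmod (f z0)" using k[of z] that by (simp add: dist_norm)
      also have "\<dots> \<le> cmod (f z)" using z0(2)[of z] that by simp
      finally show ?thesis .
    qed
    have finR: "finite {p. cmod p < R \<and> f p = 0}"
      by (rule finite_subset[OF _ holomorphic_compact_finite_zeros[OF f open_UNIV connected_UNIV compact_cball _ False, of 0 R]]) auto
    have "int (\<Sum>z\<in>A. nat (zorder f z)) = (\<Sum>z\<in>A. zorder f z)"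
      unfolding of_nat_sum using A(2) pos by (intro sum.cong refl) (auto intro: less_imp_le)
    also have "\<dots> \<le> (\<Sum>p | cmod p < R \<and> f p = 0. zorder f p)"
      using A(2) m(1) R0 pos finR by (intro sum_mono2) (force intro: less_imp_le)+
    also have "\<dots> = (\<Sum>p | cmod p < R \<and> g k p = 0. zorder (g k) p)"
      by (rule zeros_in_circle_eq[OF f g R0(1) less, symmetric])
    also have "\<dots> \<le> (\<Sum>p | cmod p < R \<and> g k p = 0. int (nat (zorder (g k) p)))"
      by (intro sum_mono) simp
    also have "\<dots> \<le> (\<Sum>p | g k p = 0. int (nat (zorder (g k) p)))"
      by (intro sum_mono2 fin) auto
    also have "\<dots> = int (\<Sum>p | g k p = 0. nat (zorder (g k) p))" by (rule of_nat_sum[symmetric])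
    also have "\<dots> \<le> int r" using count by (simp only: of_nat_le_iff)
    finally show ?thesis by (simp only: of_nat_le_iff)
  qed
  have "finite {z. f z = 0}"
  proof (rule ccontr)
    assume "infinite {z. f z = 0}"
    then obtain A where A: "finite A" "card A = Suc r" "A \<subseteq> {z. f z = 0}"
      using infinite_arbitrarily_large by blast
    have "card A = (\<Sum>z\<in>A. 1)" by simp
    also have "\<dots> \<le> (\<Sum>z\<in>A. nat (zorder f z))"
      using A(3) pos by (intro sum_mono) (force simp: Suc_le_eq)
    also have "\<dots> \<le> r" by (rule bound[OF A(1,3)])
    finally show False using A(2) by simp
  qed
  then show ?thesis using bound by blast
qed

text \<open>The vector representing evaluation of the stellar function at \<open>\<alpha>\<close>, an unnormalised coherent
  state.\<close>

definition coherent :: "complex \<Rightarrow> l2" where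
  "coherent \<alpha> = (\<Sum>n. (cnj \<alpha> ^ n / complex_of_real (sqrt (fact n))) *\<^sub>c fock n)"

lemma coherent_coefficients: "(\<lambda>n. (cmod (cnj \<alpha> ^ n / complex_of_real (sqrt (fact n))))\<^sup>2) sums exp ((cmod \<alpha>)\<^sup>2)"
proof -
  have "(cmod (cnj \<alpha> ^ n / complex_of_real (sqrt (fact n))))\<^sup>2 = ((cmod \<alpha>)\<^sup>2) ^ n /\<^sub>R fact n" for n
  proof -
    have "(cmod (cnj \<alpha> ^ n / complex_of_real (sqrt (fact n))))\<^sup>2 = (cmod \<alpha> ^ n)\<^sup>2 / fact n"
      by (simp add: norm_divide norm_power power_divide)
    also have "(cmod \<alpha> ^ n)\<^sup>2 = ((cmod \<alpha>)\<^sup>2) ^ n"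
      by (simp add: mult.commute flip: power_mult)
    finally show ?thesis by (simp add: divide_inverse_commute)
  qed
  then show ?thesis using exp_converges[of "(cmod \<alpha>)\<^sup>2"] by (simp only:)
qed

lemma cinner_fock_coherent: "cinner (fock n) (coherent \<alpha>) = cnj \<alpha> ^ n / complex_of_real (sqrt (fact n))"
  unfolding coherent_def
  by (rule cinner_fock_suminf[OF riesz_fischer[OF sums_summable[OF coherent_coefficients]]])

lemma norm_coherent: "norm (coherent \<alpha>) = exp ((cmod \<alpha>)\<^sup>2 / 2)"
proof -
  have "(norm (coherent \<alpha>))\<^sup>2 = exp ((cmod \<alpha>)\<^sup>2)"
    using parseval[of "coherent \<alpha>"] coherent_coefficients[of \<alpha>]
    unfolding cinner_fock_coherent by (rule sums_unique2)
  also have "\<dots> = (exp ((cmod \<alpha>)\<^sup>2 / 2))\<^sup>2" by (simp flip: exp_double)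
  finally show ?thesis by (simp add: power2_eq_iff_nonneg)
qed

lemma stellar_fun_sums:
  "(\<lambda>n. cinner (fock n) \<psi> / complex_of_real (sqrt (fact n)) * \<alpha> ^ n) sums cinner (coherent \<alpha>) \<psi>"
  using parseval_cinner[of "coherent \<alpha>" \<psi>] by (simp add: cinner_fock_coherent mult.commute)

lemma stellar_fun_eq: "stellar_fun \<psi> \<alpha> = cinner (coherent \<alpha>) \<psi>"
  using sums_unique[OF stellar_fun_sums[of \<psi> \<alpha>]] by (simp add: stellar_fun_def)

lemma holomorphic_stellar_fun: "stellar_fun \<psi> holomorphic_on UNIV"
proof -
  have "stellar_fun \<psi> holomorphic_on ball 0 R" for R
    using stellar_fun_sums
    by (intro power_series_holomorphic[where a = "\<lambda>n. cinner (fock n) \<psi> / complex_of_real (sqrt (fact n))"])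
      (simp add: stellar_fun_eq)
  then have "stellar_fun \<psi> field_differentiable at z" for z
    by (rule holomorphic_on_imp_differentiable_at[of _ "ball 0 (cmod z + 1)"]) auto
  then show ?thesis by (simp add: holomorphic_on_def)
qed

text \<open>Hurwitz' theorem fails for the limit 0, which is excluded here: a vanishing stellar
  function has vanishing power series coefficients, and these are the Fock coefficients up to
  nonzero factors.\<close>

lemma stellar_fun_nonzero:
  assumes "\<psi> \<noteq> 0"
  shows "\<exists>b. stellar_fun \<psi> b \<noteq> 0"
proof (rule ccontr)
  let ?a = "\<lambda>n. cinner (fock n) \<psi> / complex_of_real (sqrt (fact n))"
  assume "\<nexists>b. stellar_fun \<psi> b \<noteq> 0"
  then have zero: "stellar_fun \<psi> b = 0" for b by auto
  \<comment> \<open>The constant coefficient is settled directly, since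
    \<open>powser_0_nonzero\<close> asks for a positive index.\<close>
  have "?a 0 = stellar_fun \<psi> 0"
    using sums_unique2[OF powser_sums_zero stellar_fun_sums[of \<psi> 0]] by (simp add: stellar_fun_eq)
  have "?a m = 0" for m
  proof (rule ccontr)
    assume m: "?a m \<noteq> 0"
    then have "0 < m" using zero \<open>?a 0 = stellar_fun \<psi> 0\<close> by (cases m) auto
    obtain s where s: "0 < s" "\<And>z. z \<in> cball 0 s - {0} \<Longrightarrow> stellar_fun \<psi> z \<noteq> 0"
    proof (rule powser_0_nonzero[of 1 0 ?a "stellar_fun \<psi>" m])
      show "(\<lambda>n. ?a n * (x - 0) ^ n) sums stellar_fun \<psi> x" for x
        using stellar_fun_sums[of \<psi> x] by (simp add: stellar_fun_eq)
    qed (use zero m \<open>0 < m\<close> in auto)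
    then have "stellar_fun \<psi> (of_real s) \<noteq> 0" by auto
    then show False using zero by simp
  qed
  then have "\<psi> = 0" by (intro fock_total) simp
  with assms show False by simp
qed

lemma pure_stellar_rank_le_iff:
  "pure_stellar_rank \<psi> \<le> enat r \<longleftrightarrow>
    finite {\<alpha>. stellar_fun \<psi> \<alpha> = 0} \<and> (\<Sum>\<alpha> | stellar_fun \<psi> \<alpha> = 0. nat (zorder (stellar_fun \<psi>) \<alpha>)) \<le> r"
  by (simp add: pure_stellar_rank_def Let_def)

definition low_rank :: "nat \<Rightarrow> l2 set" where
  "low_rank r = {\<psi>. norm \<psi> = 1 \<and> pure_stellar_rank \<psi> \<le> enat r}"

text \<open>Evaluation of the stellar function at \<alpha> is the inner product with a vector of
  norm exp(|\<alpha>|^2/2), so norm convergence of vectors implies locally uniform convergence of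
  their stellar functions. Unit norm passes to the limit and keeps it nonzero.\<close>

theorem closed_low_rank: "closed (low_rank r)"
  unfolding closed_sequential_limits
proof (intro allI impI, elim conjE)
  fix \<psi> :: "nat \<Rightarrow> l2" and \<phi>
  assume low: "\<forall>k. \<psi> k \<in> low_rank r" and lim: "\<psi> \<longlonglongrightarrow> \<phi>"
  have "(\<lambda>k. norm (\<psi> k)) \<longlonglongrightarrow> norm \<phi>" by (rule tendsto_norm[OF lim])
  moreover have "norm (\<psi> k) = 1" for k using low by (simp add: low_rank_def)
  ultimately have unit: "norm \<phi> = 1" by (simp add: LIMSEQ_const_iff)
  then have "\<phi> \<noteq> 0" by auto
  then obtain b where b: "stellar_fun \<phi> b \<noteq> 0" using stellar_fun_nonzero by blast
  have "finite {\<alpha>. stellar_fun \<phi> \<alpha> = 0} \<and> (\<Sum>\<alpha> | stellar_fun \<phi> \<alpha> = 0. nat (zorder (stellar_fun \<phi>) \<alpha>)) \<le> r"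
  proof (rule zero_count_limit[OF holomorphic_stellar_fun holomorphic_stellar_fun _ b])
    show "uniform_limit (cball 0 R) (\<lambda>k. stellar_fun (\<psi> k)) (stellar_fun \<phi>) sequentially" for R
      unfolding uniform_limit_iff
    proof (intro allI impI)
      fix e :: real assume e: "0 < e"
      have "(\<lambda>k. exp (R\<^sup>2 / 2) * norm (\<psi> k - \<phi>)) \<longlonglongrightarrow> exp (R\<^sup>2 / 2) * norm (\<phi> - \<phi>)"
        by (intro tendsto_intros lim)
      then have "\<forall>\<^sub>F k in sequentially. exp (R\<^sup>2 / 2) * norm (\<psi> k - \<phi>) < e"
        using e by (intro order_tendstoD(2)) auto
      then show "\<forall>\<^sub>F k in sequentially. \<forall>\<alpha>\<in>cball 0 R. dist (stellar_fun (\<psi> k) \<alpha>) (stellar_fun \<phi> \<alpha>) < e"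
      proof eventually_elim
        case (elim k)
        show ?case
        proof
          fix \<alpha> :: complex assume "\<alpha> \<in> cball 0 R"
          then have R: "cmod \<alpha> \<le> R" by simp
          have "dist (stellar_fun (\<psi> k) \<alpha>) (stellar_fun \<phi> \<alpha>) = cmod (cinner (coherent \<alpha>) (\<psi> k - \<phi>))"
            by (simp add: dist_norm stellar_fun_eq cinner.diff_right)
          also have "\<dots> \<le> exp ((cmod \<alpha>)\<^sup>2 / 2) * norm (\<psi> k - \<phi>)"
            using cmod_cinner_le[of "coherent \<alpha>" "\<psi> k - \<phi>"] by (simp add: norm_coherent)
          also have "\<dots> \<le> exp (R\<^sup>2 / 2) * norm (\<psi> k - \<phi>)"
            using R by (intro mult_right_mono) (auto intro: power_mono)
          also note elim
          finally show "dist (stellar_fun (\<psi> k) \<alpha>) (stellar_fun \<phi> \<alpha>) < e" .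
        qed
      qed
    qed
  qed (use low in \<open>auto simp: low_rank_def pure_stellar_rank_le_iff\<close>)
  with unit show "\<phi> \<in> low_rank r" by (simp add: low_rank_def pure_stellar_rank_le_iff)
qed

section \<open>Coding vectors by real numbers\<close>

text \<open>Digits 0 and 1 in base 3 code a Cantor set: unlike in base 2, sequences that differ
  early have codes that are far apart, so nearby codes share their first digits.\<close>

definition ternary :: "(nat \<Rightarrow> bool) \<Rightarrow> real" where
  "ternary b = (\<Sum>j. of_bool (b j) * (1/3) ^ j)"

lemma summable_ternary:
  assumes "\<And>j. \<bar>d j\<bar> \<le> (1 :: real)"
  shows "summable (\<lambda>j. d j * (1/3) ^ j)"
proof (rule summable_comparison_test'[where N = 0])
  show "summable (\<lambda>j. (1/3 :: real) ^ j)" by (rule summable_geometric) simp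
  show "norm (d j * (1/3) ^ j) \<le> (1/3) ^ j" for j
    using assms[of j] by (simp add: abs_mult power_abs mult_left_le_one_le)
qed

lemma abs_suminf_ternary_le:
  assumes "\<And>j. \<bar>d j\<bar> \<le> (1 :: real)"
  shows "\<bar>\<Sum>j. d j * (1/3) ^ j\<bar> \<le> 3 / 2"
proof -
  have g: "summable (\<lambda>j. (1/3 :: real) ^ j)" by (rule summable_geometric) simp
  have "norm (\<Sum>j. d j * (1/3) ^ j) \<le> (\<Sum>j. (1/3) ^ j)"
    by (rule norm_suminf_le[OF _ g])
      (use assms in \<open>simp add: abs_mult power_abs mult_left_le_one_le\<close>)
  also have "(\<Sum>j. (1/3 :: real) ^ j) = 3 / 2" by (subst suminf_geometric) auto
  finally show ?thesis by simp
qed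

lemma ternary_range: "0 \<le> ternary b" "ternary b \<le> 3 / 2"
proof -
  show "0 \<le> ternary b"
    unfolding ternary_def by (intro suminf_nonneg summable_ternary) auto
  show "ternary b \<le> 3 / 2"
    using abs_suminf_ternary_le[of "\<lambda>j. of_bool (b j)"] by (simp add: ternary_def)
qed

text \<open>The first difference, at \<open>i\<close>, contributes (1/3)^i, and everything after it
  at most (1/3)^(i+1) * 3/2, which is half of that.\<close>

lemma ternary_separates:
  assumes "\<exists>i\<le>j. b i \<noteq> b' i"
  shows "(1/3) ^ j / 2 \<le> \<bar>ternary b - ternary b'\<bar>"
proof -
  define i where "i = (LEAST i. b i \<noteq> b' i)"
  obtain i0 where i0: "i0 \<le> j" "b i0 \<noteq> b' i0" using assms by blast
  have i: "b i \<noteq> b' i" "i \<le> j"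
    using LeastI[of "\<lambda>i. b i \<noteq> b' i", OF i0(2)] Least_le[of "\<lambda>i. b i \<noteq> b' i", OF i0(2)] i0(1)
    unfolding i_def by (blast, linarith)
  have below: "b k = b' k" if "k < i" for k
    using not_less_Least[of k "\<lambda>i. b i \<noteq> b' i"] that by (auto simp: i_def)
  define d where "d k = (of_bool (b k) - of_bool (b' k) :: real)" for k
  have d: "\<bar>d k\<bar> \<le> 1" for k by (simp add: d_def)
  have sm: "summable (\<lambda>k. d k * (1/3) ^ k)" by (rule summable_ternary[OF d])
  have "ternary b - ternary b' = (\<Sum>k. d k * (1/3) ^ k)"
    unfolding ternary_def
    by (subst suminf_diff) (auto intro!: summable_ternary simp: d_def left_diff_distrib)
  also have "\<dots> = (\<Sum>k. d (k + Suc i) * (1/3) ^ (k + Suc i)) + (\<Sum>k<Suc i. d k * (1/3) ^ k)"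
    by (rule suminf_split_initial_segment[OF sm])
  also have "(\<Sum>k<Suc i. d k * (1/3) ^ k) = d i * (1/3) ^ i"
    using below by (simp add: d_def)
  also have "(\<Sum>k. d (k + Suc i) * (1/3) ^ (k + Suc i)) = (1/3) ^ Suc i * (\<Sum>k. d (k + Suc i) * (1/3) ^ k)"
    by (subst suminf_mult[OF summable_ternary, symmetric])
      (auto simp: d power_add mult_ac)
  finally have eq: "ternary b - ternary b' =
      (1/3) ^ Suc i * (\<Sum>k. d (k + Suc i) * (1/3) ^ k) + d i * (1/3) ^ i" .
  have "\<bar>(1/3) ^ Suc i * (\<Sum>k. d (k + Suc i) * (1/3) ^ k)\<bar> \<le> (1/3) ^ Suc i * (3 / 2)"
    unfolding abs_mult using abs_suminf_ternary_le[of "\<lambda>k. d (k + Suc i)"] d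
    by (intro mult_mono) auto
  moreover have "\<bar>d i * (1/3) ^ i\<bar> = (1/3) ^ i"
    using i(1) by (cases "b i"; cases "b' i") (auto simp: d_def abs_mult power_abs)
  moreover have "(1/3 :: real) ^ Suc i * (3 / 2) = (1/3) ^ i / 2" by simp
  ultimately have "(1/3) ^ i / 2 \<le> \<bar>ternary b - ternary b'\<bar>"
    unfolding eq by linarith
  moreover have "(1/3 :: real) ^ j \<le> (1/3) ^ i" using i(2) by (intro power_decreasing) auto
  ultimately show ?thesis by linarith
qed

text \<open>The factor 3 separates different integers: \<open>ternary\<close> stays in [0, 3/2], so
  a change of \<open>N\<close> moves the code by at least 3/2.\<close>

definition code :: "nat \<Rightarrow> (nat \<Rightarrow> bool) \<Rightarrow> real" where
  "code N b = 3 * real N + ternary b"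

lemma code_close:
  assumes "\<bar>code N b - code N' b'\<bar> < (1/3) ^ j / 2"
  shows "N = N' \<and> (\<forall>i\<le>j. b i = b' i)"
proof -
  have "(1/3 :: real) ^ j \<le> 1" by (rule power_le_one) auto
  then have lt: "\<bar>code N b - code N' b'\<bar> < 1 / 2" using assms by simp
  have "N = N'"
  proof (rule ccontr)
    assume "N \<noteq> N'"
    then have "1 \<le> \<bar>real N - real N'\<bar>" by linarith
    then show False
      using lt ternary_range[of b] ternary_range[of b'] unfolding code_def by linarith
  qed
  then have "\<not> (\<exists>i\<le>j. b i \<noteq> b' i)"
    using assms ternary_separates[of j b b'] by (auto simp: code_def)
  with \<open>N = N'\<close> show ?thesis by auto
qed

lemma code_range: "real N \<le> code N b" "0 \<le> code N b" "code N b \<le> 3 * real N + 3 / 2"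
  using ternary_range[of b] by (auto simp: code_def)

section \<open>Inverting a coding map\<close>

lemma interleave_tendsto:
  assumes "f \<longlonglongrightarrow> l" "g \<longlonglongrightarrow> l"
  shows "(\<lambda>n. if even n then f (n div 2) else g (n div 2)) \<longlonglongrightarrow> l"
proof (rule topological_tendstoI)
  fix S assume "open S" "l \<in> S"
  then have "eventually (\<lambda>n. f n \<in> S \<and> g n \<in> S) sequentially"
    using assms by (auto simp: tendsto_def eventually_conj_iff)
  then obtain N where N: "\<And>n. N \<le> n \<Longrightarrow> f n \<in> S \<and> g n \<in> S" by (auto simp: eventually_sequentially)
  show "\<forall>\<^sub>F n in sequentially. (if even n then f (n div 2) else g (n div 2)) \<in> S"
    unfolding eventually_sequentially
  proof (intro exI allI impI)
    fix n assume "2 * N \<le> n"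
    then have "N \<le> n div 2" by simp
    from N[OF this] show "(if even n then f (n div 2) else g (n div 2)) \<in> S" by simp
  qed
qed

lemma tendsto_of_dist_tendsto:
  fixes f g :: "'b \<Rightarrow> 'a::metric_space"
  assumes "(f \<longlongrightarrow> l) F" "((\<lambda>x. dist (f x) (g x)) \<longlongrightarrow> 0) F"
  shows "(g \<longlongrightarrow> l) F"
proof (rule tendsto_dist_iff[THEN iffD2], rule Lim_null_comparison)
  show "\<forall>\<^sub>F x in F. norm (dist (g x) l) \<le> dist (f x) (g x) + dist (f x) l"
  proof (intro always_eventually allI)
    fix x
    show "norm (dist (g x) l) \<le> dist (f x) (g x) + dist (f x) l"
      using dist_triangle[of "g x" l "f x"]
      by (simp only: dist_commute[of "f x" "g x"] real_norm_def abs_of_nonneg zero_le_dist)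
  qed
  show "((\<lambda>x. dist (f x) (g x) + dist (f x) l) \<longlongrightarrow> 0) F"
    using tendsto_add[OF assms(2) tendsto_dist_iff[THEN iffD1, OF assms(1)]] by simp
qed

lemma decoding_exists:
  fixes s :: "'a::complete_space \<Rightarrow> 'b::metric_space"
  assumes cauchy: "\<And>\<psi>. range \<psi> \<subseteq> G \<Longrightarrow> Cauchy (s \<circ> \<psi>) \<Longrightarrow> Cauchy \<psi>"
  shows "\<exists>c. continuous_on (closure (s ` G)) c \<and> (\<forall>\<psi>\<in>G. c (s \<psi>) = \<psi>) \<and> c ` closure (s ` G) \<subseteq> closure G"
proof -
  have "\<exists>\<psi>. (\<forall>n. \<psi> n \<in> G) \<and> (s \<circ> \<psi>) \<longlonglongrightarrow> t" if "t \<in> closure (s ` G)" for t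
  proof -
    obtain x where x: "\<And>n. x n \<in> s ` G" "x \<longlonglongrightarrow> t"
      using \<open>t \<in> closure (s ` G)\<close> unfolding closure_sequential by blast
    then have "\<forall>n. \<exists>p. p \<in> G \<and> x n = s p" by blast
    then obtain \<psi> where \<psi>: "\<And>n. \<psi> n \<in> G" "\<And>n. x n = s (\<psi> n)" by metis
    then have "x = s \<circ> \<psi>" by auto
    with \<psi> x show ?thesis by blast
  qed
  then obtain \<Psi> where \<Psi>: "\<And>t n. t \<in> closure (s ` G) \<Longrightarrow> \<Psi> t n \<in> G"
    "\<And>t. t \<in> closure (s ` G) \<Longrightarrow> (s \<circ> \<Psi> t) \<longlonglongrightarrow> t" by metis
  define c where "c t = lim (\<Psi> t)" for t
  have c: "\<psi> \<longlonglongrightarrow> c t" if t: "t \<in> closure (s ` G)" and \<psi>: "\<And>n. \<psi> n \<in> G" "(s \<circ> \<psi>) \<longlonglongrightarrow> t" for \<psi> t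
  proof -
    \<comment> \<open>Interleaving two sequences whose codes have the same limit gives again a
      Cauchy sequence, so the decoded value does not depend on the choice of
      \<open>\<Psi> t\<close>. Constant sequences then give
      \<open>c (s \<psi>) = \<psi>\<close>.\<close>
    define \<sigma> where "\<sigma> n = (if even n then \<Psi> t (n div 2) else \<psi> (n div 2))" for n
    have "range \<sigma> \<subseteq> G" using \<Psi>(1)[OF t] \<psi>(1) by (auto simp: \<sigma>_def)
    moreover have "(s \<circ> \<sigma>) = (\<lambda>n. if even n then (s \<circ> \<Psi> t) (n div 2) else (s \<circ> \<psi>) (n div 2))"
      by (auto simp: \<sigma>_def)
    then have "(s \<circ> \<sigma>) \<longlonglongrightarrow> t" using interleave_tendsto[OF \<Psi>(2)[OF t] \<psi>(2)] by simp
    then have "Cauchy (s \<circ> \<sigma>)" by (rule LIMSEQ_imp_Cauchy)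
    ultimately have "Cauchy \<sigma>" by (rule cauchy)
    then obtain l where l: "\<sigma> \<longlonglongrightarrow> l" by (auto simp: Cauchy_convergent_iff convergent_def)
    have "(\<sigma> \<circ> (\<lambda>n. 2 * n)) \<longlonglongrightarrow> l" "(\<sigma> \<circ> (\<lambda>n. 2 * n + 1)) \<longlonglongrightarrow> l"
      by (rule LIMSEQ_subseq_LIMSEQ[OF l], simp add: strict_mono_def)+
    moreover have "\<sigma> \<circ> (\<lambda>n. 2 * n) = \<Psi> t" "\<sigma> \<circ> (\<lambda>n. 2 * n + 1) = \<psi>"
      by (auto simp: \<sigma>_def)
    ultimately show ?thesis by (simp add: c_def limI)
  qed
  have inG: "s \<psi> \<in> closure (s ` G)" if "\<psi> \<in> G" for \<psi>
    using closure_subset[of "s ` G"] that by blast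
  have "c (s \<psi>) = \<psi>" if "\<psi> \<in> G" for \<psi>
  proof -
    have "(\<lambda>n. \<psi>) \<longlonglongrightarrow> c (s \<psi>)" by (rule c[OF inG[OF that]]) (use that in \<open>auto simp: o_def\<close>)
    then show ?thesis by (simp add: LIMSEQ_const_iff)
  qed
  moreover have "c t \<in> closure G" if "t \<in> closure (s ` G)" for t
    unfolding closure_sequential using c[OF that \<Psi>(1)[OF that] \<Psi>(2)[OF that]] \<Psi>(1)[OF that] by blast
  moreover have "continuous_on (closure (s ` G)) c"
    unfolding continuous_on_sequentially
  proof (intro allI ballI impI, elim conjE)
    fix x t assume t: "t \<in> closure (s ` G)" and x: "\<forall>n. x n \<in> closure (s ` G)" "x \<longlonglongrightarrow> t"
    \<comment> \<open>Each \<open>x n\<close> is replaced by the code of a point of \<open>G\<close>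
      such that both the code and its decoded value are within 1/(n+1); this reduces continuity on
      the closure to the property of \<open>c\<close> for sequences from \<open>G\<close>.\<close>
    have "\<exists>\<psi>\<in>G. dist (s \<psi>) (x n) < 1 / Suc n \<and> dist \<psi> (c (x n)) < 1 / Suc n" for n
    proof -
      have xn: "x n \<in> closure (s ` G)" using x by simp
      have "\<forall>\<^sub>F j in sequentially. dist ((s \<circ> \<Psi> (x n)) j) (x n) < 1 / Suc n \<and> dist (\<Psi> (x n) j) (c (x n)) < 1 / Suc n"
        by (intro eventually_conj tendstoD \<Psi>(2) c xn \<Psi>(1)) auto
      from eventually_happens'[OF sequentially_bot this] show ?thesis using \<Psi>(1)[OF xn] by auto
    qed
    then obtain \<psi> where \<psi>: "\<And>n. \<psi> n \<in> G" "\<And>n. dist (s (\<psi> n)) (x n) < 1 / Suc n"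
      "\<And>n. dist (\<psi> n) (c (x n)) < 1 / Suc n" by metis
    have z: "(\<lambda>n. 1 / real (Suc n)) \<longlonglongrightarrow> 0" by (rule LIMSEQ_Suc) (rule lim_1_over_n)
    have "(\<lambda>n. dist (s (\<psi> n)) (x n)) \<longlonglongrightarrow> 0"
      by (rule real_tendsto_sandwich[OF _ _ tendsto_const z]) (use \<psi>(2) in \<open>auto intro!: always_eventually less_imp_le\<close>)
    then have "(\<lambda>n. dist (x n) (s (\<psi> n))) \<longlonglongrightarrow> 0" by (simp only: dist_commute)
    from tendsto_of_dist_tendsto[OF x(2) this] have "(s \<circ> \<psi>) \<longlonglongrightarrow> t" by (simp add: o_def)
    then have "\<psi> \<longlonglongrightarrow> c t" by (intro c t \<psi>(1))
    moreover have "(\<lambda>n. dist (\<psi> n) (c (x n))) \<longlonglongrightarrow> 0"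
      by (rule real_tendsto_sandwich[OF _ _ tendsto_const z]) (use \<psi>(3) in \<open>auto intro!: always_eventually less_imp_le\<close>)
    ultimately show "(c \<circ> x) \<longlonglongrightarrow> c t" by (auto simp: o_def intro: tendsto_of_dist_tendsto)
  qed
  ultimately show ?thesis by blast
qed

text \<open>A substitute for the theorems of Prokhorov and Skorokhod: through the coding map \<open>s\<close> the measures
  become real distributions, where Helly's selection theorem and Skorokhod's theorem are available.\<close>

theorem coded_skorohod:
  fixes R G :: "'a::complete_space set" and s :: "'a \<Rightarrow> real" and M :: "nat \<Rightarrow> 'a measure"
  assumes R: "closed R" "bounded R" and GR: "G \<subseteq> R"
    and s: "s \<in> borel_measurable borel"
    and cauchy: "\<And>\<psi>. range \<psi> \<subseteq> G \<Longrightarrow> Cauchy (s \<circ> \<psi>) \<Longrightarrow> Cauchy \<psi>"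
    and M: "\<And>k. prob_space (M k)" "\<And>k. sets (M k) = sets (restrict_space borel (space (M k)))"
    and AE_G: "\<And>k. AE \<psi> in M k. \<psi> \<in> G"
    and tight: "\<And>e. 0 < e \<Longrightarrow> \<exists>a. \<forall>k. measure (M k) {\<psi> \<in> space (M k). a < \<bar>s \<psi>\<bar>} < e"
  obtains r :: "nat \<Rightarrow> nat" and \<Omega> :: "real measure" and \<phi> :: "nat \<Rightarrow> real \<Rightarrow> 'a" and \<phi>' :: "real \<Rightarrow> 'a"
    and h :: "nat \<Rightarrow> real \<Rightarrow> real"
  where "strict_mono r" "prob_space \<Omega>"
    "\<And>k. \<phi> k \<in> measurable \<Omega> (restrict_space borel R)" "\<phi>' \<in> measurable \<Omega> (restrict_space borel R)"
    "\<And>k f. f \<in> borel_measurable borel \<Longrightarrow> (\<integral>\<psi>. f \<psi> \<partial>M (r k)) = (\<integral>x. (f (\<phi> k x) :: complex) \<partial>\<Omega>)"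
    "\<And>k. integrable \<Omega> (h k)" "\<And>k. AE x in \<Omega>. dist (\<phi> k x) (\<phi>' x) \<le> h k x"
    "(\<lambda>k. \<integral>x. h k x \<partial>\<Omega>) \<longlonglongrightarrow> 0"
proof -
  define D where "D = closure (s ` G)"
  have D: "D \<in> sets borel" "closed D" by (simp_all add: D_def)
  have "\<exists>c. continuous_on (closure (s ` G)) c \<and> (\<forall>\<psi>\<in>G. c (s \<psi>) = \<psi>) \<and> c ` closure (s ` G) \<subseteq> closure G"
    by (rule decoding_exists) (rule cauchy)
  then obtain c where c0: "continuous_on (closure (s ` G)) c" "\<forall>\<psi>\<in>G. c (s \<psi>) = \<psi>"
    "c ` closure (s ` G) \<subseteq> closure G"
    by (elim exE conjE) (rule that)
  have c: "continuous_on D c" "\<And>\<psi>. \<psi> \<in> G \<Longrightarrow> c (s \<psi>) = \<psi>" "\<And>t. t \<in> D \<Longrightarrow> c t \<in> closure G"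
    using c0 unfolding D_def by auto
  have cR: "c t \<in> R" if "t \<in> D" for t
    using c(3)[OF that] closure_minimal[OF GR R(1)] by blast
  \<comment> \<open>\<open>G\<close> is nonempty because it has full measure; \<open>g0\<close> is
    the default value of the decoding outside \<open>D\<close>.\<close>
  obtain g0 where g0: "g0 \<in> G"
  proof -
    interpret prob_space "M 0" by (rule M)
    have "\<exists>\<psi>. \<psi> \<in> G" using AE_G[of 0] AE_const[of False] by (metis (mono_tags, lifting) eventually_mono)
    then show ?thesis using that by blast
  qed
  have s_meas: "s \<in> borel_measurable (M k)" for k
  proof -
    have "s \<in> borel_measurable (restrict_space borel (space (M k)))"
      by (rule measurable_restrict_space1[OF s])
    then show ?thesis by (simp add: measurable_cong_sets[OF M(2) refl])
  qed
  define \<mu> where "\<mu> k = distr (M k) borel s" for k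
  have \<mu>: "real_distribution (\<mu> k)" for k
    unfolding \<mu>_def by (intro prob_space.real_distribution_distr M s_meas)
  have "Helly_Selection.tight \<mu>"
    unfolding Helly_Selection.tight_def
  proof (intro conjI allI impI \<mu>)
    fix e :: real assume "0 < e"
    then obtain a where a: "\<And>k. measure (M k) {\<psi> \<in> space (M k). a < \<bar>s \<psi>\<bar>} < e" using tight by blast
    \<comment> \<open>Large enough that \<open>\<bar>s \<psi>\<bar> \<le> a\<close> puts
      \<open>s \<psi>\<close> strictly inside the half-open interval, and positive so that the
      interval is proper.\<close>
    define b where "b = max a 0 + 1"
    show "\<exists>a b. a < b \<and> (\<forall>n. 1 - e < measure (\<mu> n) {a<..b})"
    proof (intro exI conjI allI)
      show "- b < b" by (simp add: b_def)
      fix n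
      interpret prob_space "M n" by (rule M)
      have [measurable]: "s \<in> borel_measurable (M n)" by (rule s_meas)
      let ?A = "{\<psi> \<in> space (M n). a < \<bar>s \<psi>\<bar>}"
      have "1 - e < 1 - prob ?A" using a[of n] by simp
      also have "\<dots> = prob (space (M n) - ?A)" by (subst prob_compl) auto
      also have "\<dots> \<le> prob (s -` {- b<..b} \<inter> space (M n))"
        by (intro finite_measure_mono) (auto simp: b_def)
      also have "\<dots> = measure (\<mu> n) {- b<..b}"
        by (simp add: \<mu>_def measure_distr)
      finally show "1 - e < measure (\<mu> n) {- b<..b}" .
    qed
  qed
  from tight_imp_convergent_subsubsequence[OF this strict_mono_id]
  obtain r N where r: "strict_mono r" and N: "real_distribution N" "weak_conv_m (\<mu> \<circ> r) N"
    by auto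
  have "real_distribution ((\<mu> \<circ> r) n)" for n by (simp add: \<mu>)
  from Skorohod[OF this N]
  obtain \<Omega> :: "real measure" and Y Y' where skorohod: "prob_space \<Omega> \<and> (\<forall>n. Y n \<in> measurable \<Omega> borel) \<and>
      (\<forall>n. distr \<Omega> borel (Y n) = (\<mu> \<circ> r) n) \<and> Y' \<in> measurable \<Omega> lborel \<and>
      distr \<Omega> borel Y' = N \<and> (\<forall>x\<in>space \<Omega>. (\<lambda>n. Y n x) \<longlonglongrightarrow> Y' x)"
    by (elim exE) (rule that)
  then have \<Omega>: "prob_space \<Omega>"
    and Y_meas: "\<And>n. Y n \<in> measurable \<Omega> borel" and Y_distr: "\<And>n. distr \<Omega> borel (Y n) = (\<mu> \<circ> r) n"
    and Y'_meas: "Y' \<in> measurable \<Omega> lborel"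
    and lim: "\<And>x. x \<in> space \<Omega> \<Longrightarrow> (\<lambda>n. Y n x) \<longlonglongrightarrow> Y' x"
    by simp_all
  have [measurable]: "Y n \<in> borel_measurable \<Omega>" for n by (rule Y_meas)
  have [measurable]: "Y' \<in> borel_measurable \<Omega>" using Y'_meas by simp
  interpret \<Omega>: prob_space \<Omega> by (rule \<Omega>)
  \<comment> \<open>A total Borel function with all values in \<open>R\<close>, so that the random
    vectors lie in \<open>R\<close> everywhere and not just almost surely.\<close>
  define c' where "c' t = (if t \<in> D then c t else g0)" for t
  have c'_meas: "c' \<in> borel_measurable borel"
    unfolding c'_def by (rule borel_measurable_continuous_on_if[OF D(1) c(1)]) simp
  have c'R: "c' t \<in> R" for t using cR g0 GR by (auto simp: c'_def)
  have c'_dec: "c' (s \<psi>) = \<psi>" if "\<psi> \<in> G" for \<psi>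
  proof -
    have "s \<psi> \<in> D" unfolding D_def using closure_subset[of "s ` G"] that by blast
    then show ?thesis using c(2)[OF that] by (simp add: c'_def)
  qed
  have Y_D: "AE x in \<Omega>. Y n x \<in> D" for n
  proof -
    have "AE t in \<mu> (r n). t \<in> D"
      unfolding \<mu>_def
    proof (subst AE_distr_iff[OF s_meas])
      show "{t \<in> space borel. t \<in> D} \<in> sets borel" using D by simp
      show "AE \<psi> in M (r n). s \<psi> \<in> D"
        using AE_G[of "r n"] by eventually_elim (use closure_subset[of "s ` G"] in \<open>auto simp: D_def\<close>)
    qed
    then have "AE t in distr \<Omega> borel (Y n). t \<in> D" by (simp only: Y_distr o_apply)
    then show ?thesis by (subst (asm) AE_distr_iff[OF Y_meas]) (use D in auto)
  qed
  then have Y_all_D: "AE x in \<Omega>. \<forall>n. Y n x \<in> D" by (simp add: AE_all_countable)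
  have Y'_D: "AE x in \<Omega>. Y' x \<in> D"
    using Y_all_D AE_space
  proof eventually_elim
    case (elim x)
    then show ?case using closed_sequentially[OF D(2) _ lim[of x]] by auto
  qed
  obtain B where B: "\<And>x y. x \<in> R \<Longrightarrow> y \<in> R \<Longrightarrow> dist x y \<le> B"
    using R(2) by (auto simp: bounded_two_points)
  \<comment> \<open>In a metric space that may be nonseparable the distance of two Borel maps may
    fail to be Borel. As a function of the pair of codes it is continuous on
    \<open>D \<times> D\<close>. This is why the theorem provides an integrable majorant
    \<open>h\<close> of the distance and not the distance itself.\<close>
  define w where "w p = (if p \<in> D \<times> D then dist (c (fst p)) (c (snd p)) else 0)" for p :: "real \<times> real"
  have w_meas: "w \<in> borel_measurable borel"
    unfolding w_def
  proof (rule borel_measurable_continuous_on_if)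
    show "D \<times> D \<in> sets borel" using closed_Times[OF D(2) D(2)] by simp
    show "continuous_on (D \<times> D) (\<lambda>p. dist (c (fst p)) (c (snd p)))"
      by (intro continuous_on_dist continuous_on_compose2[OF c(1)] continuous_intros) auto
  qed simp
  define h where "h n x = w (Y n x, Y' x)" for n x
  have h_meas [measurable]: "h n \<in> borel_measurable \<Omega>" for n
  proof -
    have "(\<lambda>x. (Y n x, Y' x)) \<in> measurable \<Omega> (borel \<Otimes>\<^sub>M borel)" by measurable
    then show ?thesis
      unfolding h_def by (intro measurable_compose[OF _ w_meas]) (simp add: borel_prod)
  qed
  have h_bound: "0 \<le> h n x" "h n x \<le> max B 0" for n x
    using B cR by (auto simp: h_def w_def le_max_iff_disj)
  show thesis
  proof (rule that[of r \<Omega> "\<lambda>n x. c' (Y n x)" "\<lambda>x. c' (Y' x)" h])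
    show "(\<lambda>x. c' (Y n x)) \<in> measurable \<Omega> (restrict_space borel R)" for n
      by (intro measurable_restrict_space2 measurable_compose[OF _ c'_meas]) (auto simp: c'R)
    show "(\<lambda>x. c' (Y' x)) \<in> measurable \<Omega> (restrict_space borel R)"
      by (intro measurable_restrict_space2 measurable_compose[OF _ c'_meas]) (auto simp: c'R)
    show "(\<integral>\<psi>. f \<psi> \<partial>M (r k)) = (\<integral>x. (f (c' (Y k x)) :: complex) \<partial>\<Omega>)"
      if f: "f \<in> borel_measurable borel" for k f
    proof -
      have f': "f \<in> borel_measurable (M (r k))"
        using measurable_restrict_space1[OF f, of "space (M (r k))"]
        by (simp add: measurable_cong_sets[OF M(2) refl])
      have fc: "(\<lambda>t. f (c' t)) \<in> borel_measurable borel" by (rule measurable_compose[OF c'_meas f])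
      have "(\<integral>\<psi>. f \<psi> \<partial>M (r k)) = (\<integral>\<psi>. f (c' (s \<psi>)) \<partial>M (r k))"
      proof (rule integral_cong_AE[OF f'])
        show "(\<lambda>\<psi>. f (c' (s \<psi>))) \<in> borel_measurable (M (r k))" by (rule measurable_compose[OF s_meas fc])
        show "AE \<psi> in M (r k). f \<psi> = f (c' (s \<psi>))"
          using AE_G[of "r k"] by eventually_elim (simp add: c'_dec)
      qed
      also have "\<dots> = (\<integral>t. f (c' t) \<partial>\<mu> (r k))"
        unfolding \<mu>_def by (rule integral_distr[OF s_meas fc, symmetric])
      also have "\<dots> = (\<integral>t. f (c' t) \<partial>distr \<Omega> borel (Y k))" by (simp only: Y_distr o_apply)
      also have "\<dots> = (\<integral>x. f (c' (Y k x)) \<partial>\<Omega>)" by (rule integral_distr[OF Y_meas fc])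
      finally show ?thesis .
    qed
    show int_h: "integrable \<Omega> (h n)" for n
      by (rule \<Omega>.integrable_const_bound[of _ "max B 0"]) (use h_bound in auto)
    show "AE x in \<Omega>. dist (c' (Y n x)) (c' (Y' x)) \<le> h n x" for n
      using Y_D[of n] Y'_D by eventually_elim (simp add: c'_def h_def w_def)
    have "(\<lambda>n. \<integral>x. h n x \<partial>\<Omega>) \<longlonglongrightarrow> (\<integral>x. 0 \<partial>\<Omega>)"
    proof (rule integral_dominated_convergence[where w = "\<lambda>_. max B 0"])
      show "AE x in \<Omega>. (\<lambda>n. h n x) \<longlonglongrightarrow> 0"
        using Y_all_D Y'_D AE_space
      proof eventually_elim
        case (elim x)
        have "(\<lambda>n. c (Y n x)) \<longlonglongrightarrow> c (Y' x)"
          by (rule continuous_on_tendsto_compose[OF c(1) lim]) (use elim in auto)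
        then have "(\<lambda>n. dist (c (Y n x)) (c (Y' x))) \<longlonglongrightarrow> 0" by (rule tendsto_dist_iff[THEN iffD1])
        then show ?case using elim by (simp add: h_def w_def)
      qed
    qed (use h_bound in auto)
    then show "(\<lambda>n. \<integral>x. h n x \<partial>\<Omega>) \<longlonglongrightarrow> 0" by simp
  qed (fact r \<Omega>)+
qed

section \<open>A code from the energy and the Fock coefficients\<close>

text \<open>The bits are the Dedekind cuts of the real and imaginary parts of all Fock coefficients.
  They are Borel, though not continuous, and when all of them stabilise along a bounded sequence the
  coefficients converge.\<close>

definition fock_bit :: "nat \<Rightarrow> l2 \<Rightarrow> bool" where
  "fock_bit j \<psi> \<longleftrightarrow> (case prod_decode j of (i, m) \<Rightarrow>
     of_rat (nat_to_rat_surj m) < (if even i then Re else Im) (cinner (fock (i div 2)) \<psi>))"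

text \<open>The integer part makes a Cauchy sequence of codes bounded in energy, which
  coefficientwise convergence alone would not give. Infinite energy is sent to 0 by
  \<open>enn2real\<close>; the coding is applied to sets of vectors of finite energy, where this
  value is harmless.\<close>

definition fock_code :: "l2 \<Rightarrow> real" where
  "fock_code \<psi> = code (nat \<lceil>enn2real (energy \<psi>)\<rceil>) (\<lambda>j. fock_bit j \<psi>)"

lemma measurable_cinner [measurable]: "(\<lambda>\<psi>. cinner u \<psi>) \<in> borel_measurable borel"
  by (intro borel_measurable_continuous_onI linear_continuous_on cinner.bounded_linear_right)

lemma measurable_energy [measurable]: "energy \<in> borel_measurable borel"
  unfolding energy_def[abs_def] by measurable

lemma measurable_fock_bit [measurable]: "Measurable.pred borel (fock_bit j)"
proof -
  obtain i m where "prod_decode j = (i, m)" by fastforce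
  then have "fock_bit j = (\<lambda>\<psi>. of_rat (nat_to_rat_surj m) < (if even i then Re else Im) (cinner (fock (i div 2)) \<psi>))"
    by (auto simp: fock_bit_def)
  then show ?thesis by (cases "even i") simp_all
qed

lemma measurable_fock_code: "fock_code \<in> borel_measurable borel"
  unfolding fock_code_def[abs_def] code_def ternary_def by measurable

text \<open>By boundedness a subsequence has a limit \<open>l\<close>. For a rational
  \<open>q\<close> other than \<open>l\<close> the subsequence reveals the eventual value of the cut
  at \<open>q\<close>, hence the side of \<open>q\<close> on which the whole sequence stays.\<close>

lemma convergent_of_rational_cuts:
  fixes x :: "nat \<Rightarrow> real"
  assumes bdd: "\<And>k. \<bar>x k\<bar> \<le> B"
    and cut: "\<And>q :: rat. \<exists>N. \<forall>k\<ge>N. (of_rat q < x k) = (of_rat q < x N)"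
  shows "convergent x"
proof -
  have "bounded (range x)" using bdd by (auto simp: bounded_iff)
  then obtain l f where f: "strict_mono f" "(x \<circ> f) \<longlonglongrightarrow> l"
    using bounded_imp_convergent_subsequence by blast
  have below: "\<forall>\<^sub>F k in sequentially. of_rat q < x k" if "of_rat q < l" for q :: rat
  proof -
    obtain N where N: "\<And>k. N \<le> k \<Longrightarrow> (of_rat q < x k) = (of_rat q < x N)" using cut by blast
    have "\<forall>\<^sub>F k in sequentially. of_rat q < (x \<circ> f) k" by (rule order_tendstoD(1)[OF f(2) that])
    then have "\<forall>\<^sub>F k in sequentially. of_rat q < x (f k) \<and> N \<le> k"
      using eventually_ge_at_top[of N] by eventually_elim simp
    from eventually_happens'[OF sequentially_bot this]
    obtain k where "of_rat q < x (f k)" "N \<le> k" by blast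
    then have "of_rat q < x N" using N[of "f k"] seq_suble[OF f(1), of k] by simp
    then have "of_rat q < x k" if "N \<le> k" for k using N[OF that] by simp
    then show ?thesis by (auto simp: eventually_sequentially)
  qed
  have above: "\<forall>\<^sub>F k in sequentially. x k \<le> of_rat q" if "l < of_rat q" for q :: rat
  proof -
    obtain N where N: "\<And>k. N \<le> k \<Longrightarrow> (of_rat q < x k) = (of_rat q < x N)" using cut by blast
    have "\<forall>\<^sub>F k in sequentially. (x \<circ> f) k < of_rat q" by (rule order_tendstoD(2)[OF f(2) that])
    then have "\<forall>\<^sub>F k in sequentially. x (f k) < of_rat q \<and> N \<le> k"
      using eventually_ge_at_top[of N] by eventually_elim simp
    from eventually_happens'[OF sequentially_bot this]
    obtain k where "x (f k) < of_rat q" "N \<le> k" by blast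
    then have "\<not> of_rat q < x N" using N[of "f k"] seq_suble[OF f(1), of k] by simp
    then have "x k \<le> of_rat q" if "N \<le> k" for k using N[OF that] by simp
    then show ?thesis by (auto simp: eventually_sequentially)
  qed
  have "x \<longlonglongrightarrow> l"
  proof (rule order_tendstoI)
    fix a assume "a < l"
    then obtain q where "a < of_rat q" "of_rat q < l" using of_rat_dense by blast
    from below[OF this(2)] show "\<forall>\<^sub>F k in sequentially. a < x k"
      by eventually_elim (use \<open>a < of_rat q\<close> in simp)
  next
    fix a assume "l < a"
    then obtain q where "l < of_rat q" "of_rat q < a" using of_rat_dense by blast
    from above[OF this(1)] show "\<forall>\<^sub>F k in sequentially. x k < a"
      by eventually_elim (use \<open>of_rat q < a\<close> in simp)
  qed
  then show ?thesis by (auto simp: convergent_def)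
qed

lemma energy_partial_sum_le:
  assumes "energy \<psi> \<le> ennreal C" "0 \<le> C"
  shows "(\<Sum>n<M. real n * (cmod (cinner (fock n) \<psi>))\<^sup>2) \<le> C"
proof -
  have "ennreal (\<Sum>n<M. real n * (cmod (cinner (fock n) \<psi>))\<^sup>2) =
      (\<Sum>n<M. ennreal (real n * (cmod (cinner (fock n) \<psi>))\<^sup>2))"
    by (rule sum_ennreal[symmetric]) simp
  also have "\<dots> \<le> energy \<psi>"
    unfolding energy_def by (rule sum_le_suminf[OF summableI]) auto
  also note assms(1)
  finally show ?thesis using assms(2) by (subst (asm) ennreal_le_iff) auto
qed

definition fock_truncation :: "nat \<Rightarrow> l2 \<Rightarrow> l2" where
  "fock_truncation N \<psi> = (\<Sum>n<N. cinner (fock n) \<psi> *\<^sub>c fock n)"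

lemma norm_fock_tail_le:
  assumes E: "energy \<psi> \<le> ennreal C" "0 \<le> C" and N: "0 < N"
  shows "norm (\<psi> - fock_truncation N \<psi>) \<le> sqrt (C / real N)"
proof -
  let ?u = "\<psi> - fock_truncation N \<psi>"
  have u: "cinner (fock n) ?u = (if n < N then 0 else cinner (fock n) \<psi>)" for n
    by (simp add: fock_truncation_def cinner.diff_right cinner_fock_sum)
  have "(norm ?u)\<^sup>2 \<le> C / real N"
  proof (rule LIMSEQ_le_const2)
    show "(\<lambda>M. \<Sum>n<M. (cmod (cinner (fock n) ?u))\<^sup>2) \<longlonglongrightarrow> (norm ?u)\<^sup>2"
      using parseval[of ?u] by (simp only: sums_def)
    have "(\<Sum>n<M. (cmod (cinner (fock n) ?u))\<^sup>2) \<le> C / real N" for M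
    proof -
      have "(\<Sum>n<M. (cmod (cinner (fock n) ?u))\<^sup>2) = (\<Sum>n\<in>{N..<M}. (cmod (cinner (fock n) \<psi>))\<^sup>2)"
        by (rule sum.mono_neutral_cong_right) (auto simp: u)
      also have "\<dots> \<le> C / real N"
        by (rule sum_tail_le[OF _ energy_partial_sum_le[OF E] N]) simp
      finally show ?thesis .
    qed
    then show "\<exists>M0. \<forall>M\<ge>M0. (\<Sum>n<M. (cmod (cinner (fock n) ?u))\<^sup>2) \<le> C / real N" by blast
  qed
  then show ?thesis by (rule real_le_rsqrt)
qed

text \<open>The compactness of energy bounded sets: finitely many coefficients converge, and the
  remaining ones are uniformly small in norm.\<close>

lemma Cauchy_of_energy_bounded:
  fixes \<psi> :: "nat \<Rightarrow> l2"
  assumes E: "\<And>k. K \<le> k \<Longrightarrow> energy (\<psi> k) \<le> ennreal C" "0 \<le> C"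
    and conv: "\<And>n. convergent (\<lambda>k. cinner (fock n) (\<psi> k))"
  shows "Cauchy \<psi>"
  unfolding Cauchy_def
proof (intro allI impI)
  fix e :: real assume e: "0 < e"
  \<comment> \<open>This size makes each of the two tails at most \<open>e / 4\<close> and leaves
    \<open>e / 2\<close> for the truncated vectors; the successor keeps the cutoff positive.\<close>
  obtain N :: nat where "16 * C / e\<^sup>2 < real N" using reals_Archimedean2 by blast
  moreover define N' where "N' = Suc N"
  ultimately have N': "0 < N'" "16 * C / e\<^sup>2 < real N'" by auto
  have "sqrt (C / real N') \<le> sqrt ((e / 4)\<^sup>2)"
    using N' e by (intro real_sqrt_le_mono) (simp add: field_simps power2_eq_square)
  then have tail: "norm (\<psi> k - fock_truncation N' (\<psi> k)) \<le> e / 4" if "K \<le> k" for k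
    using norm_fock_tail_le[OF E(1)[OF that] E(2) N'(1)] e by simp
  obtain a where a: "\<And>n. (\<lambda>k. cinner (fock n) (\<psi> k)) \<longlonglongrightarrow> a n"
    using conv unfolding convergent_def by metis
  have "(\<lambda>k. fock_truncation N' (\<psi> k)) \<longlonglongrightarrow> (\<Sum>n<N'. a n *\<^sub>c fock n)"
    unfolding fock_truncation_def by (intro tendsto_sum cscale.tendsto tendsto_const a)
  then have "Cauchy (\<lambda>k. fock_truncation N' (\<psi> k))" by (rule LIMSEQ_imp_Cauchy)
  then obtain K' where K': "\<And>k l. K' \<le> k \<Longrightarrow> K' \<le> l \<Longrightarrow>
      dist (fock_truncation N' (\<psi> k)) (fock_truncation N' (\<psi> l)) < e / 2"
    unfolding Cauchy_def using e by (meson half_gt_zero)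
  show "\<exists>M. \<forall>k\<ge>M. \<forall>l\<ge>M. dist (\<psi> k) (\<psi> l) < e"
  proof (intro exI allI impI)
    fix k l assume kl: "max K K' \<le> k" "max K K' \<le> l"
    have "dist (\<psi> k) (\<psi> l) \<le> dist (\<psi> k) (fock_truncation N' (\<psi> k)) +
        dist (fock_truncation N' (\<psi> k)) (fock_truncation N' (\<psi> l)) + dist (fock_truncation N' (\<psi> l)) (\<psi> l)"
      by (metis add.commute add_left_mono dist_triangle order_trans dist_triangle_le add.assoc)
    also have "\<dots> < e / 4 + e / 2 + e / 4"
      using K'[of k l] tail[of k] tail[of l] kl
      by (intro add_less_le_mono add_le_less_mono) (auto simp: dist_norm norm_minus_commute)
    finally show "dist (\<psi> k) (\<psi> l) < e" by simp
  qed
qed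

text \<open>Codes closer than half of (1/3)^j agree in the integer part and in the bits up to
  \<open>j\<close>, so along a Cauchy sequence the rounded energy and every bit are eventually
  constant.\<close>

lemma Cauchy_of_fock_code:
  fixes \<psi> :: "nat \<Rightarrow> l2"
  assumes \<psi>: "\<And>k. norm (\<psi> k) = 1" "\<And>k. energy (\<psi> k) < \<infinity>" and cauchy: "Cauchy (fock_code \<circ> \<psi>)"
  shows "Cauchy \<psi>"
proof -
  have stable: "\<exists>K. \<forall>k\<ge>K. nat \<lceil>enn2real (energy (\<psi> k))\<rceil> = nat \<lceil>enn2real (energy (\<psi> K))\<rceil> \<and>
      fock_bit j (\<psi> k) = fock_bit j (\<psi> K)" for j
  proof -
    have "0 < (1/3 :: real) ^ j / 2" by simp
    then obtain K where K: "\<And>k. K \<le> k \<Longrightarrow> dist (fock_code (\<psi> k)) (fock_code (\<psi> K)) < (1/3) ^ j / 2"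
      using cauchy unfolding Cauchy_altdef2 by (metis comp_apply)
    show ?thesis
    proof (intro exI allI impI)
      fix k assume "K \<le> k"
      from code_close[OF K[OF this, unfolded fock_code_def dist_real_def]]
      show "nat \<lceil>enn2real (energy (\<psi> k))\<rceil> = nat \<lceil>enn2real (energy (\<psi> K))\<rceil> \<and>
          fock_bit j (\<psi> k) = fock_bit j (\<psi> K)"
        by blast
    qed
  qed
  obtain K where K: "\<And>k. K \<le> k \<Longrightarrow> nat \<lceil>enn2real (energy (\<psi> k))\<rceil> = nat \<lceil>enn2real (energy (\<psi> K))\<rceil>"
    using stable[of 0] by blast
  define C where "C = real (nat \<lceil>enn2real (energy (\<psi> K))\<rceil>)"
  have bound: "energy (\<psi> k) \<le> ennreal C" if "K \<le> k" for k
  proof -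
    have "energy (\<psi> k) = ennreal (enn2real (energy (\<psi> k)))" using \<psi>(2)[of k] by (simp add: less_top)
    also have "\<dots> \<le> ennreal C"
      unfolding C_def K[OF that, symmetric] by (intro ennreal_leI) linarith
    finally show ?thesis .
  qed
  have conv: "convergent (\<lambda>k. cinner (fock n) (\<psi> k))" for n
  proof -
    have cut: "\<exists>K. \<forall>k\<ge>K. (of_rat q < (if even i then Re else Im) (cinner (fock (i div 2)) (\<psi> k))) =
        (of_rat q < (if even i then Re else Im) (cinner (fock (i div 2)) (\<psi> K)))" for q i
    proof -
      obtain m where "q = nat_to_rat_surj m" using surj_nat_to_rat_surj by (metis surjD)
      then have bit: "fock_bit (prod_encode (i, m)) \<psi> \<longleftrightarrow>
          of_rat q < (if even i then Re else Im) (cinner (fock (i div 2)) \<psi>)" for \<psi>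
        by (simp add: fock_bit_def)
      from stable[of "prod_encode (i, m)"] show ?thesis unfolding bit by blast
    qed
    have le: "cmod (cinner (fock n) (\<psi> k)) \<le> 1" for k
      using cmod_cinner_le[of "fock n" "\<psi> k"] \<psi>(1) by simp
    have "convergent (\<lambda>k. Re (cinner (fock n) (\<psi> k)))"
    proof (rule convergent_of_rational_cuts)
      show "\<bar>Re (cinner (fock n) (\<psi> k))\<bar> \<le> 1" for k by (rule order_trans[OF abs_Re_le_cmod le])
    qed (use cut[of _ "2 * n"] in simp)
    moreover have "convergent (\<lambda>k. Im (cinner (fock n) (\<psi> k)))"
    proof (rule convergent_of_rational_cuts)
      show "\<bar>Im (cinner (fock n) (\<psi> k))\<bar> \<le> 1" for k by (rule order_trans[OF abs_Im_le_cmod le])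
    qed (use cut[of _ "2 * n + 1"] in simp)
    ultimately obtain a b where ab: "(\<lambda>k. Re (cinner (fock n) (\<psi> k))) \<longlonglongrightarrow> a"
      "(\<lambda>k. Im (cinner (fock n) (\<psi> k))) \<longlonglongrightarrow> b"
      by (auto simp: convergent_def)
    have "(\<lambda>k. cinner (fock n) (\<psi> k)) \<longlonglongrightarrow> Complex a b" using tendsto_Complex[OF ab] by simp
    then show ?thesis by (auto simp: convergent_def)
  qed
  have "0 \<le> C" unfolding C_def by (rule of_nat_0_le_iff)
  from Cauchy_of_energy_bounded[OF bound this conv] show ?thesis .
qed

text \<open>Makes bounds on the energy into bounds on the code, for tightness. The constant is 3 for
  rounding the energy up plus 3/2 for the ternary part.\<close>

lemma fock_code_le: "\<bar>fock_code \<psi>\<bar> \<le> 3 * enn2real (energy \<psi>) + 9 / 2"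
proof -
  have "real (nat \<lceil>enn2real (energy \<psi>)\<rceil>) \<le> enn2real (energy \<psi>) + 1"
    using of_int_ceiling_le_add_one[of "enn2real (energy \<psi>)"] by simp
  then show ?thesis
    using code_range[of "nat \<lceil>enn2real (energy \<psi>)\<rceil>" "\<lambda>j. fock_bit j \<psi>"]
    unfolding fock_code_def by linarith
qed

section \<open>States, mean energy and decompositions\<close>

interpretation trace_metric: Metric_space trace_class "\<lambda>S T. enn2real (trace_norm (S - T))"
  by (rule Metric_space_trace_class)

lemma trace_norm_topology_eq: "trace_norm_topology = trace_metric.mtopology"
  by (rule trace_norm_topology_def)

lemma norm_diff_le_trace_distance:
  assumes "S \<in> trace_class" "T \<in> trace_class"
  shows "norm (S - T) \<le> enn2real (trace_norm (S - T))"
proof (rule norm_le_trace_norm)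
  show "complex_linear_op (S - T)" using assms by (simp add: trace_class_def complex_linear_op_diff)
  show "trace_norm (S - T) \<le> ennreal (enn2real (trace_norm (S - T)))"
    using trace_norm_diff_finite[OF assms] by (simp add: less_top)
qed simp

text \<open>Partial sums are continuous in operator norm, so the condition is closed, while the full
  sum is only lower semicontinuous.\<close>

definition mean_energy_le :: "(l2 \<Rightarrow>\<^sub>L l2) \<Rightarrow> real \<Rightarrow> bool" where
  "mean_energy_le \<rho> E \<longleftrightarrow> (\<forall>N. (\<Sum>n<N. real n * population \<rho> n) \<le> E)"

lemma cinner_pure_state: "cinner u (pure_state \<psi> v) = cinner \<psi> v * cinner u \<psi>"
  by (simp add: pure_state.rep_eq cinner_cscale_right)

lemma cinner_pure_state_diag: "cinner u (pure_state \<psi> u) = complex_of_real ((cmod (cinner u \<psi>))\<^sup>2)"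
  unfolding cinner_pure_state by (subst cinner_commute[of \<psi>]) (metis complex_norm_square mult.commute)

lemma abs_diag_diff_le:
  "\<bar>(\<Sum>n<N. real n * population \<rho> n) - (\<Sum>n<N. real n * population \<sigma> n)\<bar>
    \<le> (\<Sum>n<N. real n) * norm (\<rho> - \<sigma>)" for \<rho> \<sigma> :: "l2 \<Rightarrow>\<^sub>L l2"
proof -
  have "\<bar>(\<Sum>n<N. real n * population \<rho> n) - (\<Sum>n<N. real n * population \<sigma> n)\<bar>
      = \<bar>\<Sum>n<N. real n * population (\<rho> - \<sigma>) n\<bar>"
    by (simp add: blinfun.diff_left cinner.diff_right right_diff_distrib sum_subtractf)
  also have "\<dots> \<le> (\<Sum>n<N. \<bar>real n * population (\<rho> - \<sigma>) n\<bar>)" by (rule sum_abs)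
  also have "\<dots> \<le> (\<Sum>n<N. real n * norm (\<rho> - \<sigma>))"
  proof (intro sum_mono)
    fix n
    have "\<bar>population (\<rho> - \<sigma>) n\<bar> \<le> cmod (cinner (fock n) ((\<rho> - \<sigma>) (fock n)))"
      by (rule abs_Re_le_cmod)
    also have "\<dots> \<le> norm (fock n) * norm ((\<rho> - \<sigma>) (fock n))" by (rule cmod_cinner_le)
    also have "\<dots> \<le> norm (\<rho> - \<sigma>)" using norm_blinfun[of "\<rho> - \<sigma>" "fock n"] by simp
    finally show "\<bar>real n * population (\<rho> - \<sigma>) n\<bar> \<le> real n * norm (\<rho> - \<sigma>)"
      by (simp add: abs_mult mult_left_mono)
  qed
  finally show ?thesis by (simp add: sum_distrib_right)
qed

text \<open>For each \<open>N\<close> the truncated mean energy \<open>L\<close> is a linear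
  functional continuous in operator norm and hence in trace norm. The set \<open>L T \<le> E\<close>
  is thus a closed half-space containing the generating pure states.\<close>

lemma mean_energy_le_energy_bounded:
  assumes E: "0 \<le> E" and \<rho>: "\<rho> \<in> energy_bounded E"
  shows "mean_energy_le \<rho> E"
  unfolding mean_energy_le_def
proof
  fix N
  define L where "L T = (\<Sum>n<N. real n * population T n)" for T :: "l2 \<Rightarrow>\<^sub>L l2"
  let ?P = "{pure_state \<psi> |\<psi>. norm \<psi> = 1 \<and> energy \<psi> \<le> ennreal E}"
  have "convex {T. L T \<le> E}"
  proof (rule convexI)
    fix S T and u v :: real
    assume "S \<in> {T. L T \<le> E}" "T \<in> {T. L T \<le> E}" and uv: "0 \<le> u" "0 \<le> v" "u + v = 1"
    then have "u * L S + v * L T \<le> u * E + v * E" by (intro add_mono mult_left_mono) auto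
    also have "u * E + v * E = E" using uv by (simp flip: distrib_right)
    also have "u * L S + v * L T = L (u *\<^sub>R S + v *\<^sub>R T)"
      by (simp add: L_def blinfun.add_left blinfun.scaleR_left cinner.add_right cinner.scaleR_right
          distrib_left sum.distrib sum_distrib_left mult_ac)
    finally show "u *\<^sub>R S + v *\<^sub>R T \<in> {T. L T \<le> E}" by simp
  qed
  moreover have "?P \<subseteq> {T. L T \<le> E}"
    using energy_partial_sum_le[OF _ E] by (auto simp: L_def cinner_pure_state_diag simp del: of_real_power)
  ultimately have hull: "convex hull ?P \<subseteq> {T. L T \<le> E}" by (intro hull_minimal)
  have "L \<rho> \<le> E"
  proof (rule real_le_of_approx)
    fix e :: real assume "0 < e"
    then obtain S where S: "S \<in> convex hull ?P" "S \<in> trace_metric.mball \<rho> e"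
      using \<rho> by (auto simp: energy_bounded_def cch_def trace_norm_topology_eq trace_metric.metric_closure_of)
    then have "norm (\<rho> - S) < e"
      using norm_diff_le_trace_distance[of \<rho> S] by (auto simp: trace_metric.in_mball)
    then have "(\<Sum>n<N. real n) * norm (\<rho> - S) \<le> (\<Sum>n<N. real n) * e"
      by (intro mult_left_mono sum_nonneg) auto
    moreover have "L S \<le> E" using hull S(1) by auto
    ultimately show "L \<rho> \<le> E + (\<Sum>n<N. real n) * e"
      using abs_diag_diff_le[where N = N and \<rho> = \<rho> and \<sigma> = S] unfolding L_def by linarith
  qed (simp add: sum_nonneg)
  then show "(\<Sum>n<N. real n * population \<rho> n) \<le> E" by (simp add: L_def)
qed

lemma cinner_positive_diag:
  assumes "positive_op \<rho>"
  shows "cinner u (\<rho> u) = complex_of_real (Re (cinner u (\<rho> u)))"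
  using assms by (auto simp: positive_op_def complex_nonneg_Reals_iff complex_eq_iff)

text \<open>A positive operator is its own absolute value, so trace norm and trace are the same
  series of populations, read in \<open>ennreal\<close> and in the complex numbers; finiteness of
  the former yields the summability that the latter needs.\<close>

lemma states_iff:
  "\<rho> \<in> states \<longleftrightarrow> positive_op \<rho> \<and> (\<Sum>n. ennreal (population \<rho> n)) = 1"
proof (cases "positive_op \<rho>")
  case True
  let ?p = "\<lambda>n. population \<rho> n"
  have p0: "0 \<le> ?p n" for n by (rule Re_cinner_positive[OF True])
  have tn: "trace_norm \<rho> = (\<Sum>n. ennreal (?p n))"
    by (simp add: trace_norm_def abs_op_positive[OF True])
  have tr: "trace_op \<rho> = (\<Sum>n. complex_of_real (?p n))"
    unfolding trace_op_def by (subst cinner_positive_diag[OF True]) (rule refl)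
  show ?thesis
  proof
    assume "\<rho> \<in> states"
    then have fin: "trace_norm \<rho> < \<infinity>" and one: "trace_op \<rho> = 1" by (auto simp: states_def trace_class_def)
    have sm: "summable ?p"
      by (rule summable_suminf_not_top) (use fin p0 in \<open>auto simp: tn\<close>)
    have "complex_of_real (\<Sum>n. ?p n) = 1"
      using one by (simp add: tr suminf_of_real[OF sm])
    then have "(\<Sum>n. ?p n) = 1" by (simp only: of_real_eq_1_iff)
    then show "positive_op \<rho> \<and> (\<Sum>n. ennreal (?p n)) = 1"
      using suminf_ennreal2[OF p0 sm] True by simp
  next
    assume "positive_op \<rho> \<and> (\<Sum>n. ennreal (?p n)) = 1"
    then have one: "(\<Sum>n. ennreal (?p n)) = 1" by simp
    then have sm: "summable ?p" by (intro summable_suminf_not_top) (auto simp: p0)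
    then have "ennreal (\<Sum>n. ?p n) = 1" using suminf_ennreal2[OF p0 sm] one by simp
    then have "(\<Sum>n. ?p n) = 1" by (simp add: ennreal_eq_1)
    then have "trace_op \<rho> = 1"
      using suminf_of_real[OF sm, where 'a = complex] by (simp add: tr)
    then show "\<rho> \<in> states"
      using True one by (simp add: states_def trace_class_def tn positive_op_linear)
  qed
qed (simp add: states_def)

text \<open>The cutoff \<open>N\<close> is fixed by the energy tail first, and only then
  \<open>d\<close> by \<open>N\<close>. The resulting \<open>d\<close> depends on \<open>E\<close>
  and \<open>e\<close> alone.\<close>

lemma trace_distance_le_of_norm_close:
  assumes E: "0 \<le> E" and e: "0 < e"
  shows "\<exists>d>0. \<forall>\<rho> \<sigma>. \<rho> \<in> states \<longrightarrow> mean_energy_le \<rho> E \<longrightarrow> \<sigma> \<in> states \<longrightarrow> mean_energy_le \<sigma> E \<longrightarrow>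
    norm (\<rho> - \<sigma>) < d \<longrightarrow> enn2real (trace_norm (\<rho> - \<sigma>)) < e"
proof -
  \<comment> \<open>Chosen so that sqrt(E/N) is at most \<open>e / 8\<close>: both tails together
    cost \<open>e / 4\<close>, and \<open>d = e / (2 N)\<close> below keeps the first
    \<open>N\<close> entries under \<open>e / 2\<close>.\<close>
  obtain N0 :: nat where "64 * E / e\<^sup>2 < real N0" using reals_Archimedean2 by blast
  moreover define N where "N = Suc N0"
  ultimately have N: "0 < N" "64 * E / e\<^sup>2 < real N" by auto
  have "sqrt (E / real N) \<le> sqrt ((e / 8)\<^sup>2)"
    using N e by (intro real_sqrt_le_mono) (simp add: field_simps power2_eq_square)
  then have tail: "sqrt (E / real N) \<le> e / 8" using e by simp
  show ?thesis
  proof (intro exI[of _ "e / (2 * real N)"] conjI allI impI)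
    show "0 < e / (2 * real N)" using e N by simp
    fix \<rho> \<sigma>
    assume \<rho>: "\<rho> \<in> states" "mean_energy_le \<rho> E" and \<sigma>: "\<sigma> \<in> states" "mean_energy_le \<sigma> E"
      and close: "norm (\<rho> - \<sigma>) < e / (2 * real N)"
    have "trace_norm (\<rho> - \<sigma>) \<le> ennreal (real N * norm (\<rho> - \<sigma>) + 2 * sqrt (E / real N))"
      by (rule trace_norm_diff_le) (use \<rho> \<sigma> N in \<open>auto simp: states_iff mean_energy_le_def\<close>)
    then have "enn2real (trace_norm (\<rho> - \<sigma>)) \<le> real N * norm (\<rho> - \<sigma>) + 2 * sqrt (E / real N)"
      using E by (intro enn2real_leI) auto
    also have "\<dots> < e"
    proof -
      have "real N * norm (\<rho> - \<sigma>) < e / 2" using close N by (simp add: field_simps)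
      then show ?thesis using tail e by simp
    qed
    finally show "enn2real (trace_norm (\<rho> - \<sigma>)) < e" .
  qed
qed

section \<open>Barycentres of measures on unit vectors\<close>

lemma decompositionsD:
  assumes "M \<in> decompositions \<rho>"
  shows "prob_space M" "\<And>\<psi>. \<psi> \<in> space M \<Longrightarrow> norm \<psi> = 1"
    "sets M = sets (restrict_space borel (space M))"
    "cinner u (\<rho> v) = (\<integral>\<psi>. cinner u (pure_state \<psi> v) \<partial>M)"
  using assms by (auto simp: decompositions_def)

text \<open>The space of \<open>M\<close> may be a set that is not Borel; what matters is that
  \<open>M\<close> carries the trace of the Borel sigma-algebra on it.\<close>

lemma measurable_decomposition:
  assumes "M \<in> decompositions \<rho>" and f: "f \<in> borel_measurable borel"
  shows "f \<in> borel_measurable M"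
proof -
  have "f \<in> borel_measurable (restrict_space borel (space M))" by (rule measurable_restrict_space1[OF f])
  then show ?thesis by (simp only: measurable_cong_sets[OF decompositionsD(3)[OF assms(1)] refl])
qed

lemma measurable_cinner_left [measurable]: "(\<lambda>\<psi>. cinner \<psi> v) \<in> borel_measurable borel"
  by (intro borel_measurable_continuous_onI linear_continuous_on cinner.bounded_linear_left)

lemma measurable_matrix_element: "(\<lambda>\<psi>. cinner u (pure_state \<psi> v)) \<in> borel_measurable borel"
  unfolding cinner_pure_state by measurable

text \<open>On unit vectors the integrand is bounded, so the Bochner integral of the definition is a
  genuine one and can be replaced by a nonnegative integral, which exchanges with sums over the Fock
  basis.\<close>

lemma nn_integral_decomposition_diag:
  assumes M: "M \<in> decompositions \<rho>"
  shows "(\<integral>\<^sup>+\<psi>. ennreal ((cmod (cinner u \<psi>))\<^sup>2) \<partial>M) = ennreal (Re (cinner u (\<rho> u)))"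
    "cinner u (\<rho> u) \<in> \<real>\<^sub>\<ge>\<^sub>0"
proof -
  interpret prob_space M by (rule decompositionsD(1)[OF M])
  have meas: "(\<lambda>\<psi>. (cmod (cinner u \<psi>))\<^sup>2) \<in> borel_measurable M"
    by (rule measurable_decomposition[OF M]) measurable
  have int: "integrable M (\<lambda>\<psi>. (cmod (cinner u \<psi>))\<^sup>2)"
  proof (rule integrable_const_bound[OF _ meas])
    show "AE \<psi> in M. norm ((cmod (cinner u \<psi>))\<^sup>2) \<le> (norm u)\<^sup>2"
    proof (rule AE_I2)
      fix \<psi> assume "\<psi> \<in> space M"
      then have "cmod (cinner u \<psi>) \<le> norm u"
        using cmod_cinner_le[of u \<psi>] decompositionsD(2)[OF M] by simp
      then show "norm ((cmod (cinner u \<psi>))\<^sup>2) \<le> (norm u)\<^sup>2" by (simp add: power_mono)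
    qed
  qed
  have eq: "cinner u (\<rho> u) = complex_of_real (\<integral>\<psi>. (cmod (cinner u \<psi>))\<^sup>2 \<partial>M)"
    unfolding decompositionsD(4)[OF M] cinner_pure_state_diag by (rule integral_complex_of_real)
  show "cinner u (\<rho> u) \<in> \<real>\<^sub>\<ge>\<^sub>0"
    unfolding eq by (simp add: complex_nonneg_Reals_iff)
  show "(\<integral>\<^sup>+\<psi>. ennreal ((cmod (cinner u \<psi>))\<^sup>2) \<partial>M) = ennreal (Re (cinner u (\<rho> u)))"
    unfolding eq using nn_integral_eq_integral[OF int] by simp
qed

text \<open>Parseval under the integral gives trace 1. Hence the limit operator is a state as soon
  as it is a barycentre, with no separate passage to the limit for the trace.\<close>

lemma states_of_decomposition:
  assumes M: "M \<in> decompositions \<rho>"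
  shows "\<rho> \<in> states"
proof -
  interpret prob_space M by (rule decompositionsD(1)[OF M])
  have "positive_op \<rho>"
    unfolding positive_op_def
  proof (intro conjI allI nn_integral_decomposition_diag(2)[OF M])
    show "complex_linear_op \<rho>"
      unfolding complex_linear_op_def
    proof (intro allI cinner_ext)
      fix c u w
      show "cinner w (\<rho> (c *\<^sub>c u)) = cinner w (c *\<^sub>c \<rho> u)"
        unfolding cinner_cscale_right decompositionsD(4)[OF M] cinner_pure_state
        by (simp add: mult.assoc cinner_cscale_right)
    qed
  qed
  moreover have "(\<Sum>n. ennreal (population \<rho> n)) = 1"
  proof -
    have "(\<Sum>n. ennreal (population \<rho> n)) =
        (\<Sum>n. \<integral>\<^sup>+\<psi>. ennreal ((cmod (cinner (fock n) \<psi>))\<^sup>2) \<partial>M)"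
      by (simp only: nn_integral_decomposition_diag(1)[OF M])
    also have "\<dots> = (\<integral>\<^sup>+\<psi>. (\<Sum>n. ennreal ((cmod (cinner (fock n) \<psi>))\<^sup>2)) \<partial>M)"
      by (intro nn_integral_suminf[symmetric] measurable_decomposition[OF M]) measurable
    also have "\<dots> = (\<integral>\<^sup>+\<psi>. 1 \<partial>M)"
      unfolding parseval_ennreal by (intro nn_integral_cong) (simp add: decompositionsD(2)[OF M])
    also have "\<dots> = 1" by (simp add: emeasure_space_1)
    finally show ?thesis .
  qed
  ultimately show ?thesis by (simp add: states_iff)
qed

lemma nn_integral_energy_le:
  assumes M: "M \<in> decompositions \<rho>" and E: "mean_energy_le \<rho> E" "0 \<le> E"
  shows "(\<integral>\<^sup>+\<psi>. energy \<psi> \<partial>M) \<le> ennreal E"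
proof -
  have p0: "0 \<le> population \<rho> n" for n
    using states_of_decomposition[OF M] Re_cinner_positive by (auto simp: states_iff)
  have "(\<integral>\<^sup>+\<psi>. energy \<psi> \<partial>M) = (\<Sum>n. \<integral>\<^sup>+\<psi>. ennreal (of_nat n * (cmod (cinner (fock n) \<psi>))\<^sup>2) \<partial>M)"
    unfolding energy_def by (intro nn_integral_suminf measurable_decomposition[OF M]) measurable
  also have "\<dots> = (\<Sum>n. ennreal (real n * population \<rho> n))"
  proof (rule suminf_cong)
    fix n
    have "(\<integral>\<^sup>+\<psi>. ennreal (of_nat n * (cmod (cinner (fock n) \<psi>))\<^sup>2) \<partial>M) =
        (\<integral>\<^sup>+\<psi>. ennreal (real n) * ennreal ((cmod (cinner (fock n) \<psi>))\<^sup>2) \<partial>M)"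
      by (simp add: ennreal_mult)
    also have "\<dots> = ennreal (real n) * (\<integral>\<^sup>+\<psi>. ennreal ((cmod (cinner (fock n) \<psi>))\<^sup>2) \<partial>M)"
      by (intro nn_integral_cmult measurable_decomposition[OF M]) measurable
    also have "\<dots> = ennreal (real n * population \<rho> n)"
      by (simp add: nn_integral_decomposition_diag(1)[OF M] ennreal_mult p0)
    finally show "(\<integral>\<^sup>+\<psi>. ennreal (of_nat n * (cmod (cinner (fock n) \<psi>))\<^sup>2) \<partial>M) =
        ennreal (real n * population \<rho> n)" .
  qed
  also have "\<dots> \<le> ennreal E"
  proof (rule suminf_le_const[OF summableI])
    fix N
    have "(\<Sum>n<N. ennreal (real n * population \<rho> n)) =
        ennreal (\<Sum>n<N. real n * population \<rho> n)"
      by (rule sum_ennreal) (simp add: p0)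
    also have "\<dots> \<le> ennreal E" using E(1) by (intro ennreal_leI) (simp add: mean_energy_le_def)
    finally show "(\<Sum>n<N. ennreal (real n * population \<rho> n)) \<le> ennreal E" .
  qed
  finally show ?thesis .
qed

text \<open>Markov's inequality for the energy; the threshold is the bound of
  \<open>fock_code_le\<close> for vectors of energy \<open>c\<close>.\<close>

lemma measure_energy_gt_le:
  assumes M: "M \<in> decompositions \<rho>" and E: "mean_energy_le \<rho> E" "0 \<le> E" and c: "0 < c"
  shows "measure M {\<psi> \<in> space M. 3 * c + 9 / 2 < \<bar>fock_code \<psi>\<bar>} \<le> E / c"
proof -
  interpret prob_space M by (rule decompositionsD(1)[OF M])
  have [measurable]: "fock_code \<in> borel_measurable M" "energy \<in> borel_measurable M"
    by (intro measurable_decomposition[OF M] measurable_fock_code measurable_energy)+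
  let ?A = "{\<psi> \<in> space M. 3 * c + 9 / 2 < \<bar>fock_code \<psi>\<bar>}"
  have A: "?A \<in> sets M" by measurable
  have "ennreal c * emeasure M ?A = (\<integral>\<^sup>+\<psi>. ennreal c * indicator ?A \<psi> \<partial>M)"
    using A by (simp add: nn_integral_cmult_indicator)
  also have "\<dots> \<le> (\<integral>\<^sup>+\<psi>. energy \<psi> \<partial>M)"
  proof (intro nn_integral_mono)
    fix \<psi>
    show "ennreal c * indicator ?A \<psi> \<le> energy \<psi>"
    proof (cases "\<psi> \<in> ?A")
      case True
      then have "c < enn2real (energy \<psi>)" using fock_code_le[of \<psi>] by simp
      then have "ennreal c \<le> energy \<psi>"
        using c by (metis ennreal_enn2real_if ennreal_leI less_imp_le top_greatest)
      then show ?thesis using True by simp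
    qed simp
  qed
  also have "\<dots> \<le> ennreal E" by (rule nn_integral_energy_le[OF M E])
  finally have "ennreal (c * prob ?A) \<le> ennreal E"
    using c by (simp add: emeasure_eq_measure ennreal_mult)
  then have "c * prob ?A \<le> E" using E(2) by (subst (asm) ennreal_le_iff) auto
  then show ?thesis using c by (simp add: field_simps)
qed

text \<open>The infimum is attained because the values are discrete: one that lies below
  \<open>r + 1\<close> is at most \<open>r\<close>. So a rank bound always comes with a
  decomposition that realises it.\<close>

lemma stellar_rank_le_iff:
  "stellar_rank \<rho> \<le> enat r \<longleftrightarrow> (\<exists>M\<in>decompositions \<rho>. space M \<subseteq> low_rank r)"
proof
  assume le: "stellar_rank \<rho> \<le> enat r"
  have "\<exists>M\<in>decompositions \<rho>. (SUP \<psi>\<in>space M. pure_stellar_rank \<psi>) < enat (Suc r)"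
  proof (rule ccontr)
    assume "\<not> ?thesis"
    then have "enat (Suc r) \<le> stellar_rank \<rho>"
      unfolding stellar_rank_def by (intro INF_greatest) (auto simp: not_less)
    with le have "enat (Suc r) \<le> enat r" by (rule order_trans[rotated])
    then show False by simp
  qed
  then obtain M where M: "M \<in> decompositions \<rho>" "(SUP \<psi>\<in>space M. pure_stellar_rank \<psi>) < enat (Suc r)" by blast
  have "pure_stellar_rank \<psi> \<le> enat r" if "\<psi> \<in> space M" for \<psi>
  proof -
    have "pure_stellar_rank \<psi> < enat (Suc r)"
      by (rule le_less_trans[OF SUP_upper[OF that] M(2)])
    then show ?thesis by (cases "pure_stellar_rank \<psi>") auto
  qed
  then show "\<exists>M\<in>decompositions \<rho>. space M \<subseteq> low_rank r"
    using M(1) decompositionsD(2)[OF M(1)] by (auto simp: low_rank_def)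
next
  assume "\<exists>M\<in>decompositions \<rho>. space M \<subseteq> low_rank r"
  then obtain M where M: "M \<in> decompositions \<rho>" "space M \<subseteq> low_rank r" by blast
  have "stellar_rank \<rho> \<le> (SUP \<psi>\<in>space M. pure_stellar_rank \<psi>)"
    unfolding stellar_rank_def by (rule INF_lower[OF M(1)])
  also have "\<dots> \<le> enat r" by (rule SUP_least) (use M(2) in \<open>auto simp: low_rank_def\<close>)
  finally show "stellar_rank \<rho> \<le> enat r" .
qed

section \<open>Compactness\<close>

lemma matrix_element_lipschitz:
  assumes "norm \<psi> = 1" "norm \<eta> = 1"
  shows "cmod (cinner u (pure_state \<psi> v) - cinner u (pure_state \<eta> v)) \<le> 2 * norm u * norm v * dist \<psi> \<eta>"
proof -
  have "cinner u (pure_state \<psi> v) - cinner u (pure_state \<eta> v) =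
      cinner (\<psi> - \<eta>) v * cinner u \<psi> + cinner \<eta> v * cinner u (\<psi> - \<eta>)"
    by (simp add: cinner_pure_state cinner.diff_left cinner.diff_right algebra_simps)
  also have "cmod \<dots> \<le> cmod (cinner (\<psi> - \<eta>) v) * cmod (cinner u \<psi>) + cmod (cinner \<eta> v) * cmod (cinner u (\<psi> - \<eta>))"
    by (metis norm_mult norm_triangle_ineq)
  also have "\<dots> \<le> (norm (\<psi> - \<eta>) * norm v) * (norm u * norm \<psi>) + (norm \<eta> * norm v) * (norm u * norm (\<psi> - \<eta>))"
    by (intro add_mono mult_mono cmod_cinner_le) auto
  also have "\<dots> = 2 * norm u * norm v * dist \<psi> \<eta>" using assms by (simp add: dist_norm)
  finally show ?thesis .
qed

text \<open>The bound depends on \<open>u\<close> and \<open>v\<close> only through their norms,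
  which turns convergence of random vectors in mean into convergence of barycentres in operator
  norm.\<close>

lemma integral_matrix_element_diff_le:
  fixes \<phi> \<eta> :: "real \<Rightarrow> l2"
  assumes \<Omega>: "prob_space \<Omega>"
    and \<phi>: "\<phi> \<in> measurable \<Omega> (restrict_space borel (low_rank r))"
    and \<eta>: "\<eta> \<in> measurable \<Omega> (restrict_space borel (low_rank r))"
    and h: "integrable \<Omega> h" "AE x in \<Omega>. dist (\<phi> x) (\<eta> x) \<le> h x"
  shows "cmod ((\<integral>x. cinner u (pure_state (\<phi> x) v) \<partial>\<Omega>) - (\<integral>x. cinner u (pure_state (\<eta> x) v) \<partial>\<Omega>))
    \<le> 2 * norm u * norm v * (\<integral>x. h x \<partial>\<Omega>)"
proof -
  interpret prob_space \<Omega> by (rule \<Omega>)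
  have unit: "norm (\<tau> x) = 1"
    if "\<tau> \<in> measurable \<Omega> (restrict_space borel (low_rank r))" "x \<in> space \<Omega>" for \<tau> x
    using measurable_space[OF that] by (simp add: space_restrict_space low_rank_def)
  have int: "integrable \<Omega> (\<lambda>x. cinner u (pure_state (\<tau> x) v))"
    if \<tau>: "\<tau> \<in> measurable \<Omega> (restrict_space borel (low_rank r))" for \<tau>
  proof (rule integrable_const_bound)
    show "AE x in \<Omega>. norm (cinner u (pure_state (\<tau> x) v)) \<le> norm v * norm u"
    proof (rule AE_I2)
      fix x assume "x \<in> space \<Omega>"
      then have "norm (\<tau> x) = 1" by (rule unit[OF \<tau>])
      then show "norm (cinner u (pure_state (\<tau> x) v)) \<le> norm v * norm u"
        using mult_mono[OF cmod_cinner_le[of "\<tau> x" v] cmod_cinner_le[of u "\<tau> x"]]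
        by (simp add: cinner_pure_state norm_mult)
    qed
    have "\<tau> \<in> borel_measurable \<Omega>" using \<tau> by (simp add: measurable_restrict_space2_iff)
    from measurable_compose[OF this measurable_matrix_element]
    show "(\<lambda>x. cinner u (pure_state (\<tau> x) v)) \<in> borel_measurable \<Omega>" .
  qed
  have "cmod ((\<integral>x. cinner u (pure_state (\<phi> x) v) \<partial>\<Omega>) - (\<integral>x. cinner u (pure_state (\<eta> x) v) \<partial>\<Omega>)) =
      cmod (\<integral>x. cinner u (pure_state (\<phi> x) v) - cinner u (pure_state (\<eta> x) v) \<partial>\<Omega>)"
    by (subst Bochner_Integration.integral_diff[OF int[OF \<phi>] int[OF \<eta>]]) (rule refl)
  also have "\<dots> \<le> (\<integral>x. cmod (cinner u (pure_state (\<phi> x) v) - cinner u (pure_state (\<eta> x) v)) \<partial>\<Omega>)"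
    by (rule integral_norm_bound)
  also have "\<dots> \<le> (\<integral>x. 2 * norm u * norm v * h x \<partial>\<Omega>)"
  proof (rule integral_mono_AE)
    show "integrable \<Omega> (\<lambda>x. cmod (cinner u (pure_state (\<phi> x) v) - cinner u (pure_state (\<eta> x) v)))"
      by (intro integrable_norm Bochner_Integration.integrable_diff int \<phi> \<eta>)
    show "integrable \<Omega> (\<lambda>x. 2 * norm u * norm v * h x)" using h(1) by simp
    show "AE x in \<Omega>. norm (cinner u (pure_state (\<phi> x) v) - cinner u (pure_state (\<eta> x) v)) \<le> 2 * norm u * norm v * h x"
      using h(2) AE_space
    proof eventually_elim
      case (elim x)
      have "norm (cinner u (pure_state (\<phi> x) v) - cinner u (pure_state (\<eta> x) v)) \<le>
          2 * norm u * norm v * dist (\<phi> x) (\<eta> x)"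
        by (intro matrix_element_lipschitz unit[OF \<phi>] unit[OF \<eta>] elim)
      also have "\<dots> \<le> 2 * norm u * norm v * h x" by (intro mult_left_mono elim) simp
      finally show ?case .
    qed
  qed
  finally show ?thesis by simp
qed

lemma norm_blinfun_le_of_cinner:
  fixes T :: "l2 \<Rightarrow>\<^sub>L l2"
  assumes "\<And>u v. cmod (cinner u (T v)) \<le> norm u * norm v * b" "0 \<le> b"
  shows "norm T \<le> b"
proof (rule norm_blinfun_bound[OF assms(2)])
  fix v
  show "norm (T v) \<le> b * norm v"
  proof (cases "T v = 0")
    case False
    have "(norm (T v))\<^sup>2 = cmod (cinner (T v) (T v))" by (simp add: cinner_self norm_power)
    also have "\<dots> \<le> norm (T v) * norm v * b" by (rule assms(1))
    finally show ?thesis using False by (simp add: power2_eq_square mult_ac)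
  qed (use assms(2) in simp)
qed

text \<open>The subsequence is Cauchy in operator norm, so its limit exists by completeness and need
  not be constructed from the form \<open>L\<close>; it only remains to recognise \<open>L\<close>
  as its matrix elements. The limit law then is a decomposition of the limit.\<close>

theorem low_rank_mixtures_limit:
  fixes \<rho> :: "nat \<Rightarrow> (l2 \<Rightarrow>\<^sub>L l2)"
  assumes E: "0 \<le> E" and energy: "\<And>k. mean_energy_le (\<rho> k) E"
    and rank: "\<And>k. stellar_rank (\<rho> k) \<le> enat r"
  shows "\<exists>f \<sigma>. strict_mono f \<and> (\<rho> \<circ> f) \<longlonglongrightarrow> \<sigma> \<and>
    \<sigma> \<in> states \<and> mean_energy_le \<sigma> E \<and> stellar_rank \<sigma> \<le> enat r"
proof -
  have "\<forall>k. \<exists>M. M \<in> decompositions (\<rho> k) \<and> space M \<subseteq> low_rank r"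
    using rank unfolding stellar_rank_le_iff by blast
  then obtain M where M: "\<And>k. M k \<in> decompositions (\<rho> k)" and space_M: "\<And>k. space (M k) \<subseteq> low_rank r"
    by metis
  define G where "G = {\<psi> \<in> low_rank r. energy \<psi> < \<infinity>}"
  have GR: "G \<subseteq> low_rank r" by (auto simp: G_def)
  have bounded: "bounded (low_rank r)"
    by (rule bounded_subset[of "cball 0 1"]) (auto simp: low_rank_def)
  have cauchy: "Cauchy \<psi>" if "range \<psi> \<subseteq> G" "Cauchy (fock_code \<circ> \<psi>)" for \<psi>
    by (rule Cauchy_of_fock_code[OF _ _ that(2)]) (use that(1) in \<open>auto simp: G_def low_rank_def\<close>)
  have AE_G: "AE \<psi> in M k. \<psi> \<in> G" for k
  proof -
    have "(\<integral>\<^sup>+\<psi>. energy \<psi> \<partial>M k) \<noteq> \<infinity>"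
      using nn_integral_energy_le[OF M energy E, of k] by (auto simp: top_unique)
    then have "AE \<psi> in M k. energy \<psi> \<noteq> \<infinity>"
      by (intro nn_integral_PInf_AE measurable_decomposition[OF M] measurable_energy)
    then show ?thesis
      using AE_space
    proof eventually_elim
      case (elim \<psi>)
      then show ?case using space_M[of k] by (auto simp: G_def less_top)
    qed
  qed
  have tight: "\<exists>a. \<forall>k. measure (M k) {\<psi> \<in> space (M k). a < \<bar>fock_code \<psi>\<bar>} < e" if e: "0 < e" for e
  proof (intro exI allI)
    fix k
    \<comment> \<open>The summand 1 makes \<open>c\<close> positive and \<open>E / c < e\<close>
      strict also for \<open>E = 0\<close>.\<close>
    define c where "c = (E + 1) / e"
    have c: "0 < c" using E e by (simp add: c_def)
    have "measure (M k) {\<psi> \<in> space (M k). 3 * c + 9 / 2 < \<bar>fock_code \<psi>\<bar>} \<le> E / c"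
      by (rule measure_energy_gt_le[OF M energy E c])
    also have "\<dots> < e" using E e by (simp add: c_def field_simps)
    finally show "measure (M k) {\<psi> \<in> space (M k). 3 * ((E + 1) / e) + 9 / 2 < \<bar>fock_code \<psi>\<bar>} < e"
      by (simp add: c_def)
  qed
  obtain f :: "nat \<Rightarrow> nat" and \<Omega> :: "real measure" and \<phi> \<phi>' h where f: "strict_mono f" and \<Omega>: "prob_space \<Omega>"
    and \<phi>: "\<And>k. \<phi> k \<in> measurable \<Omega> (restrict_space borel (low_rank r))"
    and \<phi>': "\<phi>' \<in> measurable \<Omega> (restrict_space borel (low_rank r))"
    and integral: "\<And>k g. g \<in> borel_measurable borel \<Longrightarrow> (\<integral>\<psi>. g \<psi> \<partial>M (f k)) = (\<integral>x. (g (\<phi> k x) :: complex) \<partial>\<Omega>)"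
    and h: "\<And>k. integrable \<Omega> (h k)" "\<And>k. AE x in \<Omega>. dist (\<phi> k x) (\<phi>' x) \<le> h k x"
    and h_lim: "(\<lambda>k. \<integral>x. h k x \<partial>\<Omega>) \<longlonglongrightarrow> 0"
    by (rule coded_skorohod[OF closed_low_rank bounded GR measurable_fock_code cauchy
          decompositionsD(1)[OF M] decompositionsD(3)[OF M] AE_G tight]) (assumption | rule that)+
  interpret \<Omega>: prob_space \<Omega> by (rule \<Omega>)
  have elem: "cinner u (\<rho> (f k) v) = (\<integral>x. cinner u (pure_state (\<phi> k x) v) \<partial>\<Omega>)" for k u v
    unfolding decompositionsD(4)[OF M] by (rule integral[OF measurable_matrix_element])
  define H where "H k = (\<integral>x. h k x \<partial>\<Omega>)" for k
  have H0: "0 \<le> H k" for k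
    unfolding H_def using h(2)[of k] by (intro integral_nonneg_AE) (auto elim!: eventually_mono intro: order_trans[OF zero_le_dist])
  define L where "L u v = (\<integral>x. cinner u (pure_state (\<phi>' x) v) \<partial>\<Omega>)" for u v
  have near: "cmod (cinner u (\<rho> (f k) v) - L u v) \<le> norm u * norm v * (2 * H k)" for k u v
    using integral_matrix_element_diff_le[OF \<Omega> \<phi>[of k] \<phi>' h(1)[of k] h(2)[of k], of u v]
    by (simp add: elem L_def H_def)
  have diff: "norm (\<rho> (f k) - \<rho> (f l)) \<le> 2 * H k + 2 * H l" for k l
  proof (rule norm_blinfun_le_of_cinner)
    fix u v
    have "cinner u ((\<rho> (f k) - \<rho> (f l)) v) =
        (cinner u (\<rho> (f k) v) - L u v) - (cinner u (\<rho> (f l) v) - L u v)"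
      by (simp add: blinfun.diff_left cinner.diff_right)
    also have "cmod \<dots> \<le> norm u * norm v * (2 * H k) + norm u * norm v * (2 * H l)"
      by (rule order_trans[OF norm_triangle_ineq4 add_mono[OF near near]])
    finally show "cmod (cinner u ((\<rho> (f k) - \<rho> (f l)) v)) \<le> norm u * norm v * (2 * H k + 2 * H l)"
      by (simp add: distrib_left)
  qed (use H0 in simp)
  have "Cauchy (\<rho> \<circ> f)"
    unfolding Cauchy_def
  proof (intro allI impI)
    fix e :: real assume "0 < e"
    then have "\<forall>\<^sub>F k in sequentially. H k < e / 4"
      using h_lim unfolding H_def by (intro order_tendstoD(2)) auto
    then obtain K where K: "\<And>k. K \<le> k \<Longrightarrow> H k < e / 4" by (auto simp: eventually_sequentially)
    show "\<exists>K. \<forall>k\<ge>K. \<forall>l\<ge>K. dist ((\<rho> \<circ> f) k) ((\<rho> \<circ> f) l) < e"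
    proof (intro exI allI impI)
      fix k l assume "K \<le> k" "K \<le> l"
      then show "dist ((\<rho> \<circ> f) k) ((\<rho> \<circ> f) l) < e"
        using diff[of k l] K[of k] K[of l] by (simp add: dist_norm)
    qed
  qed
  then obtain \<sigma> where \<sigma>: "(\<rho> \<circ> f) \<longlonglongrightarrow> \<sigma>" by (auto simp: Cauchy_convergent_iff convergent_def)
  have elem_lim: "(\<lambda>k. cinner u (\<rho> (f k) v)) \<longlonglongrightarrow> cinner u (\<sigma> v)" for u v
    using \<sigma> unfolding o_def by (intro cinner.tendsto tendsto_const blinfun.tendsto)
  have \<sigma>_elem: "cinner u (\<sigma> v) = L u v" for u v
  proof (rule LIMSEQ_unique[OF elem_lim])
    have "(\<lambda>k. norm u * norm v * (2 * H k)) \<longlonglongrightarrow> norm u * norm v * (2 * 0)"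
      using h_lim unfolding H_def by (intro tendsto_intros)
    then have "(\<lambda>k. norm u * norm v * (2 * H k)) \<longlonglongrightarrow> 0" by simp
    from Lim_null_comparison[OF always_eventually[OF allI[OF near]] this]
    show "(\<lambda>k. cinner u (\<rho> (f k) v)) \<longlonglongrightarrow> L u v" by (rule LIM_zero_cancel)
  qed
  \<comment> \<open>The law is taken on \<open>low_rank r\<close> itself, so the rank bound holds on
    the whole space of \<open>M'\<close>. Closedness of this set is what placed the limit vectors in
    it.\<close>
  define M' where "M' = distr \<Omega> (restrict_space borel (low_rank r)) \<phi>'"
  have space_M': "space M' = low_rank r" by (simp add: M'_def space_restrict_space)
  have M': "M' \<in> decompositions \<sigma>"
    unfolding decompositions_def
  proof (intro CollectI conjI allI)
    show "prob_space M'" unfolding M'_def by (rule \<Omega>.prob_space_distr[OF \<phi>'])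
    show "space M' \<subseteq> sphere 0 1" by (auto simp: space_M' low_rank_def)
    show "sets M' = sets (restrict_space borel (space M'))"
      unfolding space_M' by (simp add: M'_def)
    fix u v
    show "cinner u (\<sigma> v) = (\<integral>\<psi>. cinner u (pure_state \<psi> v) \<partial>M')"
      unfolding \<sigma>_elem L_def M'_def
      by (rule integral_distr[OF \<phi>' measurable_restrict_space1[OF measurable_matrix_element], symmetric])
  qed
  have "mean_energy_le \<sigma> E"
    unfolding mean_energy_le_def
  proof
    fix N
    have "(\<lambda>k. \<Sum>n<N. real n * Re (cinner (fock n) (\<rho> (f k) (fock n)))) \<longlonglongrightarrow>
        (\<Sum>n<N. real n * population \<sigma> n)"
      by (intro tendsto_intros elem_lim)
    then show "(\<Sum>n<N. real n * population \<sigma> n) \<le> E"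
      by (rule LIMSEQ_le_const2) (use energy in \<open>auto simp: mean_energy_le_def\<close>)
  qed
  moreover have "stellar_rank \<sigma> \<le> enat r"
    unfolding stellar_rank_le_iff using M' space_M' by blast
  moreover have "\<sigma> \<in> states" by (rule states_of_decomposition[OF M'])
  ultimately show ?thesis using f \<sigma> by blast
qed

lemma energy_bounded_rankD:
  assumes "0 \<le> E" "\<rho> \<in> energy_bounded_rank r E"
  shows "\<rho> \<in> states" "mean_energy_le \<rho> E" "stellar_rank \<rho> \<le> enat r" "\<rho> \<in> energy_bounded E"
  using assms(2) mean_energy_le_energy_bounded[OF assms(1), of \<rho>] by (simp_all add: energy_bounded_rank_def)

text \<open>Compactness for the operator norm, sequentially. Membership of the limit in
  \<open>energy_bounded E\<close> is a closed condition only in trace norm, so it needs the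
  comparison of the two norms at the limit.\<close>

lemma compact_energy_bounded_rank:
  assumes E: "0 \<le> E"
  shows "compact (energy_bounded_rank r E)"
  unfolding compact_def
proof (intro allI impI)
  fix \<rho> :: "nat \<Rightarrow> (l2 \<Rightarrow>\<^sub>L l2)" assume "\<forall>k. \<rho> k \<in> energy_bounded_rank r E"
  then have \<rho>: "\<rho> k \<in> energy_bounded_rank r E" for k by blast
  note \<rho>D = energy_bounded_rankD[OF E \<rho>]
  from low_rank_mixtures_limit[where \<rho> = \<rho>, OF E \<rho>D(2,3)]
  obtain f \<sigma> where f: "strict_mono f" and lim: "(\<rho> \<circ> f) \<longlonglongrightarrow> \<sigma>"
    and \<sigma>: "\<sigma> \<in> states" "mean_energy_le \<sigma> E" "stellar_rank \<sigma> \<le> enat r"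
    by (elim exE conjE) (rule that)
  have "\<sigma> \<in> energy_bounded E"
  proof (rule ccontr)
    assume notin: "\<sigma> \<notin> energy_bounded E"
    have "closedin trace_metric.mtopology (energy_bounded E)"
      unfolding energy_bounded_def cch_def trace_norm_topology_eq by (rule closedin_closure_of)
    moreover have "\<sigma> \<in> trace_class" using \<sigma>(1) by (simp add: states_def)
    ultimately obtain e where e: "0 < e" "disjnt (energy_bounded E) (trace_metric.mball \<sigma> e)"
      using notin unfolding trace_metric.closedin_metric by blast
    obtain d where d: "0 < d" "\<And>\<tau>. \<tau> \<in> states \<Longrightarrow> mean_energy_le \<tau> E \<Longrightarrow> norm (\<sigma> - \<tau>) < d \<Longrightarrow>
        enn2real (trace_norm (\<sigma> - \<tau>)) < e"
      using trace_distance_le_of_norm_close[OF E e(1)] \<sigma>(1,2) by blast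
    have "\<forall>\<^sub>F k in sequentially. dist ((\<rho> \<circ> f) k) \<sigma> < d" by (rule tendstoD[OF lim d(1)])
    from eventually_happens'[OF sequentially_bot this]
    obtain k where k: "dist (\<rho> (f k)) \<sigma> < d" by auto
    have "enn2real (trace_norm (\<sigma> - \<rho> (f k))) < e"
      by (rule d(2)[OF \<rho>D(1,2)]) (use k in \<open>simp add: dist_norm norm_minus_commute\<close>)
    then have "\<rho> (f k) \<in> trace_metric.mball \<sigma> e"
      using \<rho>D(1)[of "f k"] \<sigma>(1) by (simp add: states_def)
    with e(2) \<rho>D(4) show False by (auto simp: disjnt_iff)
  qed
  with \<sigma> f lim show "\<exists>l\<in>energy_bounded_rank r E. \<exists>f. strict_mono f \<and> (\<rho> \<circ> f) \<longlonglongrightarrow> l"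
    by (auto simp: energy_bounded_rank_def)
qed

text \<open>On this set the identity is continuous from the operator norm to the trace norm, and a
  continuous image of a compact set is compact.\<close>

theorem lemma6:
  fixes r :: nat and E :: real
  assumes "0 \<le> E"
  shows "compactin trace_norm_topology (energy_bounded_rank r E)"
proof -
  let ?S = "energy_bounded_rank r E"
  have "continuous_map (top_of_set ?S) trace_norm_topology id"
    unfolding trace_norm_topology_eq trace_metric.continuous_map_to_metric
  proof (intro ballI allI impI)
    fix \<rho> and e :: real assume "\<rho> \<in> topspace (top_of_set ?S)" and e: "0 < e"
    then have \<rho>: "\<rho> \<in> ?S" by simp
    obtain d where d: "0 < d" "\<And>\<sigma>. \<sigma> \<in> states \<Longrightarrow> mean_energy_le \<sigma> E \<Longrightarrow> norm (\<rho> - \<sigma>) < d \<Longrightarrow>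
        enn2real (trace_norm (\<rho> - \<sigma>)) < e"
      using trace_distance_le_of_norm_close[OF assms e] energy_bounded_rankD(1,2)[OF assms \<rho>] by blast
    show "\<exists>U. openin (top_of_set ?S) U \<and> \<rho> \<in> U \<and> (\<forall>\<sigma>\<in>U. id \<sigma> \<in> trace_metric.mball (id \<rho>) e)"
    proof (intro exI conjI ballI)
      show "openin (top_of_set ?S) (?S \<inter> ball \<rho> d)" by (simp add: openin_open_Int)
      show "\<rho> \<in> ?S \<inter> ball \<rho> d" using \<rho> d(1) by simp
      fix \<sigma> assume \<sigma>: "\<sigma> \<in> ?S \<inter> ball \<rho> d"
      have "enn2real (trace_norm (\<rho> - \<sigma>)) < e"
        by (rule d(2)) (use \<sigma> energy_bounded_rankD(1,2)[OF assms] in \<open>auto simp: dist_norm\<close>)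
      then show "id \<sigma> \<in> trace_metric.mball (id \<rho>) e"
        using \<rho> \<sigma> by (simp add: energy_bounded_rank_def states_def)
    qed
  qed
  moreover have "compactin (top_of_set ?S) ?S"
    using compact_energy_bounded_rank[OF assms] by (simp add: compactin_subtopology)
  ultimately have "compactin trace_norm_topology (id ` ?S)" by (rule image_compactin[rotated])
  then show ?thesis by simp
qed

end
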